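(* Up to equivalence of actions, there is precisely one subgroup of $\mathsf{Spin}(8)<\mathsf{SO}(8)\times\mathsf{SO}(8)$ isomorphic to $\mathsf{SU}(2)$ whose induced action on $\mathbb S^7\times\mathbb S^7$ is free. Up to equivalence, the action can be described both (a) as the Hopf action on both factors and (b) via multiplication by $\mathsf{SO}(3)$, embedded as $A\mapsto\mathrm{diag}(1,1,1,1,1,A)\in\mathsf{SO}(8)$ (precomposed with the double cover $\mathsf{SU}(2)\to\mathsf{SO}(3)$), on one factor and the Hopf action on the other. Up to conjugacy in $\mathsf{Spin}(7)$, there is precisely one subgroup of $\mathsf{Spin}(7)$ isomorphic to $\mathsf{SU}(2)$ whose induced action on $\mathbb S^6\times\mathbb S^7$ is free. This action is equivalent to the restriction of the action (b) on $\mathbb S^7\times\mathbb S^7$ to $\mathbb S^6\times\mathbb S^7$. There is no subgroup of $\mathsf{Spin}(8)$ (respectively of $\mathsf{Spin}(7)$) isomorphic to $\mathsf{SO}(3)$ whose induced action on $\mathbb S^7\times\mathbb S^7$ (respectively $\mathbb S^6\times\mathbb S^7$) is free.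
   Context: Octonions: $\mathbb O=\mathbb H\oplus\mathbb H\cong\mathbb R^8$ with product $(a_1,a_2)(b_1,b_2)=(a_1b_1-\overline{b_2}a_2,\ b_2a_1+a_2\overline{b_1})$. Triality equation: $A(x)B(y)=C(xy)$ for all $x,y\in\mathbb O$. $\mathsf{Spin}(8)$ denotes the group of all $(A,B)\in\mathsf{SO}(8)\times\mathsf{SO}(8)$ for which there is $C\in\mathsf{SO}(8)$ satisfying the triality equation; $\mathsf{Spin}(7)$ denotes its subgroup where $B=C$. $\mathsf{Spin}(8)$ acts on $\mathbb S^7\times\mathbb S^7\subset\mathbb O\oplus\mathbb O$ by $(A,B)\ast(x,y)=(Ax,By)$; $\mathsf{Spin}(7)$ acts by restriction on $\mathbb S^6\times\mathbb S^7=\{(x,y)\in\mathbb S^7\times\mathbb S^7:\mathrm{Re}(x)=0\}$. Two actions of $L$ on $M$ and $L'$ on $M'$ are equivalent if there are an isomorphism $\phi:L\to L'$ and a diffeomorphism $F:M\to M'$ with $F(g\ast m)=\phi(g)\ast F(m)$ for all $g\in L$, $m\in M$. The Hopf action of $\mathsf{SU}(2)\cong\mathsf{Sp}(1)$ on $\mathbb S^7\subset\mathbb H^2$ is $q\cdot(b_1,b_2)=(qb_1,qb_2)$. In the restriction of (b), the factor on which $\mathsf{SO}(3)$ acts is restricted to the invariant equatorial $\mathbb S^6$, i.e. $A\mapsto\mathrm{diag}(1,1,1,1,A)\in\mathsf{SO}(7)$ on $\mathbb S^6$. *)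

theory Defs
  imports "HOL-Analysis.Analysis" "HOL-Algebra.Group"
begin

primrec higher_differentiable_on ::
  "nat \<Rightarrow> 'a::euclidean_space set \<Rightarrow> ('a \<Rightarrow> 'b::euclidean_space) \<Rightarrow> bool" where
  "higher_differentiable_on 0 U f \<longleftrightarrow> continuous_on U f"
| "higher_differentiable_on (Suc n) U f \<longleftrightarrow>
     (\<forall>x\<in>U. f differentiable (at x)) \<and>
     (\<forall>v. higher_differentiable_on n U (\<lambda>x. frechet_derivative f (at x) v))"

text \<open>Meaningful only for open \<open>U\<close>.\<close>

definition smooth_on :: "'a::euclidean_space set \<Rightarrow> ('a \<Rightarrow> 'b::euclidean_space) \<Rightarrow> bool" where
  "smooth_on U f \<longleftrightarrow> (\<forall>n. higher_differentiable_on n U f)"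

text \<open>
  A map between arbitrary subsets of Euclidean spaces is smooth if locally it extends to a smooth
  map on an open subset of the ambient space. For embedded submanifolds (all the spheres and
  matrix groups below) this is the usual notion of a smooth map.
\<close>

definition smooth_map ::
  "'a::euclidean_space set \<Rightarrow> 'b::euclidean_space set \<Rightarrow> ('a \<Rightarrow> 'b) \<Rightarrow> bool" where
  "smooth_map M N f \<longleftrightarrow> f \<in> M \<rightarrow> N \<and>
     (\<forall>x\<in>M. \<exists>U g. open U \<and> x \<in> U \<and> smooth_on U g \<and> (\<forall>y\<in>M \<inter> U. g y = f y))"

definition diffeomorphism ::
  "'a::euclidean_space set \<Rightarrow> 'b::euclidean_space set \<Rightarrow> ('a \<Rightarrow> 'b) \<Rightarrow> bool" where
  "diffeomorphism M N F \<longleftrightarrow>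
     bij_betw F M N \<and> smooth_map M N F \<and> smooth_map N M (inv_into M F)"

text \<open>
  The Lie groups below are groups (in the sense of HOL-Algebra) whose carrier is a subset of a
  Euclidean space of (pairs of) matrices. A subgroup of a compact group that is isomorphic, by a map
  smooth in both directions, to a compact group is automatically closed, hence embedded.
\<close>

definition lie_group_iso ::
  "('a::euclidean_space) monoid \<Rightarrow> ('b::euclidean_space) monoid \<Rightarrow> ('a \<Rightarrow> 'b) \<Rightarrow> bool" where
  "lie_group_iso G H \<phi> \<longleftrightarrow> \<phi> \<in> iso G H \<and> diffeomorphism (carrier G) (carrier H) \<phi>"

definition free_action :: "'g monoid \<Rightarrow> 'm set \<Rightarrow> ('g \<Rightarrow> 'm \<Rightarrow> 'm) \<Rightarrow> bool" where
  "free_action G M act \<longleftrightarrow> (\<forall>g\<in>carrier G. \<forall>m\<in>M. act g m = m \<longrightarrow> g = \<one>\<^bsub>G\<^esub>)"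

definition equivalent_actions ::
  "('g::euclidean_space) monoid \<Rightarrow> ('m::euclidean_space) set \<Rightarrow> ('g \<Rightarrow> 'm \<Rightarrow> 'm) \<Rightarrow>
   ('h::euclidean_space) monoid \<Rightarrow> ('n::euclidean_space) set \<Rightarrow> ('h \<Rightarrow> 'n \<Rightarrow> 'n) \<Rightarrow> bool" where
  "equivalent_actions L M act L' M' act' \<longleftrightarrow>
     (\<exists>\<phi> F. lie_group_iso L L' \<phi> \<and> diffeomorphism M M' F \<and>
            (\<forall>g\<in>carrier L. \<forall>m\<in>M. F (act g m) = act' (\<phi> g) (F m)))"

abbreviation as_group :: "'g monoid \<Rightarrow> 'g set \<Rightarrow> 'g monoid" where
  "as_group G L \<equiv> G\<lparr>carrier := L\<rparr>"

definition free_subgroups ::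
  "('g::euclidean_space) monoid \<Rightarrow> ('h::euclidean_space) monoid \<Rightarrow> 'm set \<Rightarrow> ('g \<Rightarrow> 'm \<Rightarrow> 'm) \<Rightarrow>
   'g set set" where
  "free_subgroups G K M act =
     {L. subgroup L G \<and> (\<exists>\<phi>. lie_group_iso (as_group G L) K \<phi>) \<and>
         free_action (as_group G L) M act}"

definition conjugate_in :: "'g monoid \<Rightarrow> 'g set \<Rightarrow> 'g set \<Rightarrow> bool" where
  "conjugate_in G L L' \<longleftrightarrow>
     (\<exists>g\<in>carrier G. L' = (\<lambda>h. g \<otimes>\<^bsub>G\<^esub> h \<otimes>\<^bsub>G\<^esub> inv\<^bsub>G\<^esub> g) ` L)"

definition SO :: "(real^'n^'n) monoid" where
  "SO = \<lparr>carrier = {A. rotation_matrix A}, mult = (**), one = mat 1\<rparr>"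

definition SU2 :: "(complex^2^2) monoid" where
  "SU2 = \<lparr>carrier = {U. (\<chi> i j. cnj (U $ j $ i)) ** U = mat 1 \<and> det U = 1},
          mult = (**), one = mat 1\<rparr>"

text \<open>
  The coordinates of \<open>real^4\<close> are those with respect to \<open>1, i, j, k\<close>. An octonion
  \<open>(a\<^sub>1, a\<^sub>2)\<close> has the coordinates of \<open>a\<^sub>1\<close> followed by those of \<open>a\<^sub>2\<close>, so its real part is
  \<open>x $ 1\<close>. (In the index type \<open>8\<close> the numeral \<open>8\<close> denotes \<open>0\<close>, and likewise for \<open>4\<close>.)
\<close>

type_synonym quat = "real^4"
type_synonym oct = "real^8"

definition quat_mult :: "quat \<Rightarrow> quat \<Rightarrow> quat" where
  "quat_mult p q = vector
     [p$1 * q$1 - p$2 * q$2 - p$3 * q$3 - p$4 * q$4,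
      p$1 * q$2 + p$2 * q$1 + p$3 * q$4 - p$4 * q$3,
      p$1 * q$3 - p$2 * q$4 + p$3 * q$1 + p$4 * q$2,
      p$1 * q$4 + p$2 * q$3 - p$3 * q$2 + p$4 * q$1]"

definition quat_conj :: "quat \<Rightarrow> quat" where
  "quat_conj q = vector [q$1, - q$2, - q$3, - q$4]"

definition quat_im :: "quat \<Rightarrow> real^3" where
  "quat_im q = vector [q$2, q$3, q$4]"

definition im_quat :: "real^3 \<Rightarrow> quat" where
  "im_quat v = vector [0, v$1, v$2, v$3]"

definition oct_pair :: "quat \<Rightarrow> quat \<Rightarrow> oct" where
  "oct_pair a b = vector [a$1, a$2, a$3, a$4, b$1, b$2, b$3, b$4]"

definition oct_fst :: "oct \<Rightarrow> quat" where
  "oct_fst x = vector [x$1, x$2, x$3, x$4]"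

definition oct_snd :: "oct \<Rightarrow> quat" where
  "oct_snd x = vector [x$5, x$6, x$7, x$8]"

definition oct_mult :: "oct \<Rightarrow> oct \<Rightarrow> oct" where
  "oct_mult a b = oct_pair
     (quat_mult (oct_fst a) (oct_fst b) - quat_mult (quat_conj (oct_snd b)) (oct_snd a))
     (quat_mult (oct_snd b) (oct_fst a) + quat_mult (oct_snd a) (quat_conj (oct_fst b)))"

definition triality :: "real^8^8 \<Rightarrow> real^8^8 \<Rightarrow> real^8^8 \<Rightarrow> bool" where
  "triality A B C \<longleftrightarrow> (\<forall>x y. oct_mult (A *v x) (B *v y) = C *v oct_mult x y)"

definition Spin8 :: "((real^8^8) \<times> (real^8^8)) monoid" where
  "Spin8 = as_group (SO \<times>\<times> SO)
     {(A, B). A \<in> carrier SO \<and> B \<in> carrier SO \<and> (\<exists>C\<in>carrier SO. triality A B C)}"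

definition Spin7 :: "((real^8^8) \<times> (real^8^8)) monoid" where
  "Spin7 = as_group Spin8 {(A, B). (A, B) \<in> carrier Spin8 \<and> triality A B B}"

definition spin_act :: "(real^8^8) \<times> (real^8^8) \<Rightarrow> oct \<times> oct \<Rightarrow> oct \<times> oct" where
  "spin_act = (\<lambda>(A, B) (x, y). (A *v x, B *v y))"

definition S7xS7 :: "(oct \<times> oct) set" where
  "S7xS7 = sphere 0 1 \<times> sphere 0 1"

definition S6xS7 :: "(oct \<times> oct) set" where
  "S6xS7 = {(x, y) \<in> S7xS7. x $ 1 = 0}"

text \<open>
  The isomorphism from SU(2) onto the unit quaternions, sending the matrix with first row
  \<open>(a, b)\<close> to \<open>a + b j\<close>.
\<close>

definition su2_quat :: "complex^2^2 \<Rightarrow> quat" where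
  "su2_quat U = vector [Re (U$1$1), Im (U$1$1), Re (U$1$2), Im (U$1$2)]"

definition hopf_act :: "complex^2^2 \<Rightarrow> oct \<Rightarrow> oct" where
  "hopf_act U x = oct_pair (quat_mult (su2_quat U) (oct_fst x)) (quat_mult (su2_quat U) (oct_snd x))"

definition su2_cover :: "complex^2^2 \<Rightarrow> real^3^3" where
  "su2_cover U = matrix (\<lambda>v. quat_im
     (quat_mult (quat_mult (su2_quat U) (im_quat v)) (quat_conj (su2_quat U))))"

text \<open>
  The block matrix \<open>diag(1, 1, 1, 1, 1, A)\<close>. On the equator \<open>x $ 1 = 0\<close>, with coordinates
  \<open>x $ 2, \<dots>, x $ 8\<close>, it acts as \<open>diag(1, 1, 1, 1, A)\<close>.
\<close>

definition so3_block :: "real^3^3 \<Rightarrow> real^8^8" where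
  "so3_block A = vector
     [vector [1, 0, 0, 0, 0, 0, 0, 0],
      vector [0, 1, 0, 0, 0, 0, 0, 0],
      vector [0, 0, 1, 0, 0, 0, 0, 0],
      vector [0, 0, 0, 1, 0, 0, 0, 0],
      vector [0, 0, 0, 0, 1, 0, 0, 0],
      vector [0, 0, 0, 0, 0, A$1$1, A$1$2, A$1$3],
      vector [0, 0, 0, 0, 0, A$2$1, A$2$2, A$2$3],
      vector [0, 0, 0, 0, 0, A$3$1, A$3$2, A$3$3]]"

definition act_a :: "complex^2^2 \<Rightarrow> oct \<times> oct \<Rightarrow> oct \<times> oct" where
  "act_a U = (\<lambda>(x, y). (hopf_act U x, hopf_act U y))"

definition act_b :: "complex^2^2 \<Rightarrow> oct \<times> oct \<Rightarrow> oct \<times> oct" where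
  "act_b U = (\<lambda>(x, y). (so3_block (su2_cover U) *v x, hopf_act U y))"

end

theory Submission
  imports Defs
begin

text \<open>
  Let Sp(1) be the group of unit quaternions. A subgroup of Spin(8) isomorphic to SU(2) is parametrized by
  Sp(1) and thus gives three orthogonal representations \<open>a\<close>, \<open>b\<close>, \<open>c\<close> of Sp(1) on the octonions with
  \<open>a(q) x \<cdot> b(q) y = c(q) (x y)\<close>.

  An element of order two that acts freely has \<open>-1\<close> as one of its two components, and since only real
  octonions associate with all others, the other component is \<open>1\<close> or \<open>-1\<close>
  (\<open>triality_involution_signs\<close>). This already excludes SO(3), in which no involution is central.
  For SU(2) it shows that exactly one of \<open>a\<close>, \<open>b\<close>, \<open>c\<close> is trivial at \<open>-1\<close>. That one is a
  representation of SO(3), so it has a nonzero vector of weight zero, fixed by a whole circle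
  (\<open>even_rep_zero_weight\<close>). Inserted into the triality equation, this vector matches the vectors fixed by an
  element of the circle in one of the remaining representations with those fixed in the other one.
  Consequently freeness on the product of spheres forces the two remaining
  representations to be free on a single sphere (\<open>free_hopf_model\<close>). A free representation has only
  the weights \<open>1\<close> and \<open>-1\<close>, hence is linear in the quaternion and is the Hopf action in a suitable
  orthonormal basis (\<open>free_rep_is_hopf\<close>). The diffeomorphisms \<open>(x, y) \<mapsto> (x, x y)\<close> and
  \<open>(x, y) \<mapsto> (x y, y)\<close> bring \<open>c\<close> into play where \<open>a\<close> or \<open>b\<close> is not free, so every free subgroup
  acts like the Hopf action on both factors. One explicit subgroup, \<open>std_group\<close>, visibly acts like (b);
  therefore (a) and (b) are equivalent.

  In Spin(7) the first component is a rotation of the seven-dimensional space of imaginary octonions and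
  so always fixes a point of the equator. Freeness then says that \<open>b\<close> alone is free, hence linear in the
  quaternion. Triality becomes the relation \<open>B L\<^sub>x = L\<^sub>y B\<close> with \<open>y = A x\<close> between \<open>B\<close> and left
  multiplications, which satisfy the Clifford relations. It follows that \<open>b(i)\<close>, \<open>b(j)\<close>, \<open>b(k)\<close> are the
  products of pairs from \<open>L\<^sub>e\<close>, \<open>L\<^sub>f\<close>, \<open>L\<^sub>g\<close> for an orthonormal triple \<open>e\<close>, \<open>f\<close>, \<open>g\<close> of imaginary octonions
  (\<open>free_Spin7_frame\<close>). Spin(7) contains all \<open>L\<^sub>v\<close> for imaginary units \<open>v\<close>; conjugation by \<open>L\<^sub>v\<close> acts on triples as a
  reflection up to a common sign, which cancels in the products of pairs. Three reflections
  carry any triple to any other (\<open>frame_groups_conjugate\<close>), so all free subgroups are conjugate.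
\<close>

section \<open>Coordinates of quaternions and octonions\<close>

lemma exhaust_8:
  fixes x :: 8
  shows "x = 1 \<or> x = 2 \<or> x = 3 \<or> x = 4 \<or> x = 5 \<or> x = 6 \<or> x = 7 \<or> x = 8"
proof (induct x)
  case (of_int z)
  then have "0 \<le> z" and "z < 8" by simp_all
  then have "z = 0 \<or> z = 1 \<or> z = 2 \<or> z = 3 \<or> z = 4 \<or> z = 5 \<or> z = 6 \<or> z = 7" by arith
  then show ?case by auto
qed

lemma forall_8: "(\<forall>i::8. P i) \<longleftrightarrow> P 1 \<and> P 2 \<and> P 3 \<and> P 4 \<and> P 5 \<and> P 6 \<and> P 7 \<and> P 8"
  by (metis exhaust_8)

lemma UNIV_8: "UNIV = {1, 2, 3, 4, 5, 6, 7, 8::8}"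
  using exhaust_8 by auto

lemma sum_8: "sum f (UNIV::8 set) = f 1 + f 2 + f 3 + f 4 + f 5 + f 6 + f 7 + f 8"
  unfolding UNIV_8 by (simp add: ac_simps)

lemma vector_4 [simp]:
  "(vector [a,b,c,d] ::('a::zero)^4) $ 1 = a"
  "(vector [a,b,c,d] ::('a::zero)^4) $ 2 = b"
  "(vector [a,b,c,d] ::('a::zero)^4) $ 3 = c"
  "(vector [a,b,c,d] ::('a::zero)^4) $ 4 = d"
  unfolding vector_def by simp_all

lemma vector_8 [simp]:
  "(vector [a,b,c,d,e,f,g,h] ::('a::zero)^8) $ 1 = a"
  "(vector [a,b,c,d,e,f,g,h] ::('a::zero)^8) $ 2 = b"
  "(vector [a,b,c,d,e,f,g,h] ::('a::zero)^8) $ 3 = c"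
  "(vector [a,b,c,d,e,f,g,h] ::('a::zero)^8) $ 4 = d"
  "(vector [a,b,c,d,e,f,g,h] ::('a::zero)^8) $ 5 = e"
  "(vector [a,b,c,d,e,f,g,h] ::('a::zero)^8) $ 6 = f"
  "(vector [a,b,c,d,e,f,g,h] ::('a::zero)^8) $ 7 = g"
  "(vector [a,b,c,d,e,f,g,h] ::('a::zero)^8) $ 8 = h"
  unfolding vector_def by simp_all

lemma oct_fst_nth [simp]: "oct_fst x $ 1 = x $ 1" "oct_fst x $ 2 = x $ 2" "oct_fst x $ 3 = x $ 3" "oct_fst x $ 4 = x $ 4"
  by (simp_all add: oct_fst_def)
lemma oct_snd_nth [simp]: "oct_snd x $ 1 = x $ 5" "oct_snd x $ 2 = x $ 6" "oct_snd x $ 3 = x $ 7" "oct_snd x $ 4 = x $ 8"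
  by (simp_all add: oct_snd_def)
lemma oct_pair_nth [simp]: "oct_pair a b $ 1 = a $ 1" "oct_pair a b $ 2 = a $ 2" "oct_pair a b $ 3 = a $ 3" "oct_pair a b $ 4 = a $ 4"
   "oct_pair a b $ 5 = b $ 1" "oct_pair a b $ 6 = b $ 2" "oct_pair a b $ 7 = b $ 3" "oct_pair a b $ 8 = b $ 4"
  by (simp_all add: oct_pair_def)

lemma quat_mult_nth:
  "quat_mult p q $ 1 = p$1 * q$1 - p$2 * q$2 - p$3 * q$3 - p$4 * q$4"
  "quat_mult p q $ 2 = p$1 * q$2 + p$2 * q$1 + p$3 * q$4 - p$4 * q$3"
  "quat_mult p q $ 3 = p$1 * q$3 - p$2 * q$4 + p$3 * q$1 + p$4 * q$2"
  "quat_mult p q $ 4 = p$1 * q$4 + p$2 * q$3 - p$3 * q$2 + p$4 * q$1"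
  by (simp_all add: quat_mult_def)

lemma quat_conj_nth [simp]:
  "quat_conj q $ 1 = q $ 1" "quat_conj q $ 2 = - q $ 2" "quat_conj q $ 3 = - q $ 3" "quat_conj q $ 4 = - q $ 4"
  by (simp_all add: quat_conj_def)

definition oct_conj :: "oct \<Rightarrow> oct" where
  "oct_conj x = oct_pair (quat_conj (oct_fst x)) (- oct_snd x)"

definition quat_one :: quat where "quat_one = vector [1,0,0,0]"
definition oct_one :: oct where "oct_one = oct_pair quat_one 0"

lemma quat_eq_iff: "p = q \<longleftrightarrow> p $ 1 = q $ 1 \<and> p $ 2 = q $ 2 \<and> p $ 3 = q $ 3 \<and> p $ 4 = (q::quat) $ 4"
  by (simp add: vec_eq_iff forall_4)

lemma oct_eq_iff: "x = y \<longleftrightarrow> oct_fst x = oct_fst y \<and> oct_snd x = oct_snd y"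
  by (auto simp: vec_eq_iff forall_4 forall_8)

lemma oct_fst_pair [simp]: "oct_fst (oct_pair a b) = a" and oct_snd_pair [simp]: "oct_snd (oct_pair a b) = b"
  by (simp_all add: vec_eq_iff forall_4)

lemma norm_quat: "(norm p)\<^sup>2 = (p$1)\<^sup>2 + (p$2)\<^sup>2 + (p$3)\<^sup>2 + ((p::quat)$4)\<^sup>2"
  unfolding power2_norm_eq_inner by (simp add: inner_vec_def sum_4 power2_eq_square)

lemma norm_oct: "(norm x)\<^sup>2 = (norm (oct_fst x))\<^sup>2 + (norm (oct_snd x))\<^sup>2"
  unfolding power2_norm_eq_inner by (simp add: inner_vec_def sum_4 sum_8)

lemma quat_mult_assoc: "quat_mult (quat_mult p q) r = quat_mult p (quat_mult q r)"
  by (simp add: quat_eq_iff quat_mult_nth algebra_simps)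

lemma norm_quat_mult: "norm (quat_mult p q) = norm p * norm q"
proof -
  have "(norm (quat_mult p q))\<^sup>2 = (norm p * norm q)\<^sup>2"
    unfolding power_mult_distrib norm_quat quat_mult_nth by algebra
  then show ?thesis by (simp add: power2_eq_iff_nonneg)
qed

text \<open>  The octonions are not associative, but they are alternative. This identity and its mirror image are
  the only forms of alternativity used below; both reduce to polynomial identities in coordinates.\<close>

lemma oct_left_cancel: "oct_mult (oct_conj x) (oct_mult x y) = (norm x)\<^sup>2 *\<^sub>R y"
  unfolding oct_eq_iff norm_oct norm_quat
  by (simp add: quat_eq_iff oct_mult_def oct_conj_def quat_mult_nth algebra_simps power2_eq_square)

lemma oct_right_cancel: "oct_mult (oct_mult y x) (oct_conj x) = (norm x)\<^sup>2 *\<^sub>R y"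
  unfolding oct_eq_iff norm_oct norm_quat
  by (simp add: quat_eq_iff oct_mult_def oct_conj_def quat_mult_nth algebra_simps power2_eq_square)

lemma oct_adjoint: "oct_mult x y \<bullet> z = y \<bullet> oct_mult (oct_conj x) z"
  by (simp add: inner_vec_def sum_8 oct_mult_def oct_conj_def quat_mult_nth algebra_simps)

section \<open>Octonion algebra\<close>

lemma norm_eq_oneI: "(norm x)\<^sup>2 = 1 \<Longrightarrow> norm x = 1"
  by (metis norm_ge_zero one_power2 power2_eq_imp_eq zero_le_one)

lemma bilinear_quat_mult: "bilinear quat_mult"
  unfolding bilinear_def by (auto intro!: linearI simp: quat_eq_iff quat_mult_nth algebra_simps)

lemma linear_oct_fst: "linear oct_fst" and linear_oct_snd: "linear oct_snd"
  by (auto intro!: linearI simp: quat_eq_iff)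

lemma linear_quat_conj: "linear quat_conj"
  by (auto intro!: linearI simp: quat_eq_iff)

lemma linear_oct_conj: "linear oct_conj"
  by (auto intro!: linearI simp: oct_eq_iff quat_eq_iff oct_conj_def)

lemma oct_pair_add: "oct_pair (a + c) (b + d) = oct_pair a b + oct_pair c d"
  and oct_pair_scale: "oct_pair (r *\<^sub>R a) (r *\<^sub>R b) = r *\<^sub>R oct_pair a b"
  by (simp_all add: oct_eq_iff quat_eq_iff)

lemma bilinear_oct_mult: "bilinear oct_mult"
  unfolding bilinear_def
  by (auto intro!: linearI simp: oct_eq_iff oct_mult_def quat_eq_iff quat_mult_nth algebra_simps)

interpretation quat_mult: bounded_bilinear quat_mult
  using bilinear_quat_mult bilinear_conv_bounded_bilinear by blast

interpretation oct_mult: bounded_bilinear oct_mult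
  using bilinear_oct_mult bilinear_conv_bounded_bilinear by blast

text \<open>  Left multiplication by \<open>oct_conj x\<close> is adjoint to left multiplication by \<open>x\<close>, and composing the two
  gives \<open>(norm x)\<^sup>2\<close>.\<close>

lemma norm_oct_mult: "norm (oct_mult x y) = norm x * norm y"
proof -
  have "(norm (oct_mult x y))\<^sup>2 = y \<bullet> oct_mult (oct_conj x) (oct_mult x y)"
    by (simp add: power2_norm_eq_inner oct_adjoint)
  also have "\<dots> = (norm x * norm y)\<^sup>2"
    by (simp add: oct_left_cancel power_mult_distrib power2_norm_eq_inner)
  finally show ?thesis by (simp add: power2_eq_iff_nonneg)
qed

lemma oct_conj_conj [simp]: "oct_conj (oct_conj x) = x"
  by (simp add: oct_eq_iff quat_eq_iff oct_conj_def)

lemma norm_oct_conj [simp]: "norm (oct_conj x) = norm x"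
proof -
  have "(norm (oct_conj x))\<^sup>2 = (norm x)\<^sup>2"
    unfolding norm_oct norm_quat by (simp add: oct_conj_def)
  then show ?thesis by (simp add: power2_eq_iff_nonneg)
qed

lemma oct_one_nth: "oct_one $ 1 = 1" "oct_one $ 2 = 0" "oct_one $ 3 = 0" "oct_one $ 4 = 0"
   "oct_one $ 5 = 0" "oct_one $ 6 = 0" "oct_one $ 7 = 0" "oct_one $ 8 = 0"
  by (simp_all add: oct_one_def quat_one_def)

lemma oct_mult_one [simp]: "oct_mult oct_one x = x" "oct_mult x oct_one = x"
  by (simp_all add: oct_eq_iff quat_eq_iff oct_mult_def oct_one_nth quat_mult_nth)

lemma quat_mult_one [simp]: "quat_mult quat_one x = x" "quat_mult x quat_one = x"
  by (simp_all add: quat_eq_iff quat_mult_nth quat_one_def)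

lemma norm_quat_one [simp]: "norm quat_one = 1"
  by (rule norm_eq_oneI) (simp add: norm_quat quat_one_def)

lemma norm_oct_one [simp]: "norm oct_one = 1"
  by (rule norm_eq_oneI) (simp add: norm_oct oct_one_def)

lemma inner_oct_one: "x \<bullet> oct_one = x $ 1"
  by (simp add: inner_vec_def sum_8 oct_one_nth)

lemma oct_conj_imaginary: "x $ 1 = 0 \<Longrightarrow> oct_conj x = - x"
  by (simp add: oct_eq_iff quat_eq_iff oct_conj_def)

lemma oct_imaginary_square: "x $ 1 = 0 \<Longrightarrow> oct_mult x (oct_mult x y) = - ((norm x)\<^sup>2 *\<^sub>R y)"
  using oct_left_cancel[of x y] by (simp add: oct_conj_imaginary oct_mult.minus_left) (metis minus_minus)

text \<open>  Polarization of \<open>oct_imaginary_square\<close>: left multiplications by imaginary octonions satisfy the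
  Clifford relations, which replace associativity in all computations with Spin(7).\<close>

lemma oct_imaginary_clifford:
  assumes "u $ 1 = 0" "v $ 1 = 0"
  shows "oct_mult u (oct_mult v y) + oct_mult v (oct_mult u y) = - ((2 * (u \<bullet> v)) *\<^sub>R y)"
proof -
  have "oct_mult (u + v) (oct_mult (u + v) y) = - ((norm (u + v))\<^sup>2 *\<^sub>R y)"
    using assms by (intro oct_imaginary_square) simp
  moreover have "(norm (u + v))\<^sup>2 = (norm u)\<^sup>2 + (norm v)\<^sup>2 + 2 * (u \<bullet> v)"
    by (simp add: power2_norm_eq_inner inner_add_left inner_add_right inner_commute)
  ultimately show ?thesis
    using oct_imaginary_square[OF assms(1), of y] oct_imaginary_square[OF assms(2), of y]
    by (simp add: oct_mult.add_left oct_mult.add_right scaleR_add_left algebra_simps)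
       (simp add: add.assoc[symmetric] eq_neg_iff_add_eq_0)
qed

text \<open>  An octonion that associates with all others in this way is real. Three pairs of basis
  elements \<open>x\<close>, \<open>y\<close> suffice to see that all imaginary coordinates vanish.\<close>

lemma oct_right_nucleus_real:
  assumes "\<And>x y. oct_mult x (oct_mult y b) = oct_mult (oct_mult x y) b"
  shows "b = (b $ 1) *\<^sub>R oct_one"
  using assms[of "vector [0,1,0,0,0,0,0,0]" "vector [0,0,1,0,0,0,0,0]"]
        assms[of "vector [0,1,0,0,0,0,0,0]" "vector [0,0,0,0,1,0,0,0]"]
        assms[of "vector [0,0,1,0,0,0,0,0]" "vector [0,0,0,0,1,0,0,0]"]
  by (simp add: oct_eq_iff quat_eq_iff oct_mult_def quat_mult_nth oct_one_nth)

lemma oct_left_nucleus_real: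
  assumes "\<And>x y. oct_mult (oct_mult a x) y = oct_mult a (oct_mult x y)"
  shows "a = (a $ 1) *\<^sub>R oct_one"
  using assms[of "vector [0,1,0,0,0,0,0,0]" "vector [0,0,1,0,0,0,0,0]"]
        assms[of "vector [0,1,0,0,0,0,0,0]" "vector [0,0,0,0,1,0,0,0]"]
        assms[of "vector [0,0,1,0,0,0,0,0]" "vector [0,0,0,0,1,0,0,0]"]
  by (simp add: oct_eq_iff quat_eq_iff oct_mult_def quat_mult_nth oct_one_nth)

lemma real_unit_multiple_cases:
  assumes "norm (r *\<^sub>R oct_one) = 1" shows "r = 1 \<or> r = -1"
  using assms by auto

text \<open>  The identity lifts to Spin(8) only in two ways. Putting \<open>x = 1\<close> and \<open>y = 1\<close> shows that both \<open>B\<close>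
  and \<open>C\<close> are right multiplication by \<open>b = B 1\<close>, and then the triality equation puts \<open>b\<close> into the
  nucleus.\<close>

lemma triality_trivial_left:
  assumes "\<And>x y. oct_mult x (B y) = C (oct_mult x y)" and "norm (B oct_one) = 1"
  shows "(\<forall>y. B y = y) \<or> (\<forall>y. B y = - y)"
proof -
  define b where "b = B oct_one"
  have C: "C x = oct_mult x b" for x using assms(1)[of x oct_one] by (simp add: b_def)
  have B: "B y = oct_mult y b" for y using assms(1)[of oct_one y] C by simp
  have "b = (b $ 1) *\<^sub>R oct_one"
    using assms(1) by (intro oct_right_nucleus_real) (simp add: B C)
  then obtain r where "b = r *\<^sub>R oct_one" "r = 1 \<or> r = -1"
    using assms(2) real_unit_multiple_cases unfolding b_def by metis
  then show ?thesis by (auto simp: B oct_mult.minus_right)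
qed

lemma triality_trivial_right:
  assumes "\<And>x y. oct_mult (A x) y = C (oct_mult x y)" and "norm (A oct_one) = 1"
  shows "(\<forall>x. A x = x) \<or> (\<forall>x. A x = - x)"
proof -
  define a where "a = A oct_one"
  have C: "C y = oct_mult a y" for y using assms(1)[of oct_one y] by (simp add: a_def)
  have A: "A x = oct_mult a x" for x using assms(1)[of x oct_one] C by simp
  have "a = (a $ 1) *\<^sub>R oct_one"
    using assms(1) by (intro oct_left_nucleus_real) (simp add: A C)
  then obtain r where "a = r *\<^sub>R oct_one" "r = 1 \<or> r = -1"
    using assms(2) real_unit_multiple_cases unfolding a_def by metis
  then show ?thesis by (auto simp: A oct_mult.minus_left)
qed

text \<open>  If an involution \<open>A\<close> is not \<open>-1\<close>, it fixes some \<open>x + A x \<noteq> 0\<close>. So an involution in Spin(8)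
  without fixed points on the product of spheres has \<open>-1\<close> as one of its components, and then the other
  one is a sign as well. In particular it is central.\<close>

lemma triality_involution_signs:
  assumes linA: "linear A" and invA: "\<And>x. A (A x) = x" and normA: "norm (A oct_one) = 1"
    and linB: "linear B" and invB: "\<And>y. B (B y) = y" and normB: "norm (B oct_one) = 1"
    and tri: "\<And>x y. oct_mult (A x) (B y) = C (oct_mult x y)"
    and nofix: "\<And>x y. A x = x \<Longrightarrow> B y = y \<Longrightarrow> x = 0 \<or> y = 0"
  shows "(\<forall>x. A x = - x) \<and> ((\<forall>y. B y = y) \<or> (\<forall>y. B y = - y)) \<or>
         (\<forall>y. B y = - y) \<and> ((\<forall>x. A x = x) \<or> (\<forall>x. A x = - x))"
proof -
  have "(\<forall>x. A x = - x) \<or> (\<forall>y. B y = - y)"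
  proof (rule ccontr)
    assume "\<not> ?thesis"
    then obtain x y where "x + A x \<noteq> 0" "y + B y \<noteq> 0"
      by (auto simp: eq_neg_iff_add_eq_0 add.commute)
    moreover have "A (x + A x) = x + A x" "B (y + B y) = y + B y"
      by (simp_all add: linear_add[OF linA] linear_add[OF linB] invA invB add.commute)
    ultimately show False using nofix by blast
  qed
  then show ?thesis
  proof
    assume A: "\<forall>x. A x = - x"
    have "oct_mult x (B y) = - C (oct_mult x y)" for x y
      using tri[of x y, symmetric] A by (simp add: oct_mult.minus_left)
    then have "(\<forall>y. B y = y) \<or> (\<forall>y. B y = - y)"
      using normB by (rule triality_trivial_left[where C = "\<lambda>z. - C z"])
    then show ?thesis using A by blast
  next
    assume B: "\<forall>y. B y = - y"
    have "oct_mult (A x) y = - C (oct_mult x y)" for x y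
      using tri[of x y, symmetric] B by (simp add: oct_mult.minus_right)
    then have "(\<forall>x. A x = x) \<or> (\<forall>x. A x = - x)"
      using normA by (rule triality_trivial_right[where C = "\<lambda>z. - C z"])
    then show ?thesis using B by blast
  qed
qed

section \<open>Unit quaternions\<close>

lemma quat_conj_mult [simp]: "quat_conj (quat_mult p q) = quat_mult (quat_conj q) (quat_conj p)"
  by (simp add: quat_eq_iff quat_mult_nth algebra_simps)

lemma quat_conj_conj [simp]: "quat_conj (quat_conj q) = q"
  by (simp add: quat_eq_iff)

lemma norm_quat_conj [simp]: "norm (quat_conj q) = norm q"
proof -
  have "(norm (quat_conj q))\<^sup>2 = (norm q)\<^sup>2" unfolding norm_quat by simp
  then show ?thesis by (simp add: power2_eq_iff_nonneg)
qed

lemma quat_mult_conj: "quat_mult q (quat_conj q) = (norm q)\<^sup>2 *\<^sub>R quat_one"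
  "quat_mult (quat_conj q) q = (norm q)\<^sup>2 *\<^sub>R quat_one"
  unfolding norm_quat by (simp_all add: quat_eq_iff quat_mult_nth quat_one_def power2_eq_square)

definition hopf :: "quat \<Rightarrow> oct \<Rightarrow> oct" where
  "hopf q x = oct_pair (quat_mult q (oct_fst x)) (quat_mult q (oct_snd x))"

text \<open>The one-parameter subgroup \<open>e\<^sup>t\<^sup>v\<close> of the unit quaternions with direction \<open>v\<close>.\<close>

definition quat_cis :: "quat \<Rightarrow> real \<Rightarrow> quat" where
  "quat_cis v t = cos t *\<^sub>R quat_one + sin t *\<^sub>R v"

definition imag_units :: "quat set" where "imag_units = {v. norm v = 1 \<and> v $ 1 = 0}"

lemma imag_unit_square: "v \<in> imag_units \<Longrightarrow> quat_mult v v = - quat_one"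
  using quat_mult_conj(1)[of v] norm_quat[of v]
  by (simp add: imag_units_def quat_eq_iff quat_mult_nth quat_one_def power2_eq_square)

lemma norm_quat_cis: assumes "v \<in> imag_units" shows "norm (quat_cis v t) = 1"
proof -
  have "(norm (quat_cis v t))\<^sup>2 = (cos t)\<^sup>2 + (sin t)\<^sup>2 * (norm v)\<^sup>2"
    using assms unfolding norm_quat
    by (simp add: quat_cis_def quat_one_def imag_units_def power_mult_distrib algebra_simps)
  then show ?thesis using assms by (intro norm_eq_oneI) (simp add: imag_units_def)
qed

lemma quat_cis_add: assumes "v \<in> imag_units"
  shows "quat_cis v (s + t) = quat_mult (quat_cis v s) (quat_cis v t)"
  unfolding quat_cis_def
  by (simp add: quat_mult.add_left quat_mult.add_right quat_mult.scaleR_left quat_mult.scaleR_right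
      imag_unit_square[OF assms] cos_add sin_add algebra_simps)

lemma quat_cis_0 [simp]: "quat_cis v 0 = quat_one" by (simp add: quat_cis_def)

lemma unit_quat_is_cis:
  assumes "norm q = 1" obtains v t where "v \<in> imag_units" "q = quat_cis v t"
proof (cases "q $ 1 = 1 \<or> q $ 1 = - 1")
  case True
  have "(q$2)\<^sup>2 + (q$3)\<^sup>2 + (q$4)\<^sup>2 = 0" using True norm_quat[of q] assms by auto
  then have "q$2 = 0 \<and> q$3 = 0 \<and> q$4 = 0"
    by (smt (verit) zero_le_power2 zero_eq_power2)
  moreover have "vector [0,1,0,0] \<in> imag_units"
    by (auto intro: norm_eq_oneI simp: imag_units_def norm_quat)
  moreover have "q = quat_cis (vector [0,1,0,0]) 0 \<or> q = quat_cis (vector [0,1,0,0]) pi"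
    using True calculation by (auto simp: quat_eq_iff quat_cis_def quat_one_def)
  ultimately show ?thesis using that by blast
next
  case False
  define t where "t = arccos (q $ 1)"
  have le: "\<bar>q $ 1\<bar> \<le> 1" using component_le_norm_cart[of q 1] assms by simp
  then have c: "cos t = q $ 1" by (simp add: t_def cos_arccos_abs)
  have "(sin t)\<^sup>2 = 1 - (q$1)\<^sup>2" by (simp add: sin_squared_eq c)
  then have s0: "sin t \<noteq> 0" using False by (auto simp: power2_eq_1_iff)
  define v where "v = (1 / sin t) *\<^sub>R (q - (q$1) *\<^sub>R quat_one)"
  have q: "q = quat_cis v t"
    using s0 by (simp add: quat_cis_def v_def c)
  have v1: "v $ 1 = 0" by (simp add: v_def quat_one_def)
  have "1 = (cos t)\<^sup>2 + (sin t)\<^sup>2 * (norm v)\<^sup>2"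
    using assms norm_quat[of q] v1 unfolding norm_quat[of v] q
    by (simp add: quat_cis_def quat_one_def power_mult_distrib algebra_simps)
  then have "(sin t)\<^sup>2 * (norm v)\<^sup>2 = (sin t)\<^sup>2 * 1"
    using sin_cos_squared_add[of t] by linarith
  then have "norm v = 1" using s0 by (intro norm_eq_oneI) simp
  then show ?thesis using that q v1 by (simp add: imag_units_def)
qed

text \<open>  All one-parameter circles in Sp(1) are conjugate. Since \<open>v v = i i = -1\<close>, the quaternion \<open>p = 1 - i v\<close>
  satisfies \<open>p v = v + i = i p\<close>; it vanishes only for \<open>v = -i\<close>, where \<open>j\<close> does the job.\<close>

lemma imag_unit_conjugate:
  assumes "v \<in> imag_units"
  obtains p where "norm p = 1" "quat_mult p v = quat_mult (vector [0,1,0,0]) p"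
proof (cases "v = - vector [0,1,0,0]")
  case True
  have "norm (vector [0,0,1,0] :: quat) = 1"
    by (rule norm_eq_oneI) (simp add: norm_quat)
  moreover have "quat_mult (vector [0,0,1,0]) v = quat_mult (vector [0,1,0,0]) (vector [0,0,1,0])"
    by (simp add: True quat_eq_iff quat_mult_nth)
  ultimately show ?thesis using that by blast
next
  case False
  define i where "i = (vector [0,1,0,0] :: quat)"
  define p where "p = quat_one - quat_mult i v"
  have ii: "quat_mult i i = - quat_one" by (simp add: i_def quat_eq_iff quat_mult_nth quat_one_def)
  have "p \<noteq> 0"
  proof
    assume "p = 0"
    then have "quat_mult i (quat_mult i v) = quat_mult i quat_one" by (simp add: p_def)
    then have "- v = i" by (simp add: quat_mult_assoc[symmetric] ii quat_mult.minus_left)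
    then show False using False by (metis i_def minus_minus)
  qed
  moreover have "quat_mult p v = quat_mult i p"
    by (simp add: p_def quat_mult.diff_left quat_mult.diff_right quat_mult_assoc
        imag_unit_square[OF assms] quat_mult.minus_right)
       (simp add: quat_mult_assoc[symmetric] ii quat_mult.minus_left)
  ultimately have "norm ((1 / norm p) *\<^sub>R p) = 1"
    "quat_mult ((1 / norm p) *\<^sub>R p) v = quat_mult i ((1 / norm p) *\<^sub>R p)"
    by (simp_all add: quat_mult.scaleR_left quat_mult.scaleR_right)
  then show ?thesis using that unfolding i_def by blast
qed

section \<open>Smooth maps between subsets of Euclidean spaces\<close>

lemma higher_differentiable_cong:
  assumes "open U" "\<And>x. x \<in> U \<Longrightarrow> f x = g x"
  shows "higher_differentiable_on n U f \<longleftrightarrow> higher_differentiable_on n U g"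
  using assms(2)
proof (induction n arbitrary: f g)
  case 0
  then show ?case by (auto cong: continuous_on_cong)
next
  case (Suc n)
  have hd: "(f has_derivative D) (at x) \<longleftrightarrow> (g has_derivative D) (at x)" if "x \<in> U" for x D
    using has_derivative_transform_within_open[of f D x UNIV U g]
      has_derivative_transform_within_open[of g D x UNIV U f] assms(1) that Suc.prems by auto
  have eq: "(f differentiable (at x) \<longleftrightarrow> g differentiable (at x)) \<and>
      frechet_derivative f (at x) = frechet_derivative g (at x)" if "x \<in> U" for x
    unfolding differentiable_def frechet_derivative_def hd[OF that] by simp
  have "higher_differentiable_on n U (\<lambda>x. frechet_derivative f (at x) v) \<longleftrightarrow>
      higher_differentiable_on n U (\<lambda>x. frechet_derivative g (at x) v)" for v
    by (rule Suc.IH) (simp add: eq)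
  then show ?case using eq by simp
qed

lemma higher_differentiable_subset:
  assumes "V \<subseteq> U"
  shows "higher_differentiable_on n U f \<Longrightarrow> higher_differentiable_on n V f"
proof (induction n arbitrary: f)
  case 0
  then show ?case using assms by (simp add: continuous_on_subset)
next
  case (Suc n)
  then show ?case using assms by (simp add: subset_iff)
qed

lemma higher_differentiable_antimono:
  "higher_differentiable_on (Suc n) U f \<Longrightarrow> higher_differentiable_on n U f"
proof (induction n arbitrary: f)
  case 0
  then have "\<forall>x\<in>U. f differentiable (at x)"
    unfolding higher_differentiable_on.simps(2) by blast
  then show ?case
    by (simp add: differentiable_imp_continuous_within continuous_at_imp_continuous_on)
next
  case (Suc n)
  have "higher_differentiable_on n U (\<lambda>x. frechet_derivative f (at x) v)" for v
    using Suc.prems unfolding higher_differentiable_on.simps(2)[of "Suc n"] by (intro Suc.IH) blast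
  moreover have "\<forall>x\<in>U. f differentiable (at x)"
    using Suc.prems unfolding higher_differentiable_on.simps(2)[of "Suc n"] by blast
  ultimately show ?case unfolding higher_differentiable_on.simps(2)[of n] by blast
qed

lemma higher_differentiable_const: "higher_differentiable_on n U (\<lambda>_. c)"
proof (induction n arbitrary: c)
  case (Suc n)
  then show ?case by (simp add: frechet_derivative_const)
qed simp

lemma higher_differentiable_linear: "linear f \<Longrightarrow> higher_differentiable_on n U f"
proof (cases n)
  case 0
  assume "linear f" then show ?thesis using 0 by (simp add: linear_continuous_on linear_conv_bounded_linear)
next
  case (Suc m)
  assume "linear f"
  then have "bounded_linear f" by (simp add: linear_conv_bounded_linear)
  then have "(f has_derivative f) (at x)" for x by (rule bounded_linear_imp_has_derivative)
  then have "frechet_derivative f (at x) = f" "f differentiable (at x)" for x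
    by (auto simp: frechet_derivative_at[symmetric] differentiable_def)
  then show ?thesis using Suc by (simp add: higher_differentiable_const)
qed

lemma higher_differentiable_add:
  assumes "open U"
  shows "higher_differentiable_on n U f \<Longrightarrow> higher_differentiable_on n U g \<Longrightarrow>
   higher_differentiable_on n U (\<lambda>x. f x + g x)"
proof (induction n arbitrary: f g)
  case 0 then show ?case by (simp add: continuous_on_add)
next
  case (Suc n)
  have d: "(f has_derivative frechet_derivative f (at x)) (at x)"
     "(g has_derivative frechet_derivative g (at x)) (at x)" if "x \<in> U" for x
    using Suc.prems that by (auto simp: frechet_derivative_works[symmetric])
  have "((\<lambda>x. f x + g x) has_derivative (\<lambda>v. frechet_derivative f (at x) v + frechet_derivative g (at x) v)) (at x)"
    if "x \<in> U" for x using d[OF that] by (rule has_derivative_add)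
  then have e: "frechet_derivative (\<lambda>x. f x + g x) (at x) = (\<lambda>v. frechet_derivative f (at x) v + frechet_derivative g (at x) v)"
    "(\<lambda>x. f x + g x) differentiable (at x)" if "x \<in> U" for x
    using that by (auto simp: frechet_derivative_at[symmetric] differentiable_def)
  have "higher_differentiable_on n U (\<lambda>x. frechet_derivative (\<lambda>x. f x + g x) (at x) v)" for v
    using Suc.IH[of "\<lambda>x. frechet_derivative f (at x) v" "\<lambda>x. frechet_derivative g (at x) v"] Suc.prems
      higher_differentiable_cong[OF assms, of "\<lambda>x. frechet_derivative (\<lambda>x. f x + g x) (at x) v" "\<lambda>x. frechet_derivative f (at x) v + frechet_derivative g (at x) v"] e
    by auto
  then show ?case using e by auto
qed

lemma higher_differentiable_scaleR:
  fixes f :: "'a::euclidean_space \<Rightarrow> real" and g :: "'a \<Rightarrow> 'b::euclidean_space"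
  assumes "open U"
  shows "higher_differentiable_on n U f \<Longrightarrow> higher_differentiable_on n U g \<Longrightarrow>
   higher_differentiable_on n U (\<lambda>x. f x *\<^sub>R g x)"
proof (induction n arbitrary: f g)
  case 0 then show ?case by (simp add: continuous_on_scaleR)
next
  case (Suc n)
  have d: "(f has_derivative frechet_derivative f (at x)) (at x)"
     "(g has_derivative frechet_derivative g (at x)) (at x)" if "x \<in> U" for x
    using Suc.prems that by (auto simp: frechet_derivative_works[symmetric])
  have "((\<lambda>x. f x *\<^sub>R g x) has_derivative (\<lambda>v. f x *\<^sub>R frechet_derivative g (at x) v + frechet_derivative f (at x) v *\<^sub>R g x)) (at x)"
    if "x \<in> U" for x using d[OF that] by (rule has_derivative_scaleR)
  then have e: "frechet_derivative (\<lambda>x. f x *\<^sub>R g x) (at x) = (\<lambda>v. f x *\<^sub>R frechet_derivative g (at x) v + frechet_derivative f (at x) v *\<^sub>R g x)"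
    "(\<lambda>x. f x *\<^sub>R g x) differentiable (at x)" if "x \<in> U" for x
    using that by (auto simp: frechet_derivative_at[symmetric] differentiable_def)
  have "higher_differentiable_on n U (\<lambda>x. f x *\<^sub>R frechet_derivative g (at x) v + frechet_derivative f (at x) v *\<^sub>R g x)" for v
    using Suc.prems by (intro higher_differentiable_add assms Suc.IH) (auto intro: higher_differentiable_antimono)
  then have "higher_differentiable_on n U (\<lambda>x. frechet_derivative (\<lambda>x. f x *\<^sub>R g x) (at x) v)" for v
    using higher_differentiable_cong[OF assms, of "\<lambda>x. frechet_derivative (\<lambda>x. f x *\<^sub>R g x) (at x) v" "\<lambda>x. f x *\<^sub>R frechet_derivative g (at x) v + frechet_derivative f (at x) v *\<^sub>R g x"] e
    by auto
  then show ?case using e by auto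
qed

lemma higher_differentiable_sum:
  assumes "open U" "finite A" "\<And>i. i \<in> A \<Longrightarrow> higher_differentiable_on n U (f i)"
  shows "higher_differentiable_on n U (\<lambda>x. \<Sum>i\<in>A. f i x)"
  using assms(2,3) by (induction A rule: finite_induct) (auto simp: higher_differentiable_const intro!: higher_differentiable_add assms(1))

lemma higher_differentiable_inner_const:
  assumes "open U"
  shows "higher_differentiable_on n U f \<Longrightarrow> higher_differentiable_on n U (\<lambda>x. f x \<bullet> b)"
proof (induction n arbitrary: f)
  case 0 then show ?case by (auto intro!: continuous_intros)
next
  case (Suc n)
  have d: "(f has_derivative frechet_derivative f (at x)) (at x)" if "x \<in> U" for x
    using Suc.prems that by (auto simp: frechet_derivative_works[symmetric])
  have "((\<lambda>x. f x \<bullet> b) has_derivative (\<lambda>v. frechet_derivative f (at x) v \<bullet> b)) (at x)"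
    if "x \<in> U" for x using d[OF that] by (rule has_derivative_inner_left)
  then have e: "frechet_derivative (\<lambda>x. f x \<bullet> b) (at x) = (\<lambda>v. frechet_derivative f (at x) v \<bullet> b)"
    "(\<lambda>x. f x \<bullet> b) differentiable (at x)" if "x \<in> U" for x
    using that by (auto simp: frechet_derivative_at[symmetric] differentiable_def)
  have "higher_differentiable_on n U (\<lambda>x. frechet_derivative (\<lambda>x. f x \<bullet> b) (at x) v)" for v
    using Suc higher_differentiable_cong[OF assms, of "\<lambda>x. frechet_derivative (\<lambda>x. f x \<bullet> b) (at x) v" "\<lambda>x. frechet_derivative f (at x) v \<bullet> b"] e
    by auto
  then show ?case using e by auto
qed

text \<open>  The chain rule expresses the derivative of the composition in direction \<open>v\<close> as a sum of products of
  coordinates of \<open>Df v\<close> with partial derivatives of \<open>g\<close> composed with \<open>f\<close>. The former are one order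
  less differentiable than \<open>f\<close>, and to the latter the induction hypothesis applies.\<close>

lemma higher_differentiable_compose:
  fixes f :: "'a::euclidean_space \<Rightarrow> 'b::euclidean_space" and g :: "'b \<Rightarrow> 'c::euclidean_space"
  assumes "open U" "open V"
  shows "higher_differentiable_on n U f \<Longrightarrow> f ` U \<subseteq> V \<Longrightarrow> higher_differentiable_on n V g \<Longrightarrow>
    higher_differentiable_on n U (\<lambda>x. g (f x))"
proof (induction n arbitrary: g)
  case 0
  then show ?case by (auto intro: continuous_on_compose2)
next
  case (Suc n)
  let ?Df = "\<lambda>x. frechet_derivative f (at x)"
  let ?Dg = "\<lambda>x. frechet_derivative g (at x)"
  have d: "(f has_derivative ?Df x) (at x)" "(g has_derivative ?Dg (f x)) (at (f x))" if "x \<in> U" for x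
    using Suc.prems that by (auto simp: frechet_derivative_works[symmetric] image_subset_iff)
  have c: "((\<lambda>x. g (f x)) has_derivative (\<lambda>v. ?Dg (f x) (?Df x v))) (at x)" if "x \<in> U" for x
    using has_derivative_compose[OF d[OF that]] .
  have e: "frechet_derivative (\<lambda>x. g (f x)) (at x) v = (\<Sum>b\<in>Basis. (?Df x v \<bullet> b) *\<^sub>R ?Dg (f x) b)"
    if "x \<in> U" for x v
  proof -
    have l: "linear (?Dg (f x))" using d(2)[OF that] has_derivative_linear by blast
    have "frechet_derivative (\<lambda>x. g (f x)) (at x) v = ?Dg (f x) (?Df x v)"
      using frechet_derivative_at[OF c[OF that]] by metis
    also have "\<dots> = ?Dg (f x) (\<Sum>b\<in>Basis. (?Df x v \<bullet> b) *\<^sub>R b)"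
      by (simp add: euclidean_representation)
    finally show ?thesis by (simp add: linear_sum[OF l] linear_scale[OF l])
  qed
  have "higher_differentiable_on n U (\<lambda>x. \<Sum>b\<in>Basis. (?Df x v \<bullet> b) *\<^sub>R ?Dg (f x) b)" for v
  proof (intro higher_differentiable_sum higher_differentiable_scaleR higher_differentiable_inner_const assms(1))
    show "higher_differentiable_on n U (\<lambda>x. ?Df x v)" using Suc.prems by simp
    show "higher_differentiable_on n U (\<lambda>x. ?Dg (f x) b)" for b
      using Suc.prems by (intro Suc.IH) (auto intro: higher_differentiable_antimono)
  qed auto
  then have "higher_differentiable_on n U (\<lambda>x. frechet_derivative (\<lambda>x. g (f x)) (at x) v)" for v
    using higher_differentiable_cong[OF assms(1), of "\<lambda>x. frechet_derivative (\<lambda>x. g (f x)) (at x) v" "\<lambda>x. \<Sum>b\<in>Basis. (?Df x v \<bullet> b) *\<^sub>R ?Dg (f x) b"] e by auto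
  then show ?case using c by (auto simp: differentiable_def)
qed

lemma smooth_on_linear: "linear f \<Longrightarrow> smooth_on U f"
  by (simp add: smooth_on_def higher_differentiable_linear)

text \<open>  The derivative of an inhomogeneous quadratic map in a fixed direction is an affine map of the base
  point. All explicit nonlinear maps between spheres and groups below are of this kind.\<close>

lemma smooth_on_quadratic:
  assumes h: "bilinear h" and l: "linear l"
  shows "smooth_on U (\<lambda>x. h x x + l x + c)"
  unfolding smooth_on_def
proof
  fix n
  have hb: "bounded_bilinear h" using h bilinear_conv_bounded_bilinear by blast
  have lb: "bounded_linear l" using l by (simp add: linear_conv_bounded_linear)
  have d: "((\<lambda>x. h x x + l x + c) has_derivative (\<lambda>v. (h x v + h v x) + l v)) (at x)" for x
    using has_derivative_add[OF has_derivative_add[OF bounded_bilinear.FDERIV[OF hb has_derivative_ident has_derivative_ident]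
        bounded_linear_imp_has_derivative[OF lb]] has_derivative_const] by simp
  then have fd: "frechet_derivative (\<lambda>x. h x x + l x + c) (at x) = (\<lambda>v. (h x v + h v x) + l v)" for x
    by (rule frechet_derivative_at[symmetric])
  have "higher_differentiable_on m U (\<lambda>x. (h x v + h v x) + l v)" for m v
  proof -
    have "linear (\<lambda>x. h x v + h v x)"
      using h by (auto simp: bilinear_def intro: linear_compose_add)
    then have "higher_differentiable_on m UNIV (\<lambda>x. (h x v + h v x) + l v)"
      by (intro higher_differentiable_add higher_differentiable_linear higher_differentiable_const) auto
    then show ?thesis by (rule higher_differentiable_subset[rotated]) simp
  qed
  then show "higher_differentiable_on n U (\<lambda>x. h x x + l x + c)"
    using d by (cases n) (auto simp: fd differentiable_def intro!: continuous_at_imp_continuous_on has_derivative_continuous)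
qed

lemma smooth_mapI: "smooth_on UNIV f \<Longrightarrow> f \<in> M \<rightarrow> N \<Longrightarrow> smooth_map M N f"
  unfolding smooth_map_def by blast

lemma smooth_map_cong:
  assumes "smooth_map M N f" "\<And>x. x \<in> M \<Longrightarrow> f x = g x"
  shows "smooth_map M N g"
  using assms unfolding smooth_map_def by (fastforce simp: Pi_iff)

lemma smooth_map_compose:
  assumes f: "smooth_map M N f" and g: "smooth_map N K g"
  shows "smooth_map M K (\<lambda>x. g (f x))"
  unfolding smooth_map_def
proof (intro conjI ballI)
  show "(\<lambda>x. g (f x)) \<in> M \<rightarrow> K" using assms by (auto simp: smooth_map_def)
  fix x assume x: "x \<in> M"
  obtain U f1 where U: "open U" "x \<in> U" "smooth_on U f1" "\<forall>y\<in>M \<inter> U. f1 y = f y"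
    using f x unfolding smooth_map_def by blast
  have fx: "f x \<in> N" using f x by (auto simp: smooth_map_def)
  obtain V g1 where V: "open V" "f x \<in> V" "smooth_on V g1" "\<forall>y\<in>N \<inter> V. g1 y = g y"
    using g fx unfolding smooth_map_def by blast
  define W where "W = U \<inter> f1 -` V"
  have "continuous_on U f1" using U(3) higher_differentiable_on.simps(1) unfolding smooth_on_def by blast
  then have W: "open W" unfolding W_def using U(1) V(1) by (simp add: continuous_on_open_vimage Int_commute)
  have "higher_differentiable_on n W (\<lambda>x. g1 (f1 x))" for n
  proof (rule higher_differentiable_compose[OF W V(1)])
    show "higher_differentiable_on n W f1"
      using U(3) by (intro higher_differentiable_subset[of W U]) (auto simp: W_def smooth_on_def)
  qed (use V(3) in \<open>auto simp: W_def smooth_on_def\<close>)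
  then have "smooth_on W (\<lambda>x. g1 (f1 x))" by (simp add: smooth_on_def)
  moreover have "x \<in> W" using U x V by (simp add: W_def)
  moreover have "\<forall>y\<in>M \<inter> W. g1 (f1 y) = g (f y)"
    using U V f by (auto simp: W_def smooth_map_def Pi_iff)
  ultimately show "\<exists>U h. open U \<and> x \<in> U \<and> smooth_on U h \<and> (\<forall>y\<in>M \<inter> U. h y = g (f y))"
    using W by blast
qed

lemma diffeomorphismI:
  assumes "smooth_map M N f" "smooth_map N M g"
    "\<And>x. x \<in> M \<Longrightarrow> g (f x) = x" "\<And>y. y \<in> N \<Longrightarrow> f (g y) = y"
  shows "diffeomorphism M N f"
proof -
  have fg: "f \<in> M \<rightarrow> N" "g \<in> N \<rightarrow> M" using assms by (auto simp: smooth_map_def)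
  have b: "bij_betw f M N" by (rule bij_betw_byWitness[of _ g]) (use assms fg in auto)
  have "g y = inv_into M f y" if "y \<in> N" for y
    using that assms fg b by (metis bij_betw_def inv_into_f_f Pi_mem)
  then show ?thesis unfolding diffeomorphism_def
    using b assms smooth_map_cong by blast
qed

lemma diffeomorphismD:
  assumes "diffeomorphism M N f"
  shows "smooth_map M N f" "smooth_map N M (inv_into M f)" "x \<in> M \<Longrightarrow> f x \<in> N"
    "x \<in> M \<Longrightarrow> inv_into M f (f x) = x"
    "y \<in> N \<Longrightarrow> inv_into M f y \<in> M" "y \<in> N \<Longrightarrow> f (inv_into M f y) = y"
  using assms unfolding diffeomorphism_def bij_betw_def
  by (auto simp: f_inv_into_f inv_into_into)

lemma diffeomorphism_compose:
  assumes f: "diffeomorphism M N f" and g: "diffeomorphism N K g"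
  shows "diffeomorphism M K (\<lambda>x. g (f x))"
proof (rule diffeomorphismI[where g = "\<lambda>y. inv_into M f (inv_into N g y)"])
  show "smooth_map M K (\<lambda>x. g (f x))"
    using diffeomorphismD(1)[OF f] diffeomorphismD(1)[OF g] by (rule smooth_map_compose)
  show "smooth_map K M (\<lambda>y. inv_into M f (inv_into N g y))"
    using diffeomorphismD(2)[OF g] diffeomorphismD(2)[OF f] by (rule smooth_map_compose)
qed (simp_all add: diffeomorphismD[OF f] diffeomorphismD[OF g])

lemma diffeomorphism_inverse:
  assumes f: "diffeomorphism M N f"
  shows "diffeomorphism N M (inv_into M f)"
  by (rule diffeomorphismI[where g = f]) (simp_all add: diffeomorphismD[OF f])

lemma lie_group_iso_compose:
  "lie_group_iso G H f \<Longrightarrow> lie_group_iso H K g \<Longrightarrow> lie_group_iso G K (\<lambda>x. g (f x))"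
  unfolding lie_group_iso_def using iso_set_trans[of f G H g K]
  by (auto simp: o_def intro: diffeomorphism_compose)

section \<open>Eigenvectors of skew-symmetric operators\<close>

text \<open>  A minimum \<open>w\<close> of the quadratic form \<open>S x \<bullet> x\<close> on the unit sphere is an eigenvector: the form minus
  its minimum is nonnegative and vanishes at \<open>w\<close>, so its first variation in the direction
  \<open>h = S w - l w\<close> vanishes too, and this variation is \<open>2 |h|\<^sup>2\<close>.\<close>

lemma self_adjoint_min_eigenvector:
  fixes S :: "'a::euclidean_space \<Rightarrow> 'a"
  assumes lin: "linear S" and sa: "\<And>x y. S x \<bullet> y = x \<bullet> S y"
  obtains w l where "norm w = 1" "S w = l *\<^sub>R w" "\<And>x. l * (norm x)\<^sup>2 \<le> S x \<bullet> x"
proof -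
  have "continuous_on (sphere 0 1) (\<lambda>x. S x \<bullet> x)"
    using lin by (intro continuous_intros linear_continuous_on) (simp add: linear_conv_bounded_linear)
  moreover have "sphere (0::'a) 1 \<noteq> {}" by simp
  ultimately obtain w where w: "norm w = 1" and min: "\<And>x. norm x = 1 \<Longrightarrow> S w \<bullet> w \<le> S x \<bullet> x"
    using continuous_attains_inf[of "sphere (0::'a) 1" "\<lambda>x. S x \<bullet> x"] by auto
  define l where "l = S w \<bullet> w"
  have le: "l * (norm x)\<^sup>2 \<le> S x \<bullet> x" for x
  proof (cases "x = 0")
    case False
    then have "l \<le> S (x /\<^sub>R norm x) \<bullet> (x /\<^sub>R norm x)" using min[of "x /\<^sub>R norm x"] by (simp add: l_def)
    also have "\<dots> = (S x \<bullet> x) / (norm x)\<^sup>2"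
      by (simp add: linear_scale[OF lin] power2_eq_square divide_inverse)
    finally show ?thesis using False by (simp add: pos_le_divide_eq)
  qed (simp add: linear_0[OF lin])
  define h where "h = S w - l *\<^sub>R w"
  define b where "b = S h \<bullet> h - l * (norm h)\<^sup>2"
  have quad: "0 \<le> 2 * e * (norm h)\<^sup>2 + e\<^sup>2 * b" for e
  proof -
    have "0 \<le> S (w + e *\<^sub>R h) \<bullet> (w + e *\<^sub>R h) - l * (norm (w + e *\<^sub>R h))\<^sup>2" using le by simp
    also have "\<dots> = 2 * e * (S w \<bullet> h - l * (w \<bullet> h)) + e\<^sup>2 * b + (S w \<bullet> w - l * (w \<bullet> w))"
      using sa[of h w] unfolding power2_norm_eq_inner b_def
      by (simp add: linear_add[OF lin] linear_scale[OF lin] inner_add_left inner_add_right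
          inner_commute power2_eq_square algebra_simps)
    also have "S w \<bullet> h - l * (w \<bullet> h) = (norm h)\<^sup>2"
      unfolding power2_norm_eq_inner by (simp add: h_def inner_diff_left)
    also have "S w \<bullet> w - l * (w \<bullet> w) = 0" using w by (simp add: l_def norm_eq_1)
    finally show ?thesis by simp
  qed
  have "h = 0"
  proof (rule ccontr)
    assume "h \<noteq> 0"
    then have a: "(norm h)\<^sup>2 > 0" by simp
    have b: "b \<ge> 0" using le[of h] by (simp add: b_def)
    \<comment> \<open>Small and negative, so that the linear term of \<open>quad\<close> dominates.\<close>
    define e where "e = - (norm h)\<^sup>2 / (b + 1)"
    have "e < 0" using a b by (simp add: e_def)
    moreover have "0 \<le> e * (2 * (norm h)\<^sup>2 + e * b)"
      using quad[of e] by (simp add: algebra_simps power2_eq_square)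
    ultimately have "2 * (norm h)\<^sup>2 + e * b \<le> 0" by (simp add: zero_le_mult_iff)
    moreover have "e * b > - (norm h)\<^sup>2" using a b by (simp add: e_def field_simps)
    ultimately show False using a by linarith
  qed
  then have "S w = l *\<^sub>R w" by (simp add: h_def)
  then show ?thesis using that w le by blast
qed

text \<open>  For skew \<open>X\<close> the operator \<open>X\<^sup>2\<close> is self-adjoint with \<open>X\<^sup>2 x \<bullet> x = - |X x|\<^sup>2\<close>. A number \<open>n \<ge> 0\<close> as below
  is the absolute value of a weight of the circle generated by \<open>X\<close>.\<close>

lemma skew_eigenvector:
  fixes X :: "'a::euclidean_space \<Rightarrow> 'a"
  assumes lin: "linear X" and skew: "\<And>x y. X x \<bullet> y = - (x \<bullet> X y)"
  shows skew_min_eigenvector: "\<exists>w n. norm w = 1 \<and> 0 \<le> n \<and> X (X w) = - (n\<^sup>2 *\<^sub>R w) \<and> (\<forall>x. n * norm x \<le> norm (X x))"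
    and skew_max_eigenvector: "\<exists>w n. norm w = 1 \<and> 0 \<le> n \<and> X (X w) = - (n\<^sup>2 *\<^sub>R w) \<and> (\<forall>x. norm (X x) \<le> n * norm x)"
proof -
  have linXX: "linear (\<lambda>x. X (X x))" using linear_compose[OF lin lin] by (simp add: o_def)
  have sq: "X (X x) \<bullet> x = - (norm (X x))\<^sup>2" for x using skew[of "X x" x] by (simp add: power2_norm_eq_inner)
  obtain w l where w: "norm w = 1" "- X (X w) = l *\<^sub>R w" "\<And>x. l * (norm x)\<^sup>2 \<le> - X (X x) \<bullet> x"
    by (rule self_adjoint_min_eigenvector[of "\<lambda>x. - X (X x)"])
       (use linXX skew in \<open>auto intro: linear_compose_neg\<close>)
  have "l = (norm (X w))\<^sup>2"
    using arg_cong[OF w(2), of "\<lambda>y. y \<bullet> w"] w(1) sq[of w] by (simp add: norm_eq_1)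
  then have l: "sqrt l ^ 2 = l" "0 \<le> sqrt l" by auto
  have "sqrt l * norm x \<le> norm (X x)" for x
  proof (rule power2_le_imp_le)
    show "(sqrt l * norm x)\<^sup>2 \<le> (norm (X x))\<^sup>2" using w(3)[of x] sq[of x] l by (simp add: power_mult_distrib)
  qed simp
  moreover have "X (X w) = - ((sqrt l)\<^sup>2 *\<^sub>R w)" using w(2) l(1) by (metis minus_minus)
  ultimately show "\<exists>w n. norm w = 1 \<and> 0 \<le> n \<and> X (X w) = - (n\<^sup>2 *\<^sub>R w) \<and> (\<forall>x. n * norm x \<le> norm (X x))"
    using w l by blast
  obtain w l where w: "norm w = 1" "X (X w) = l *\<^sub>R w" "\<And>x. l * (norm x)\<^sup>2 \<le> X (X x) \<bullet> x"
    by (rule self_adjoint_min_eigenvector[of "\<lambda>x. X (X x)"]) (use linXX skew in auto)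
  have "- l = (norm (X w))\<^sup>2"
    using arg_cong[OF w(2), of "\<lambda>y. y \<bullet> w"] w(1) sq[of w] by (simp add: norm_eq_1)
  then have l: "sqrt (- l) ^ 2 = - l" "0 \<le> sqrt (- l)" by auto
  have "norm (X x) \<le> sqrt (- l) * norm x" for x
  proof (rule power2_le_imp_le)
    show "(norm (X x))\<^sup>2 \<le> (sqrt (- l) * norm x)\<^sup>2" using w(3)[of x] sq[of x] l by (simp add: power_mult_distrib)
    show "0 \<le> sqrt (- l) * norm x" using l by simp
  qed
  moreover have "X (X w) = - ((sqrt (- l))\<^sup>2 *\<^sub>R w)" using w(2) l(1) by simp
  ultimately show "\<exists>w n. norm w = 1 \<and> 0 \<le> n \<and> X (X w) = - (n\<^sup>2 *\<^sub>R w) \<and> (\<forall>x. norm (X x) \<le> n * norm x)"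
    using w l by blast
qed

section \<open>Orthogonal representations of the unit quaternions\<close>

abbreviation "quat_i \<equiv> vector [0,1,0,0] :: quat"
abbreviation "quat_j \<equiv> vector [0,0,1,0] :: quat"
abbreviation "quat_k \<equiv> vector [0,0,0,1] :: quat"

lemma imag_unitsI: "q $ 1 = 0 \<Longrightarrow> (q$2)\<^sup>2 + (q$3)\<^sup>2 + (q$4)\<^sup>2 = 1 \<Longrightarrow> q \<in> imag_units"
  by (auto simp: imag_units_def norm_quat intro!: norm_eq_oneI)

text \<open>By homogeneity this is freeness of the action on the unit sphere.\<close>

definition acts_freely :: "(quat \<Rightarrow> 'a::real_vector \<Rightarrow> 'a) \<Rightarrow> bool" where
  "acts_freely \<rho> \<longleftrightarrow> (\<forall>q x. norm q = 1 \<longrightarrow> q \<noteq> quat_one \<longrightarrow> \<rho> q x = x \<longrightarrow> x = 0)"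

text \<open>  An orthogonal representation \<open>\<rho>\<close> of Sp(1) together with its differential \<open>D\<close> at the identity. The
  derivative is required only along one-parameter subgroups; that it is linear in the direction is what
  makes the bracket relations available.\<close>

locale sp1_rep =
  fixes \<rho> :: "quat \<Rightarrow> 'a::euclidean_space \<Rightarrow> 'a" and D :: "quat \<Rightarrow> 'a \<Rightarrow> 'a"
  assumes orth: "norm q = 1 \<Longrightarrow> orthogonal_transformation (\<rho> q)"
    and one: "\<rho> quat_one x = x"
    and mult: "norm p = 1 \<Longrightarrow> norm q = 1 \<Longrightarrow> \<rho> (quat_mult p q) x = \<rho> p (\<rho> q x)"
    and D_linear: "linear (\<lambda>v. D v x)"
    and D_deriv: "v \<in> imag_units \<Longrightarrow> ((\<lambda>t. \<rho> (quat_cis v t) x) has_vector_derivative D v x) (at 0)"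
begin

lemma rho_linear: "norm q = 1 \<Longrightarrow> linear (\<rho> q)"
  using orth orthogonal_transformation_linear by blast

lemma D_flow:
  assumes v: "v \<in> imag_units"
  shows "((\<lambda>t. \<rho> (quat_cis v t) x) has_vector_derivative D v (\<rho> (quat_cis v t) x)) (at t)"
proof -
  let ?y = "\<rho> (quat_cis v t) x"
  have "((\<lambda>s. \<rho> (quat_cis v s) ?y) \<circ> (\<lambda>s. s - t) has_vector_derivative 1 *\<^sub>R D v ?y) (at t)"
    by (rule vector_diff_chain_at) (auto intro!: derivative_eq_intros D_deriv[OF v])
  moreover have "(\<lambda>s. \<rho> (quat_cis v s) ?y) \<circ> (\<lambda>s. s - t) = (\<lambda>s. \<rho> (quat_cis v s) x)"
    by (rule ext) (simp add: mult[symmetric] norm_quat_cis[OF v] quat_cis_add[OF v, symmetric])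
  ultimately show ?thesis by simp
qed

lemma D_apply_linear: assumes v: "v \<in> imag_units" shows "linear (D v)"
proof (rule linearI)
  note lin = rho_linear[OF norm_quat_cis[OF v]]
  show "D v (x + y) = D v x + D v y" for x y
  proof (rule vector_derivative_unique_at)
    show "((\<lambda>t. \<rho> (quat_cis v t) (x + y)) has_vector_derivative D v (x + y)) (at 0)" by (rule D_deriv[OF v])
    show "((\<lambda>t. \<rho> (quat_cis v t) (x + y)) has_vector_derivative D v x + D v y) (at 0)"
      unfolding linear_add[OF lin] by (intro has_vector_derivative_add D_deriv v)
  qed
  show "D v (r *\<^sub>R x) = r *\<^sub>R D v x" for r x
  proof (rule vector_derivative_unique_at)
    show "((\<lambda>t. \<rho> (quat_cis v t) (r *\<^sub>R x)) has_vector_derivative D v (r *\<^sub>R x)) (at 0)" by (rule D_deriv[OF v])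
    show "((\<lambda>t. \<rho> (quat_cis v t) (r *\<^sub>R x)) has_vector_derivative r *\<^sub>R D v x) (at 0)"
      unfolding linear_scale[OF lin]
      using bounded_linear.has_vector_derivative[OF bounded_linear_scaleR_right D_deriv[OF v]] by blast
  qed
qed

lemma D_skew: assumes v: "v \<in> imag_units" shows "D v x \<bullet> y = - (x \<bullet> D v y)"
proof -
  have "((\<lambda>t. \<rho> (quat_cis v t) x \<bullet> \<rho> (quat_cis v t) y) has_vector_derivative (x \<bullet> D v y + D v x \<bullet> y)) (at 0)"
    using bounded_bilinear.has_vector_derivative[OF bounded_bilinear_inner D_deriv[OF v, of x] D_deriv[OF v, of y]]
    by (simp add: one)
  moreover have "\<rho> (quat_cis v t) x \<bullet> \<rho> (quat_cis v t) y = x \<bullet> y" for t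
    using orth[OF norm_quat_cis[OF v]] by (simp add: orthogonal_transformation_def)
  ultimately have "((\<lambda>t. x \<bullet> y) has_vector_derivative (x \<bullet> D v y + D v x \<bullet> y)) (at (0::real))" by simp
  then have "x \<bullet> D v y + D v x \<bullet> y = 0"
    using vector_derivative_unique_at has_vector_derivative_const by blast
  then show ?thesis by linarith
qed

text \<open>  Both sides solve \<open>h' = X h\<close> with \<open>X = D v\<close> skew, so their difference has constant norm. This replaces
  the matrix exponential.\<close>

lemma flow_unique:
  assumes v: "v \<in> imag_units" and h: "\<And>t. (h has_vector_derivative D v (h t)) (at t)"
  shows "\<rho> (quat_cis v t) (h 0) = h t"
proof -
  let ?f = "\<lambda>t. \<rho> (quat_cis v t) (h 0)"
  have d: "((\<lambda>t. ?f t - h t) has_vector_derivative D v (?f t - h t)) (at t)" for t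
    unfolding linear_diff[OF D_apply_linear[OF v]] by (intro has_vector_derivative_diff D_flow v h)
  have z: "D v x \<bullet> x = 0" for x using D_skew[OF v, of x x] by (simp add: inner_commute)
  have "((\<lambda>t. (?f t - h t) \<bullet> (?f t - h t)) has_vector_derivative 0) (at t)" for t
    using bounded_bilinear.has_vector_derivative[OF bounded_bilinear_inner d[of t] d[of t]] z[of "?f t - h t"]
    by (simp add: inner_commute)
  then have "(?f t - h t) \<bullet> (?f t - h t) = (?f 0 - h 0) \<bullet> (?f 0 - h 0)"
    by (metis (no_types, lifting) DERIV_isconst_all has_real_derivative_iff_has_vector_derivative)
  then show ?thesis by (simp add: one)
qed

lemma weight_flow:
  assumes v: "v \<in> imag_units" and n: "n > 0" and w: "D v (D v w) = - (n\<^sup>2 *\<^sub>R w)"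
  shows "\<rho> (quat_cis v t) w = cos (n * t) *\<^sub>R w + (sin (n * t) / n) *\<^sub>R D v w"
proof -
  let ?h = "\<lambda>t. cos (n * t) *\<^sub>R w + (sin (n * t) / n) *\<^sub>R D v w"
  note lin = D_apply_linear[OF v]
  have "(?h has_vector_derivative D v (?h t)) (at t)" for t
    using n by (auto intro!: derivative_eq_intros
        simp: linear_add[OF lin] linear_scale[OF lin] w power2_eq_square algebra_simps has_real_derivative_iff_has_vector_derivative[symmetric])
  from flow_unique[OF v this, of t] show ?thesis by simp
qed

lemma zero_weight_fixed:
  assumes v: "v \<in> imag_units" and w: "D v w = 0"
  shows "\<rho> (quat_cis v t) w = w"
  using flow_unique[OF v, of "\<lambda>_. w" t] by (simp add: w)

lemma weight_periodic:
  assumes v: "v \<in> imag_units" and n: "n > 0" and w: "w \<noteq> 0" "D v (D v w) = - (n\<^sup>2 *\<^sub>R w)"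
    and fxd: "\<rho> (quat_cis v t) w = w"
  obtains m :: int where "n * t = of_int m * 2 * pi"
proof -
  have "w \<bullet> w = cos (n * t) * (w \<bullet> w)"
    using arg_cong[OF weight_flow[OF v n w(2), of t], of "\<lambda>y. y \<bullet> w"] fxd D_skew[OF v, of w w]
    by (simp add: inner_add_left inner_add_right inner_commute)
  then have "cos (n * t) = 1" using w(1) by simp
  then show ?thesis using that cos_one_2pi_int by blast
qed

text \<open>  Conjugation by \<open>e\<^sup>t\<^sup>u\<close> rotates \<open>v\<close> to \<open>v' = cos 2t v + sin 2t w\<close>. Applying \<open>\<rho>\<close>, differentiating along \<open>e\<^sup>s\<^sup>v\<close> at
  \<open>s = 0\<close> and then in \<open>t\<close> at \<open>t = 0\<close> gives the commutator.\<close>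

lemma bracket:
  assumes u: "u \<in> imag_units" and vw: "\<And>a b. a\<^sup>2 + b\<^sup>2 = 1 \<Longrightarrow> a *\<^sub>R v + b *\<^sub>R w \<in> imag_units"
    and m: "quat_mult u v = w" "quat_mult v u = - w" "quat_mult w u = v"
  shows "D u (D v x) - D v (D u x) = 2 *\<^sub>R D w x"
proof -
  have v: "v \<in> imag_units" using vw[of 1 0] by simp
  have conj: "\<rho> (quat_cis u t) (D v x) = cos (2*t) *\<^sub>R D v (\<rho> (quat_cis u t) x) + sin (2*t) *\<^sub>R D w (\<rho> (quat_cis u t) x)" for t
  proof -
    define v' where "v' = cos (2*t) *\<^sub>R v + sin (2*t) *\<^sub>R w"
    have v': "v' \<in> imag_units" unfolding v'_def by (rule vw) simp
    have c: "cos (2*t) * cos t + sin (2*t) * sin t = cos t" "sin (2*t) * cos t - cos (2*t) * sin t = sin t"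
      using cos_diff[of "2*t" t] sin_diff[of "2*t" t] by simp_all
    have "quat_mult v' (quat_cis u t) = (cos (2*t) * cos t + sin (2*t) * sin t) *\<^sub>R v + (sin (2*t) * cos t - cos (2*t) * sin t) *\<^sub>R w"
      unfolding v'_def quat_cis_def
      by (simp add: quat_mult.add_left quat_mult.add_right quat_mult.scaleR_left quat_mult.scaleR_right m algebra_simps)
    also have "\<dots> = quat_mult (quat_cis u t) v"
      unfolding c by (simp add: quat_cis_def quat_mult.add_left quat_mult.scaleR_left m)
    finally have "quat_mult (quat_cis u t) (quat_cis v s) = quat_mult (quat_cis v' s) (quat_cis u t)" for s
      by (simp add: quat_cis_def[of v] quat_cis_def[of v'] quat_mult.add_left quat_mult.add_right quat_mult.scaleR_left quat_mult.scaleR_right)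
    then have e: "\<rho> (quat_cis u t) (\<rho> (quat_cis v s) x) = \<rho> (quat_cis v' s) (\<rho> (quat_cis u t) x)" for s
      by (simp add: mult[symmetric] norm_quat_cis u v v')
    have "((\<lambda>s. \<rho> (quat_cis u t) (\<rho> (quat_cis v s) x)) has_vector_derivative \<rho> (quat_cis u t) (D v x)) (at 0)"
      by (rule bounded_linear.has_vector_derivative[OF _ D_deriv[OF v]])
         (simp add: linear_conv_bounded_linear[symmetric] rho_linear norm_quat_cis u)
    then have "\<rho> (quat_cis u t) (D v x) = D v' (\<rho> (quat_cis u t) x)"
      unfolding e using D_deriv[OF v'] vector_derivative_unique_at by blast
    then show ?thesis unfolding v'_def by (simp add: linear_add[OF D_linear] linear_scale[OF D_linear])
  qed
  have w: "w \<in> imag_units" using vw[of 0 1] by simp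
  have comp: "((\<lambda>t. D z (\<rho> (quat_cis u t) x)) has_vector_derivative D z (D u x)) (at 0)" if "z \<in> imag_units" for z
    by (rule bounded_linear.has_vector_derivative[OF _ D_deriv[OF u]])
       (simp add: linear_conv_bounded_linear[symmetric] D_apply_linear that)
  have "((\<lambda>t. cos (2*t) *\<^sub>R D v (\<rho> (quat_cis u t) x) + sin (2*t) *\<^sub>R D w (\<rho> (quat_cis u t) x))
      has_vector_derivative (D v (D u x) + 2 *\<^sub>R D w x)) (at 0)"
    by (auto intro!: derivative_eq_intros comp v w simp: one has_real_derivative_iff_has_vector_derivative[symmetric])
  then have "((\<lambda>t. \<rho> (quat_cis u t) (D v x)) has_vector_derivative (D v (D u x) + 2 *\<^sub>R D w x)) (at 0)"
    by (simp add: conj)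
  then have "D u (D v x) = D v (D u x) + 2 *\<^sub>R D w x"
    using D_deriv[OF u] vector_derivative_unique_at by blast
  then show ?thesis by simp
qed

lemma imag_units_ijk: "quat_i \<in> imag_units" "quat_j \<in> imag_units" "quat_k \<in> imag_units"
  by (auto intro!: imag_unitsI)

lemma brackets:
  "D quat_i (D quat_j x) = D quat_j (D quat_i x) + 2 *\<^sub>R D quat_k x"
  "D quat_j (D quat_k x) = D quat_k (D quat_j x) + 2 *\<^sub>R D quat_i x"
  "D quat_k (D quat_i x) = D quat_i (D quat_k x) + 2 *\<^sub>R D quat_j x"
proof -
  have "D quat_i (D quat_j x) - D quat_j (D quat_i x) = 2 *\<^sub>R D quat_k x"
    by (rule bracket) (auto intro!: imag_unitsI simp: quat_eq_iff quat_mult_nth)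
  moreover have "D quat_j (D quat_k x) - D quat_k (D quat_j x) = 2 *\<^sub>R D quat_i x"
    by (rule bracket) (auto intro!: imag_unitsI simp: quat_eq_iff quat_mult_nth)
  moreover have "D quat_k (D quat_i x) - D quat_i (D quat_k x) = 2 *\<^sub>R D quat_j x"
    by (rule bracket) (auto intro!: imag_unitsI simp: quat_eq_iff quat_mult_nth)
  ultimately show "D quat_i (D quat_j x) = D quat_j (D quat_i x) + 2 *\<^sub>R D quat_k x"
  "D quat_j (D quat_k x) = D quat_k (D quat_j x) + 2 *\<^sub>R D quat_i x"
  "D quat_k (D quat_i x) = D quat_i (D quat_k x) + 2 *\<^sub>R D quat_j x"
    by (simp_all add: diff_eq_eq add.commute)
qed

text \<open>  A representation of \<open>Sp(1)/{1, -1}\<close> contains a vector fixed by the maximal torus. Let \<open>n\<close> be the least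
  absolute value of a weight of \<open>X = D i\<close>, which is even because \<open>\<rho> (-1) = 1\<close>. If \<open>n \<ge> 2\<close>, the
  lowering operator \<open>Y + \<i> Z\<close> with \<open>Y = D j\<close>, \<open>Z = D k\<close> maps weight \<open>n\<close> to weight \<open>n - 2\<close>, hence to zero by
  minimality. But it is injective on positive weight spaces, as a vector \<open>w + \<i> q\<close> in its kernel satisfies
  \<open>|Y q|\<^sup>2 + |Z q|\<^sup>2 = - 2 n |q|\<^sup>2\<close>. In the proof complex vectors are written as pairs of real ones.\<close>

lemma even_rep_zero_weight:
  assumes even: "\<And>x. \<rho> (- quat_one) x = x"
  obtains z where "norm z = 1" "\<And>t. \<rho> (quat_cis quat_i t) z = z"
proof -
  note i = imag_units_ijk(1)
  note li = D_apply_linear[OF imag_units_ijk(1)] and lj = D_apply_linear[OF imag_units_ijk(2)] and lk = D_apply_linear[OF imag_units_ijk(3)]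
  obtain w n where w: "norm w = 1" "0 \<le> n" "D quat_i (D quat_i w) = - (n\<^sup>2 *\<^sub>R w)"
    and min: "\<And>x. n * norm x \<le> norm (D quat_i x)"
    using skew_min_eigenvector[OF D_apply_linear[OF i] D_skew[OF i]] by blast
  have "n = 0"
  proof (rule ccontr)
    assume "n \<noteq> 0"
    then have n: "n > 0" using w by simp
    have "quat_cis quat_i pi = - quat_one" by (simp add: quat_cis_def)
    then have "\<rho> (quat_cis quat_i pi) w = w" by (simp add: even)
    moreover have "w \<noteq> 0" using w(1) by auto
    ultimately obtain m :: int where "n * pi = of_int m * 2 * pi"
      using weight_periodic[OF i n _ w(3)] by blast
    then have "n = 2 * of_int m" by simp
    then have n2: "n \<ge> 2" using n by auto
    \<comment> \<open>\<open>w + \<i> q\<close> is a weight vector: \<open>X (w + \<i> q) = \<i> n (w + \<i> q)\<close>.\<close>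
    define q where "q = - ((1 / n) *\<^sub>R D quat_i w)"
    have X: "D quat_i w = - (n *\<^sub>R q)" "D quat_i q = n *\<^sub>R w"
      using n by (simp_all add: q_def linear_neg[OF li] linear_scale[OF li] w(3) power2_eq_square)
    \<comment> \<open>Real and imaginary parts of \<open>(Y + \<i> Z) (w + \<i> q)\<close>.\<close>
    define p' where "p' = D quat_j w - D quat_k q"
    define q' where "q' = D quat_j q + D quat_k w"
    have b3: "D quat_i (D quat_k x) = D quat_k (D quat_i x) - 2 *\<^sub>R D quat_j x" for x
      using brackets(3)[of x] by simp
    have "D quat_i p' = - ((n - 2) *\<^sub>R q')" "D quat_i q' = (n - 2) *\<^sub>R p'"
      by (simp_all add: b3 p'_def q'_def linear_diff[OF li] linear_add[OF li] brackets(1) X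
          linear_neg[OF lj] linear_scale[OF lj] linear_neg[OF lk] linear_scale[OF lk] algebra_simps)
    then have "n * norm p' \<le> (n - 2) * norm q'" "n * norm q' \<le> (n - 2) * norm p'"
      using min[of p'] min[of q'] n2 by simp_all
    then have "n * (norm p' + norm q') \<le> (n - 2) * (norm p' + norm q')" by (simp add: algebra_simps)
    then have "2 * (norm p' + norm q') \<le> 0" by (simp add: algebra_simps)
    then have "p' = 0" "q' = 0" by (smt (verit) norm_ge_zero norm_le_zero_iff)+
    then have e: "D quat_j w = D quat_k q" "D quat_k w = - D quat_j q"
      by (simp_all add: p'_def q'_def eq_neg_iff_add_eq_0 add.commute)
    have "- (D quat_j (D quat_j q)) - D quat_k (D quat_k q) = - ((2 * n) *\<^sub>R q)"
      using brackets(2)[of w] by (simp add: e X linear_neg[OF lj])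
    from arg_cong[OF this, of "\<lambda>y. y \<bullet> q"]
    have "(norm (D quat_j q))\<^sup>2 + (norm (D quat_k q))\<^sup>2 = - (2 * n * (q \<bullet> q))"
      using D_skew[OF imag_units_ijk(2), of "D quat_j q" q] D_skew[OF imag_units_ijk(3), of "D quat_k q" q]
      by (simp add: inner_diff_left power2_norm_eq_inner)
    moreover have "0 \<le> 2 * n * (q \<bullet> q)" using n by simp
    ultimately have "2 * n * (q \<bullet> q) = 0" by (smt (verit) zero_le_power2)
    then have "q = 0" using n by simp
    then have "n *\<^sub>R w = 0" using X(2) linear_0[OF li] by simp
    then show False using n w(1) by auto
  qed
  then have "D quat_i (D quat_i w) = 0" using w by simp
  then have "D quat_i w = 0" using D_skew[OF i, of "D quat_i w" w] by simp
  then show ?thesis using that w(1) zero_weight_fixed[OF i] by blast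
qed

lemma free_if_torus_free:
  assumes tf: "\<And>t x. quat_cis quat_i t \<noteq> quat_one \<Longrightarrow> \<rho> (quat_cis quat_i t) x = x \<Longrightarrow> x = 0"
  shows "acts_freely \<rho>"
  unfolding acts_freely_def
proof (intro allI impI)
  fix q x assume q: "norm q = 1" "q \<noteq> quat_one" and fxd: "\<rho> q x = x"
  obtain v t where v: "v \<in> imag_units" and qc: "q = quat_cis v t" using unit_quat_is_cis[OF q(1)] .
  obtain p where p: "norm p = 1" "quat_mult p v = quat_mult quat_i p" using imag_unit_conjugate[OF v] .
  have "quat_mult p q = quat_mult (quat_cis quat_i t) p"
    by (simp add: qc quat_cis_def quat_mult.add_left quat_mult.add_right quat_mult.scaleR_left quat_mult.scaleR_right p)
  then have "\<rho> (quat_cis quat_i t) (\<rho> p x) = \<rho> p x"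
    using fxd by (metis mult norm_quat_cis imag_units_ijk(1) p(1) q(1))
  moreover have "quat_cis quat_i t \<noteq> quat_one"
  proof
    assume "quat_cis quat_i t = quat_one"
    then have "cos t = 1" "sin t = 0" by (simp_all add: quat_cis_def quat_eq_iff quat_one_def)
    then show False using q(2) by (simp add: qc quat_cis_def)
  qed
  ultimately have "\<rho> p x = 0" by (rule tf[rotated])
  then show "x = 0" using orthogonal_transformation_norm[OF orth[OF p(1)], of x] by simp
qed

text \<open>  The circle \<open>e\<^sup>t\<^sup>v\<close> has integral weights, and a vector of weight \<open>n \<noteq> 0\<close> is fixed at \<open>t = 2 pi / n\<close>. So
  freeness leaves only the weights \<open>1\<close> and \<open>-1\<close>.\<close>

lemma free_D_square:
  assumes free: "acts_freely \<rho>"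
    and v: "v \<in> imag_units"
  shows "D v (D v x) = - x"
proof -
  have weight: "n = 1" if w: "norm w = 1" "0 \<le> n" "D v (D v w) = - (n\<^sup>2 *\<^sub>R w)" for w n
  proof -
    have w0: "w \<noteq> 0" using w(1) by auto
    have fr: "quat_cis v t = quat_one" if "\<rho> (quat_cis v t) w = w" for t
      using free norm_quat_cis[OF v] that w0 unfolding acts_freely_def by blast
    have "n \<noteq> 0"
    proof
      assume "n = 0"
      then have "D v (D v w) = 0" using w by simp
      then have "D v w = 0" using D_skew[OF v, of "D v w" w] by simp
      from fr[OF zero_weight_fixed[OF v this], of pi] show False
        by (simp add: quat_cis_def quat_one_def quat_eq_iff)
    qed
    then have n: "n > 0" using w(2) by simp
    have "\<rho> (quat_cis v (2 * pi / n)) w = w" using weight_flow[OF v n w(3), of "2 * pi / n"] n by simp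
    then have "quat_cis v (2 * pi / n) = quat_one" by (rule fr)
    then have "quat_cis v (2 * pi / n) $ 1 = 1" by (simp add: quat_one_def)
    then have "cos (2 * pi / n) = 1" using v by (simp add: quat_cis_def imag_units_def quat_one_def)
    then obtain m :: int where "2 * pi / n = of_int m * 2 * pi" using cos_one_2pi_int by blast
    then have m: "n * of_int m = 1" using n by (simp add: field_simps)
    have "quat_cis v (2 * pi) = quat_one" by (simp add: quat_cis_def)
    then have "\<rho> (quat_cis v (2 * pi)) w = w" by (simp add: one)
    then obtain k :: int where "n * (2 * pi) = of_int k * 2 * pi" using weight_periodic[OF v n w0 w(3)] by blast
    then have k: "n = of_int k" by simp
    with m have "k * m = 1" by (metis of_int_eq_1_iff of_int_mult)
    then show "n = 1" using n k by (auto simp: zmult_eq_1_iff)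
  qed
  obtain w n where min: "norm w = 1" "0 \<le> n" "D v (D v w) = - (n\<^sup>2 *\<^sub>R w)" "\<And>x. n * norm x \<le> norm (D v x)"
    using skew_min_eigenvector[OF D_apply_linear[OF v] D_skew[OF v]] by blast
  have "norm x \<le> norm (D v x)" for x
    using weight[OF min(1,2,3)] min(4)[of x] by simp
  moreover obtain w n where max: "norm w = 1" "0 \<le> n" "D v (D v w) = - (n\<^sup>2 *\<^sub>R w)" "\<And>x. norm (D v x) \<le> n * norm x"
    using skew_max_eigenvector[OF D_apply_linear[OF v] D_skew[OF v]] by blast
  have "norm (D v x) \<le> norm x" for x
    using weight[OF max(1,2,3)] max(4)[of x] by simp
  ultimately have nD: "norm (D v x) = norm x" for x by (meson order_antisym)
  have "(norm (D v (D v x) + x))\<^sup>2 = (norm (D v (D v x)))\<^sup>2 + 2 * (D v (D v x) \<bullet> x) + (norm x)\<^sup>2"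
    by (simp add: power2_norm_eq_inner inner_add_left inner_add_right inner_commute)
  also have "D v (D v x) \<bullet> x = - (norm (D v x))\<^sup>2" by (simp add: D_skew[OF v] power2_norm_eq_inner)
  finally have "norm (D v (D v x) + x) = 0" by (simp add: nD)
  then show ?thesis by (simp add: eq_neg_iff_add_eq_0)
qed

text \<open>  By \<open>free_D_square\<close> and \<open>weight_flow\<close>, a free representation satisfies
  \<open>\<rho> (e\<^sup>t\<^sup>v) = cos t + sin t (D v)\<close>, so it is the restriction of a map that is linear in the quaternion.
  That map turns the space into a quaternionic vector space.\<close>

definition quat_ext :: "quat \<Rightarrow> 'a \<Rightarrow> 'a" where
  "quat_ext q x = (q $ 1) *\<^sub>R x + D (q - (q $ 1) *\<^sub>R quat_one) x"

lemma quat_ext_linear_left: "linear (\<lambda>q. quat_ext q x)"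
proof (rule linearI)
  have e: "p + q - ((p + q) $ 1) *\<^sub>R quat_one = (p - (p $ 1) *\<^sub>R quat_one) + (q - (q $ 1) *\<^sub>R quat_one)" for p q :: quat
    by (simp add: algebra_simps)
  show "quat_ext (p + q) x = quat_ext p x + quat_ext q x" for p q
    unfolding quat_ext_def e linear_add[OF D_linear] by (simp add: scaleR_add_left)
  have e: "r *\<^sub>R q - ((r *\<^sub>R q) $ 1) *\<^sub>R quat_one = r *\<^sub>R (q - (q $ 1) *\<^sub>R quat_one)" for r and q :: quat
    by (simp add: algebra_simps)
  show "quat_ext (r *\<^sub>R q) x = r *\<^sub>R quat_ext q x" for r q
    unfolding quat_ext_def e linear_scale[OF D_linear] by (simp add: scaleR_add_right)
qed

lemma quat_ext_eq:
  assumes free: "acts_freely \<rho>"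
    and q: "norm q = 1"
  shows "quat_ext q x = \<rho> q x"
proof -
  obtain v t where v: "v \<in> imag_units" and qc: "q = quat_cis v t" using unit_quat_is_cis[OF q] .
  have "v $ 1 = 0" using v by (simp add: imag_units_def)
  then have "q $ 1 = cos t" "q - (q $ 1) *\<^sub>R quat_one = sin t *\<^sub>R v"
    by (simp_all add: qc quat_cis_def quat_one_def)
  then have "quat_ext q x = cos t *\<^sub>R x + sin t *\<^sub>R D v x"
    unfolding quat_ext_def by (simp add: linear_scale[OF D_linear])
  then show ?thesis using weight_flow[OF v, of 1 x t] free_D_square[OF free v] by (simp add: qc)
qed

lemma quat_ext_scale:
  assumes free: "acts_freely \<rho>"
    and q: "q \<noteq> 0"
  shows "quat_ext q x = norm q *\<^sub>R \<rho> (q /\<^sub>R norm q) x"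
  using quat_ext_eq[OF free, of "q /\<^sub>R norm q" x] linear_scale[OF quat_ext_linear_left, of "norm q" "q /\<^sub>R norm q" x] q
  by simp

lemma quat_ext_0: "quat_ext 0 x = 0"
  by (rule linear_0[OF quat_ext_linear_left])

lemma quat_ext_linear_right:
  assumes free: "acts_freely \<rho>"
  shows "linear (quat_ext q)"
proof (cases "q = 0")
  case False
  then have "norm (q /\<^sub>R norm q) = 1" by simp
  then have "linear (\<lambda>x. norm q *\<^sub>R \<rho> (q /\<^sub>R norm q) x)" by (intro linear_compose_scale_right rho_linear)
  then show ?thesis using quat_ext_scale[OF free False] by (simp add: linear_iff)
next
  case True
  then show ?thesis by (auto intro!: linearI simp: quat_ext_0)
qed

lemma quat_ext_mult:
  assumes free: "acts_freely \<rho>"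
  shows "quat_ext (quat_mult p q) x = quat_ext p (quat_ext q x)"
proof (cases "p = 0 \<or> q = 0")
  case True
  have "linear (quat_ext p)" by (rule quat_ext_linear_right[OF free])
  then show ?thesis using True by (auto simp: quat_ext_0 quat_mult.zero_left quat_mult.zero_right linear_0)
next
  case False
  then have pq: "norm (p /\<^sub>R norm p) = 1" "norm (q /\<^sub>R norm q) = 1" by auto
  have n0: "quat_mult p q \<noteq> 0" using False norm_quat_mult[of p q] by auto
  have "quat_mult p q /\<^sub>R norm (quat_mult p q) = quat_mult (p /\<^sub>R norm p) (q /\<^sub>R norm q)"
    by (simp add: norm_quat_mult quat_mult.scaleR_left quat_mult.scaleR_right)
  then show ?thesis
    using False n0 by (simp add: quat_ext_scale[OF free] mult[OF pq] norm_quat_mult linear_scale[OF rho_linear[OF pq(1)]])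
qed

lemma quat_ext_norm:
  assumes free: "acts_freely \<rho>"
  shows "norm (quat_ext q x) = norm q * norm x"
  by (cases "q = 0") (simp_all add: quat_ext_0 quat_ext_scale[OF free] orthogonal_transformation_norm[OF orth])

lemma quat_ext_adjoint:
  assumes free: "acts_freely \<rho>"
  shows "quat_ext q x \<bullet> y = x \<bullet> quat_ext (quat_conj q) y"
proof (cases "q = 0")
  case False
  define u where "u = q /\<^sub>R norm q"
  have u: "norm u = 1" "norm (quat_conj u) = 1" using False by (simp_all add: u_def)
  have c: "quat_conj u = quat_conj q /\<^sub>R norm q" by (simp add: u_def quat_eq_iff)
  have "quat_mult (quat_conj u) u = quat_one" using u by (simp add: quat_mult_conj)
  then have "\<rho> (quat_conj u) (\<rho> u x) = x" using mult[OF u(2,1), of x] one by simp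
  then have "\<rho> u x \<bullet> y = x \<bullet> \<rho> (quat_conj u) y"
    using orth[OF u(2)] unfolding orthogonal_transformation_def by metis
  moreover have "quat_conj q \<noteq> 0" using False norm_quat_conj[of q] by (metis norm_eq_zero)
  ultimately show ?thesis using False by (simp add: quat_ext_scale[OF free] u_def c flip: c)
next
  case True
  then have "quat_conj q = 0" by (simp add: quat_eq_iff)
  then show ?thesis using True by (simp add: quat_ext_0)
qed

end

lemma orthogonal_transformation_inv_cancel:
  fixes f :: "'a::euclidean_space \<Rightarrow> 'a"
  assumes "orthogonal_transformation f"
  shows "inv_into UNIV f (f x) = x" "f (inv_into UNIV f x) = x"
  using orthogonal_transformation_bij[OF assms] by (simp_all add: bij_is_inj bij_is_surj surj_f_inv_f)

text \<open>  With the quaternionic structure \<open>quat_ext\<close> the octonions are two-dimensional over the quaternions.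
  A unit vector \<open>e1\<close> and a unit vector \<open>e2\<close> orthogonal to the quaternionic line through \<open>e1\<close> form a
  quaternionic orthonormal basis, which identifies the representation with the Hopf action.\<close>

lemma free_rep_is_hopf:
  fixes \<rho> :: "quat \<Rightarrow> oct \<Rightarrow> oct"
  assumes rep: "sp1_rep \<rho> D"
    and free: "acts_freely \<rho>"
  obtains Q where "orthogonal_transformation Q" "\<And>q x. norm q = 1 \<Longrightarrow> Q (\<rho> q x) = hopf q (Q x)"
proof -
  interpret sp1_rep \<rho> D by (rule rep)
  define e1 where "e1 = oct_one"
  have "dim (range (\<lambda>q. quat_ext q e1)) \<le> dim (UNIV :: quat set)"
    by (rule dim_image_le[OF quat_ext_linear_left])
  also have "\<dots> < DIM(oct)" by simp
  finally obtain e where e: "e \<noteq> 0" "\<And>y. y \<in> span (range (\<lambda>q. quat_ext q e1)) \<Longrightarrow> orthogonal e y"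
    using orthogonal_to_subspace_exists by blast
  define e2 where "e2 = e /\<^sub>R norm e"
  have n: "norm e1 = 1" "norm e2 = 1" using e(1) by (simp_all add: e1_def e2_def)
  have o: "quat_ext q e1 \<bullet> e2 = 0" for q
    using e(2)[of "quat_ext q e1"] by (simp add: e2_def span_base orthogonal_def inner_commute)
  define P where "P b = quat_ext (oct_fst b) e1 + quat_ext (oct_snd b) e2" for b
  have "linear P" unfolding P_def
    using linear_compose[OF linear_oct_fst quat_ext_linear_left[of e1]] linear_compose[OF linear_oct_snd quat_ext_linear_left[of e2]]
    by (intro linear_compose_add) (simp_all add: o_def)
  moreover have "norm (P b) = norm b" for b
  proof -
    have "quat_ext p e1 \<bullet> quat_ext q e2 = 0" for p q
      using quat_ext_adjoint[OF free, of "quat_conj q" "quat_ext p e1" e2] o[of "quat_mult (quat_conj q) p"]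
      by (simp add: quat_ext_mult[OF free])
    then have "(norm (P b))\<^sup>2 = (norm (quat_ext (oct_fst b) e1))\<^sup>2 + (norm (quat_ext (oct_snd b) e2))\<^sup>2"
      by (simp add: P_def power2_norm_eq_inner inner_add_left inner_add_right inner_commute)
    also have "\<dots> = (norm b)\<^sup>2" by (simp add: n norm_oct quat_ext_norm[OF free])
    finally show ?thesis by (simp add: power2_eq_iff_nonneg)
  qed
  ultimately have P: "orthogonal_transformation P" by (simp add: orthogonal_transformation)
  have hP: "\<rho> q (P b) = P (hopf q b)" if "norm q = 1" for q b
    by (simp add: quat_ext_eq[OF free that, symmetric] P_def linear_add[OF quat_ext_linear_right[OF free]] hopf_def
        quat_ext_mult[OF free])
  have "inv_into UNIV P (\<rho> q x) = hopf q (inv_into UNIV P x)" if "norm q = 1" for q x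
    using hP[OF that, of "inv_into UNIV P x"] by (metis orthogonal_transformation_inv_cancel[OF P])
  then show ?thesis using that orthogonal_transformation_inv[OF P] by blast
qed

section \<open>The groups Spin(8) and Spin(7)\<close>

text \<open>Inverses in these groups are transposes, so \<open>transpose A *v x\<close> has to stay in this form.\<close>

declare transpose_matrix_vector [simp del]

lemma rotation_matrix_mult: "rotation_matrix A \<Longrightarrow> rotation_matrix B \<Longrightarrow> rotation_matrix (A ** (B :: real^'n^'n))"
  by (auto simp: rotation_matrix_def det_mul intro: orthogonal_matrix_mul)

lemma rotation_matrix_one: "rotation_matrix (mat 1)"
  by (simp add: rotation_matrix_def orthogonal_matrix_id)

lemma rotation_matrix_transpose: "rotation_matrix A \<Longrightarrow> rotation_matrix (transpose A)"
  by (simp add: rotation_matrix_def det_transpose)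

lemma rotation_matrix_cancel:
  assumes "rotation_matrix (A :: real^'n^'n)"
  shows "transpose A ** A = mat 1" "A ** transpose A = mat 1"
    "transpose A *v (A *v x) = x" "A *v (transpose A *v x) = x"
  using assms by (simp_all add: rotation_matrix_def orthogonal_matrix_def matrix_vector_mul_assoc)

lemma rotation_matrix_orth: "rotation_matrix A \<Longrightarrow> orthogonal_transformation ((*v) (A :: real^'n^'n))"
  by (simp add: rotation_matrix_def orthogonal_transformation_matrix)

lemma rotation_matrix_norm: "rotation_matrix A \<Longrightarrow> norm (A *v x) = norm (x :: real^'n)"
  using rotation_matrix_orth orthogonal_transformation_norm by blast

lemma triality_mult: "triality A B C \<Longrightarrow> triality A' B' C' \<Longrightarrow> triality (A ** A') (B ** B') (C ** C')"
  by (simp add: triality_def matrix_vector_mul_assoc[symmetric])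

lemma triality_one: "triality (mat 1) (mat 1) (mat 1)"
  by (simp add: triality_def)

lemma triality_transpose:
  assumes "rotation_matrix A" "rotation_matrix B" "rotation_matrix C" "triality A B C"
  shows "triality (transpose A) (transpose B) (transpose C)"
  unfolding triality_def
proof (intro allI)
  fix x y
  have "C *v oct_mult (transpose A *v x) (transpose B *v y) = oct_mult x y"
    using assms by (simp add: triality_def[THEN iffD1, OF assms(4), rule_format, symmetric] rotation_matrix_cancel)
  then show "oct_mult (transpose A *v x) (transpose B *v y) = transpose C *v oct_mult x y"
    using rotation_matrix_cancel(3)[OF assms(3)] by metis
qed

lemma carrier_SO [simp]: "A \<in> carrier SO \<longleftrightarrow> rotation_matrix A"
  and mult_SO [simp]: "A \<otimes>\<^bsub>SO\<^esub> B = A ** B"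
  and one_SO [simp]: "\<one>\<^bsub>SO\<^esub> = mat 1"
  by (simp_all add: SO_def)

lemma carrier_Spin8: "(A, B) \<in> carrier Spin8 \<longleftrightarrow> rotation_matrix A \<and> rotation_matrix B \<and> (\<exists>C. rotation_matrix C \<and> triality A B C)"
  by (auto simp: Spin8_def)

lemma mult_Spin8 [simp]: "g \<otimes>\<^bsub>Spin8\<^esub> h = (fst g ** fst h, snd g ** snd h)"
  by (simp add: Spin8_def mult_DirProd')

lemma one_Spin8 [simp]: "\<one>\<^bsub>Spin8\<^esub> = (mat 1, mat 1)"
  by (simp add: Spin8_def)

lemma carrier_Spin7: "(A, B) \<in> carrier Spin7 \<longleftrightarrow> rotation_matrix A \<and> rotation_matrix B \<and> triality A B B"
  by (auto simp: Spin7_def carrier_Spin8)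

lemma mult_Spin7 [simp]: "g \<otimes>\<^bsub>Spin7\<^esub> h = (fst g ** fst h, snd g ** snd h)"
  by (simp add: Spin7_def)

lemma one_Spin7 [simp]: "\<one>\<^bsub>Spin7\<^esub> = (mat 1, mat 1)"
  by (simp add: Spin7_def)

lemma as_group_Spin7: "as_group Spin7 L = as_group Spin8 L"
  by (simp add: Spin7_def)

lemma group_Spin8: "group Spin8"
proof (rule groupI)
  show "\<exists>y\<in>carrier Spin8. y \<otimes>\<^bsub>Spin8\<^esub> x = \<one>\<^bsub>Spin8\<^esub>" if x: "x \<in> carrier Spin8" for x
  proof (cases x)
    case (Pair A B)
    then obtain C where C: "rotation_matrix A" "rotation_matrix B" "rotation_matrix C" "triality A B C"
      using x by (auto simp: carrier_Spin8)
    have "(transpose A, transpose B) \<in> carrier Spin8"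
      using C triality_transpose[OF C] rotation_matrix_transpose unfolding carrier_Spin8 by blast
    then show ?thesis using C by (auto simp: Pair rotation_matrix_cancel intro!: bexI)
  qed
  show "x \<otimes>\<^bsub>Spin8\<^esub> y \<in> carrier Spin8" if "x \<in> carrier Spin8" "y \<in> carrier Spin8" for x y
    using that by (cases x; cases y) (auto simp: carrier_Spin8 intro: rotation_matrix_mult dest: triality_mult)
qed (auto simp: carrier_Spin8 matrix_mul_assoc intro: rotation_matrix_one triality_one)

lemma inv_Spin8:
  assumes "(A, B) \<in> carrier Spin8"
  shows "inv\<^bsub>Spin8\<^esub> (A, B) = (transpose A, transpose B)"
proof (rule group.inv_equality[OF group_Spin8])
  obtain C where C: "rotation_matrix A" "rotation_matrix B" "rotation_matrix C" "triality A B C"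
    using assms by (auto simp: carrier_Spin8)
  show "(transpose A, transpose B) \<in> carrier Spin8"
    using C triality_transpose[OF C] rotation_matrix_transpose unfolding carrier_Spin8 by blast
  show "(transpose A, transpose B) \<otimes>\<^bsub>Spin8\<^esub> (A, B) = \<one>\<^bsub>Spin8\<^esub>"
    using C by (simp add: rotation_matrix_cancel)
qed (rule assms)

lemma subgroup_Spin7: "subgroup (carrier Spin7) Spin8"
proof (rule group.subgroupI[OF group_Spin8])
  show "carrier Spin7 \<subseteq> carrier Spin8" by (auto simp: carrier_Spin7 carrier_Spin8)
  then show "inv\<^bsub>Spin8\<^esub> g \<in> carrier Spin7" if g: "g \<in> carrier Spin7" for g
    using g by (cases g) (auto simp: inv_Spin8 carrier_Spin7 rotation_matrix_transpose triality_transpose subset_iff carrier_Spin8)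
  show "carrier Spin7 \<noteq> {}" using carrier_Spin7[of "mat 1" "mat 1"] rotation_matrix_one triality_one by blast
qed (auto simp: carrier_Spin7 intro: rotation_matrix_mult triality_mult)

lemma Spin7_as_subgroup: "Spin7 = as_group Spin8 (carrier Spin7)"
  by (simp add: Spin7_def)

lemma group_Spin7: "group Spin7"
  using subgroup.subgroup_is_group[OF subgroup_Spin7 group_Spin8] Spin7_as_subgroup by simp

lemma inv_Spin7:
  assumes "(A, B) \<in> carrier Spin7"
  shows "inv\<^bsub>Spin7\<^esub> (A, B) = (transpose A, transpose B)"
proof -
  have "(A, B) \<in> carrier Spin8" using assms by (auto simp: carrier_Spin7 carrier_Spin8)
  then show ?thesis
    using group.m_inv_consistent[OF group_Spin8 subgroup_Spin7 assms] inv_Spin8[of A B]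
    by (simp add: Spin7_as_subgroup[symmetric])
qed

lemma subgroup_Spin7_Spin8: "subgroup L Spin7 \<Longrightarrow> subgroup L Spin8"
  using group.incl_subgroup[OF group_Spin8 subgroup_Spin7] Spin7_as_subgroup by simp

lemma spin_act_S7xS7: "g \<in> carrier Spin8 \<Longrightarrow> m \<in> S7xS7 \<Longrightarrow> spin_act g m \<in> S7xS7"
  by (cases g; cases m) (auto simp: spin_act_def S7xS7_def carrier_Spin8 rotation_matrix_norm)

text \<open>Evaluate the triality equation at \<open>x = 1\<close>.\<close>

lemma Spin7_fixes_one:
  assumes "(A, B) \<in> carrier Spin7" shows "A *v oct_one = oct_one"
proof -
  have r: "rotation_matrix B" and t: "triality A B B" using assms by (auto simp: carrier_Spin7)
  have "oct_mult (A *v oct_one) (B *v y) = oct_mult oct_one (B *v y)" for y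
    using t[unfolded triality_def, rule_format, of oct_one y] by simp
  from this[of "transpose B *v oct_one"] show ?thesis by (simp add: rotation_matrix_cancel[OF r])
qed

lemma rotation_matrix_inner: "rotation_matrix A \<Longrightarrow> (A *v x) \<bullet> (A *v y) = x \<bullet> (y :: real^'n)"
  using rotation_matrix_orth unfolding orthogonal_transformation_def by blast

lemma Spin7_real_part:
  assumes "(A, B) \<in> carrier Spin7" shows "(A *v x) $ 1 = x $ 1"
proof -
  have "(A *v x) \<bullet> (A *v oct_one) = x \<bullet> oct_one"
    using assms by (intro rotation_matrix_inner) (auto simp: carrier_Spin7)
  then show ?thesis by (simp add: Spin7_fixes_one[OF assms] inner_oct_one)
qed

lemma spin_act_S6xS7: "g \<in> carrier Spin7 \<Longrightarrow> m \<in> S6xS7 \<Longrightarrow> spin_act g m \<in> S6xS7"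
  by (cases g; cases m)
    (auto simp: spin_act_def S7xS7_def S6xS7_def carrier_Spin7 rotation_matrix_norm Spin7_real_part)

section \<open>SU(2) and the unit quaternions\<close>

definition quat_su2 :: "quat \<Rightarrow> complex^2^2" where
  "quat_su2 q = vector [vector [Complex (q$1) (q$2), Complex (q$3) (q$4)],
                        vector [Complex (- q$3) (q$4), Complex (q$1) (- q$2)]]"

lemma su2_quat_nth [simp]: "su2_quat U $ 1 = Re (U$1$1)" "su2_quat U $ 2 = Im (U$1$1)"
  "su2_quat U $ 3 = Re (U$1$2)" "su2_quat U $ 4 = Im (U$1$2)"
  by (simp_all add: su2_quat_def)

lemma su2_quat_su2 [simp]: "su2_quat (quat_su2 q) = q"
  by (simp add: quat_eq_iff quat_su2_def)

lemma linear_su2_quat: "linear su2_quat"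
  by (auto intro!: linearI simp: quat_eq_iff)

lemma linear_quat_su2: "linear quat_su2"
  by (auto intro!: linearI simp: quat_su2_def vec_eq_iff forall_2 complex_eq_iff)

lemma quat_su2_mult: "quat_su2 (quat_mult p q) = quat_su2 p ** quat_su2 q"
  by (simp add: quat_su2_def vec_eq_iff forall_2 matrix_matrix_mult_def sum_2 complex_eq_iff quat_mult_nth algebra_simps)

lemma quat_su2_one: "quat_su2 quat_one = mat 1"
  by (simp add: quat_su2_def vec_eq_iff forall_2 complex_eq_iff quat_one_def mat_def)

lemma carrier_SU2: "U \<in> carrier SU2 \<longleftrightarrow> (\<chi> i j. cnj (U $ j $ i)) ** U = mat 1 \<and> det U = 1"
  and mult_SU2 [simp]: "U \<otimes>\<^bsub>SU2\<^esub> V = U ** V" and one_SU2 [simp]: "\<one>\<^bsub>SU2\<^esub> = mat 1"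
  by (simp_all add: SU2_def)

lemma quat_su2_carrier: "norm q = 1 \<Longrightarrow> quat_su2 q \<in> carrier SU2"
  using norm_quat[of q]
  by (simp add: carrier_SU2 quat_su2_def vec_eq_iff forall_2 matrix_matrix_mult_def sum_2 det_2
      complex_eq_iff mat_def power2_eq_square algebra_simps)

text \<open>  A special unitary matrix has second row \<open>(- cnj b, cnj a)\<close>: expand \<open>d = d (|a|\<^sup>2 + |c|\<^sup>2)\<close> and
  \<open>b = b (|a|\<^sup>2 + |c|\<^sup>2)\<close> by means of the other relations.\<close>

lemma SU2_form:
  assumes "U \<in> carrier SU2"
  shows "quat_su2 (su2_quat U) = U" "norm (su2_quat U) = 1"
proof -
  obtain a b c d where U: "U$1$1 = a" "U$1$2 = b" "U$2$1 = c" "U$2$2 = d" by blast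
  have e: "cnj a * a + cnj c * c = 1" "cnj a * b + cnj c * d = 0" "a * d - b * c = 1"
    using assms by (simp_all add: carrier_SU2 vec_eq_iff forall_2 matrix_matrix_mult_def sum_2 det_2 mat_def U)
  have "d = d * (cnj a * a + cnj c * c)" using e by simp
  also have "\<dots> = cnj a * (a * d - b * c) + c * (cnj a * b + cnj c * d)" by (simp add: algebra_simps)
  finally have d: "d = cnj a" using e by simp
  have "b = b * (cnj a * a + cnj c * c)" using e by simp
  also have "\<dots> = a * (cnj a * b + cnj c * d) - cnj c * (a * d - b * c)" by (simp add: algebra_simps)
  finally have b: "b = - cnj c" using e by simp
  show "quat_su2 (su2_quat U) = U"
    by (simp add: quat_su2_def vec_eq_iff forall_2 complex_eq_iff U b d)
  have "(Re a)\<^sup>2 + (Im a)\<^sup>2 + (Re c)\<^sup>2 + (Im c)\<^sup>2 = 1"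
    using e(1) by (simp add: complex_eq_iff power2_eq_square)
  then show "norm (su2_quat U) = 1"
    by (intro norm_eq_oneI) (simp add: norm_quat U b)
qed

section \<open>Equivalence of actions\<close>

lemma equivalent_actions_sym:
  assumes L: "group L" and act: "\<And>g m. g \<in> carrier L \<Longrightarrow> m \<in> M \<Longrightarrow> act g m \<in> M"
    and eq: "equivalent_actions L M act L' M' act'"
  shows "equivalent_actions L' M' act' L M act"
proof -
  obtain \<phi> F where \<phi>: "\<phi> \<in> iso L L'" "diffeomorphism (carrier L) (carrier L') \<phi>" and F: "diffeomorphism M M' F"
    and e: "\<And>g m. g \<in> carrier L \<Longrightarrow> m \<in> M \<Longrightarrow> F (act g m) = act' (\<phi> g) (F m)"
    using eq unfolding equivalent_actions_def lie_group_iso_def by blast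
  let ?\<psi> = "inv_into (carrier L) \<phi>" and ?G = "inv_into M F"
  have "lie_group_iso L' L ?\<psi>"
    unfolding lie_group_iso_def using group.iso_set_sym[OF L \<phi>(1)] diffeomorphism_inverse[OF \<phi>(2)] by simp
  moreover have "?G (act' h n) = act (?\<psi> h) (?G n)" if h: "h \<in> carrier L'" and n: "n \<in> M'" for h n
  proof -
    have g: "?\<psi> h \<in> carrier L" "?G n \<in> M" using diffeomorphismD[OF \<phi>(2)] diffeomorphismD[OF F] h n by auto
    then have "F (act (?\<psi> h) (?G n)) = act' h n"
      using e diffeomorphismD[OF \<phi>(2)] diffeomorphismD[OF F] h n by simp
    then show ?thesis using diffeomorphismD(4)[OF F act[OF g]] by simp
  qed
  ultimately show ?thesis unfolding equivalent_actions_def using diffeomorphism_inverse[OF F] by blast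
qed

lemma equivalent_actions_trans:
  assumes "equivalent_actions L M act L' M' act'" "equivalent_actions L' M' act' L'' M'' act''"
  shows "equivalent_actions L M act L'' M'' act''"
proof -
  obtain \<phi> F where 1: "lie_group_iso L L' \<phi>" "diffeomorphism M M' F"
    "\<And>g m. g \<in> carrier L \<Longrightarrow> m \<in> M \<Longrightarrow> F (act g m) = act' (\<phi> g) (F m)"
    using assms(1) unfolding equivalent_actions_def by blast
  obtain \<psi> G where 2: "lie_group_iso L' L'' \<psi>" "diffeomorphism M' M'' G"
    "\<And>g m. g \<in> carrier L' \<Longrightarrow> m \<in> M' \<Longrightarrow> G (act' g m) = act'' (\<psi> g) (G m)"
    using assms(2) unfolding equivalent_actions_def by blast
  have "\<phi> g \<in> carrier L'" if "g \<in> carrier L" for g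
    using 1(1) that diffeomorphismD(3) unfolding lie_group_iso_def by blast
  then have "G (F (act g m)) = act'' (\<psi> (\<phi> g)) (G (F m))" if "g \<in> carrier L" "m \<in> M" for g m
    using 1 2 that diffeomorphismD(3)[OF 1(2)] by simp
  then show ?thesis unfolding equivalent_actions_def
    using lie_group_iso_compose[OF 1(1) 2(1)] diffeomorphism_compose[OF 1(2) 2(2)] by blast
qed

section \<open>Homomorphisms from the unit quaternions to Spin(8)\<close>

text \<open>  Such a homomorphism from Sp(1) to Spin(8) gives three representations on the octonions. The third one, \<open>rep_c\<close>, is
  determined by the triality equation with \<open>x = 1\<close>; defined in this way, it inherits differentiability
  from the other two.\<close>

locale spin8_hom =
  fixes \<sigma> :: "quat \<Rightarrow> (real^8^8) \<times> (real^8^8)" and d :: "quat \<Rightarrow> (real^8^8) \<times> (real^8^8)"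
  assumes carrier: "norm q = 1 \<Longrightarrow> \<sigma> q \<in> carrier Spin8"
    and hom: "norm p = 1 \<Longrightarrow> norm q = 1 \<Longrightarrow> \<sigma> (quat_mult p q) = \<sigma> p \<otimes>\<^bsub>Spin8\<^esub> \<sigma> q"
    and hom_one: "\<sigma> quat_one = (mat 1, mat 1)"
    and d_linear: "linear d"
    and d_deriv: "v \<in> imag_units \<Longrightarrow> ((\<lambda>t. \<sigma> (quat_cis v t)) has_vector_derivative d v) (at 0)"
begin

definition "rep_a q x = fst (\<sigma> q) *v x"
definition "rep_b q x = snd (\<sigma> q) *v x"
definition "rep_c q x = oct_mult (rep_a q oct_one) (rep_b q x)"

lemma rotations: "norm q = 1 \<Longrightarrow> rotation_matrix (fst (\<sigma> q))" "norm q = 1 \<Longrightarrow> rotation_matrix (snd (\<sigma> q))"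
  using carrier[of q] by (cases "\<sigma> q"; simp add: carrier_Spin8)+

lemma rep_triality:
  assumes "norm q = 1" shows "oct_mult (rep_a q x) (rep_b q y) = rep_c q (oct_mult x y)"
proof -
  obtain C where "triality (fst (\<sigma> q)) (snd (\<sigma> q)) C"
    using carrier[OF assms] by (cases "\<sigma> q") (auto simp: carrier_Spin8)
  then have t: "oct_mult (rep_a q x) (rep_b q y) = C *v oct_mult x y" for x y
    by (simp add: triality_def rep_a_def rep_b_def)
  then show ?thesis using t[of oct_one "oct_mult x y"] by (simp add: rep_c_def)
qed

lemma matrix_apply_bounded_linear: "bounded_linear (\<lambda>A. (A :: real^8^8) *v x)"
  unfolding linear_conv_bounded_linear[symmetric]
  by (intro linearI) (simp_all add: matrix_vector_mult_add_rdistrib scaleR_matrix_vector_assoc)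

lemma rep_a: "sp1_rep rep_a (\<lambda>v x. fst (d v) *v x)"
proof (rule sp1_rep.intro)
  fix v x assume "v \<in> imag_units"
  from bounded_linear.has_vector_derivative[OF bounded_linear_compose[OF matrix_apply_bounded_linear bounded_linear_fst] d_deriv[OF this]]
  show "((\<lambda>t. rep_a (quat_cis v t) x) has_vector_derivative fst (d v) *v x) (at 0)"
    by (simp add: rep_a_def)
next
  fix x show "linear (\<lambda>v. fst (d v) *v x)"
    by (intro linearI) (simp_all add: linear_add[OF d_linear] linear_scale[OF d_linear] matrix_vector_mult_add_rdistrib scaleR_matrix_vector_assoc)
qed (auto simp: rep_a_def[abs_def] hom hom_one matrix_vector_mul_assoc rotations rotation_matrix_orth)

lemma rep_b: "sp1_rep rep_b (\<lambda>v x. snd (d v) *v x)"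
proof (rule sp1_rep.intro)
  fix v x assume "v \<in> imag_units"
  from bounded_linear.has_vector_derivative[OF bounded_linear_compose[OF matrix_apply_bounded_linear bounded_linear_snd] d_deriv[OF this]]
  show "((\<lambda>t. rep_b (quat_cis v t) x) has_vector_derivative snd (d v) *v x) (at 0)"
    by (simp add: rep_b_def)
next
  fix x show "linear (\<lambda>v. snd (d v) *v x)"
    by (intro linearI) (simp_all add: linear_add[OF d_linear] linear_scale[OF d_linear] matrix_vector_mult_add_rdistrib scaleR_matrix_vector_assoc)
qed (auto simp: rep_b_def[abs_def] hom hom_one matrix_vector_mul_assoc rotations rotation_matrix_orth)

sublocale a: sp1_rep rep_a "\<lambda>v x. fst (d v) *v x" by (rule rep_a)
sublocale b: sp1_rep rep_b "\<lambda>v x. snd (d v) *v x" by (rule rep_b)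

lemma rep_c: "sp1_rep rep_c (\<lambda>v x. oct_mult (fst (d v) *v oct_one) x + snd (d v) *v x)"
proof (rule sp1_rep.intro)
  fix q :: quat assume q: "norm q = 1"
  have "linear (rep_c q)"
    unfolding rep_c_def
    by (intro linearI) (simp_all add: linear_add[OF b.rho_linear[OF q]] linear_scale[OF b.rho_linear[OF q]] oct_mult.add_right oct_mult.scaleR_right)
  moreover have "norm (rep_c q x) = norm x" for x
    by (simp add: rep_c_def norm_oct_mult orthogonal_transformation_norm[OF a.orth[OF q]] orthogonal_transformation_norm[OF b.orth[OF q]])
  ultimately show "orthogonal_transformation (rep_c q)" by (simp add: orthogonal_transformation)
next
  fix x show "rep_c quat_one x = x" by (simp add: rep_c_def a.one b.one)
next
  fix p q :: quat and x assume pq: "norm p = 1" "norm q = 1"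
  show "rep_c (quat_mult p q) x = rep_c p (rep_c q x)"
    unfolding rep_c_def[of "quat_mult p q"] a.mult[OF pq] b.mult[OF pq] rep_triality[OF pq(1)]
    by (simp add: rep_c_def[of q])
next
  fix x show "linear (\<lambda>v. oct_mult (fst (d v) *v oct_one) x + snd (d v) *v x)"
    by (intro linearI) (simp_all add: linear_add[OF a.D_linear] linear_add[OF b.D_linear] linear_scale[OF a.D_linear] linear_scale[OF b.D_linear]
        oct_mult.add_left oct_mult.scaleR_left scaleR_add_right)
next
  fix v x assume v: "v \<in> imag_units"
  show "((\<lambda>t. rep_c (quat_cis v t) x) has_vector_derivative oct_mult (fst (d v) *v oct_one) x + snd (d v) *v x) (at 0)"
    using oct_mult.has_vector_derivative[OF a.D_deriv[OF v, of oct_one] b.D_deriv[OF v, of x]]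
    by (simp add: rep_c_def a.one b.one add.commute)
qed

sublocale c: sp1_rep rep_c "\<lambda>v x. oct_mult (fst (d v) *v oct_one) x + snd (d v) *v x" by (rule rep_c)

end

lemma oct_mult_left_cancel_iff: "x \<noteq> 0 \<Longrightarrow> oct_mult x y = oct_mult x z \<longleftrightarrow> y = z"
  using norm_oct_mult[of x "y - z"]
  by (simp add: oct_mult.diff_right) (metis eq_iff_diff_eq_0 mult_eq_0_iff norm_eq_zero)

lemma oct_mult_right_cancel_iff: "x \<noteq> 0 \<Longrightarrow> oct_mult y x = oct_mult z x \<longleftrightarrow> y = z"
  using norm_oct_mult[of "y - z" x]
  by (simp add: oct_mult.diff_left) (metis eq_iff_diff_eq_0 mult_eq_0_iff norm_eq_zero)

lemma oct_left_cancel': "oct_mult x (oct_mult (oct_conj x) y) = (norm x)\<^sup>2 *\<^sub>R y"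
  using oct_left_cancel[of "oct_conj x" y] by simp

lemma oct_right_cancel': "oct_mult (oct_mult y (oct_conj x)) x = (norm x)\<^sup>2 *\<^sub>R y"
  using oct_right_cancel[of y "oct_conj x"] by simp

lemma diffeo_orthogonal_pair:
  assumes "orthogonal_transformation Q1" "orthogonal_transformation Q2"
  shows "diffeomorphism S7xS7 S7xS7 (\<lambda>(x, y). (Q1 x, Q2 y))"
proof -
  have sm: "smooth_map S7xS7 S7xS7 (\<lambda>(x, y). (P1 x, P2 y))"
    if "orthogonal_transformation P1" "orthogonal_transformation P2" for P1 P2
  proof (rule smooth_mapI)
    have "linear (\<lambda>(x, y). (P1 x, P2 y))"
      using that[THEN orthogonal_transformation_linear] by (auto intro!: linearI simp: linear_add linear_scale)
    then show "smooth_on UNIV (\<lambda>(x, y). (P1 x, P2 y))" by (rule smooth_on_linear)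
  qed (auto simp: S7xS7_def orthogonal_transformation_norm that)
  show ?thesis
    by (rule diffeomorphismI[OF sm[OF assms] sm[OF assms[THEN orthogonal_transformation_inv]]])
       (auto simp: orthogonal_transformation_inv_cancel assms)
qed

text \<open>  This map and the next one trade one of the representations on the factors for \<open>rep_c\<close>: by triality,
  \<open>(x, y) \<mapsto> (x, x y)\<close> is equivariant from \<open>(rep_a, rep_b)\<close> to \<open>(rep_a, rep_c)\<close>.\<close>

lemma diffeo_mult_right: "diffeomorphism S7xS7 S7xS7 (\<lambda>(x, y). (x, oct_mult x y))"
proof -
  have "bilinear (\<lambda>z w. (0 :: oct, oct_mult (fst z) (snd w)))"
    by (simp add: bilinear_def linear_iff oct_mult.add_left oct_mult.add_right oct_mult.scaleR_left oct_mult.scaleR_right)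
  moreover have l: "linear (\<lambda>z. (fst z, 0 :: oct))" by (simp add: linear_iff)
  ultimately have "smooth_on UNIV (\<lambda>z. (0 :: oct, oct_mult (fst z) (snd z)) + (fst z, 0) + 0)"
    by (rule smooth_on_quadratic)
  then have 1: "smooth_map S7xS7 S7xS7 (\<lambda>(x, y). (x, oct_mult x y))"
    by (intro smooth_mapI) (auto simp: case_prod_unfold S7xS7_def norm_oct_mult)
  have "bilinear (\<lambda>z w. (0 :: oct, oct_mult (oct_conj (fst z)) (snd w)))"
    by (simp add: bilinear_def linear_iff oct_mult.add_left oct_mult.add_right oct_mult.scaleR_left oct_mult.scaleR_right
        linear_add[OF linear_oct_conj] linear_scale[OF linear_oct_conj])
  from smooth_on_quadratic[OF this l, of UNIV 0]
  have 2: "smooth_map S7xS7 S7xS7 (\<lambda>(x, y). (x, oct_mult (oct_conj x) y))"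
    by (intro smooth_mapI) (auto simp: case_prod_unfold S7xS7_def norm_oct_mult)
  show ?thesis
    by (rule diffeomorphismI[OF 1 2]) (auto simp: S7xS7_def oct_left_cancel oct_left_cancel')
qed

lemma diffeo_mult_left: "diffeomorphism S7xS7 S7xS7 (\<lambda>(x, y). (oct_mult x y, y))"
proof -
  have "bilinear (\<lambda>z w. (oct_mult (fst z) (snd w), 0 :: oct))"
    by (simp add: bilinear_def linear_iff oct_mult.add_left oct_mult.add_right oct_mult.scaleR_left oct_mult.scaleR_right)
  moreover have l: "linear (\<lambda>z. (0 :: oct, snd z))" by (simp add: linear_iff)
  ultimately have "smooth_on UNIV (\<lambda>z. (oct_mult (fst z) (snd z), 0 :: oct) + (0, snd z) + 0)"
    by (rule smooth_on_quadratic)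
  then have 1: "smooth_map S7xS7 S7xS7 (\<lambda>(x, y). (oct_mult x y, y))"
    by (intro smooth_mapI) (auto simp: case_prod_unfold S7xS7_def norm_oct_mult)
  have "bilinear (\<lambda>z w. (oct_mult (fst z) (oct_conj (snd w)), 0 :: oct))"
    by (simp add: bilinear_def linear_iff oct_mult.add_left oct_mult.add_right oct_mult.scaleR_left oct_mult.scaleR_right
        linear_add[OF linear_oct_conj] linear_scale[OF linear_oct_conj])
  from smooth_on_quadratic[OF this l, of UNIV 0]
  have 2: "smooth_map S7xS7 S7xS7 (\<lambda>(x, y). (oct_mult x (oct_conj y), y))"
    by (intro smooth_mapI) (auto simp: case_prod_unfold S7xS7_def norm_oct_mult)
  show ?thesis
    by (rule diffeomorphismI[OF 1 2]) (auto simp: S7xS7_def oct_right_cancel oct_right_cancel')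
qed

context spin8_hom
begin

definition free_on_spheres :: bool where
  "free_on_spheres \<longleftrightarrow> (\<forall>q x y. norm q = 1 \<longrightarrow> q \<noteq> quat_one \<longrightarrow> rep_a q x = x \<longrightarrow> rep_b q y = y \<longrightarrow> x = 0 \<or> y = 0)"

text \<open>The element \<open>-1\<close> of Sp(1) acts as one of the three nontrivial central elements of Spin(8).\<close>

lemma central_sign:
  assumes free: free_on_spheres
  defines "m \<equiv> - quat_one"
  shows "(\<forall>x. rep_a m x = - x) \<and> (\<forall>x. rep_b m x = - x) \<and> (\<forall>x. rep_c m x = x) \<or>
         (\<forall>x. rep_a m x = - x) \<and> (\<forall>x. rep_b m x = x) \<and> (\<forall>x. rep_c m x = - x) \<or>
         (\<forall>x. rep_a m x = x) \<and> (\<forall>x. rep_b m x = - x) \<and> (\<forall>x. rep_c m x = - x)"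
proof -
  have m: "norm m = 1" "m \<noteq> quat_one" "quat_mult m m = quat_one"
    by (simp_all add: m_def quat_mult.minus_left quat_mult.minus_right) (simp add: quat_eq_iff quat_one_def)
  have "(\<forall>x. rep_a m x = - x) \<and> ((\<forall>y. rep_b m y = y) \<or> (\<forall>y. rep_b m y = - y)) \<or>
        (\<forall>y. rep_b m y = - y) \<and> ((\<forall>x. rep_a m x = x) \<or> (\<forall>x. rep_a m x = - x))"
  proof (rule triality_involution_signs)
    show "rep_a m (rep_a m x) = x" "rep_b m (rep_b m x) = x" for x
      using a.mult[OF m(1,1)] b.mult[OF m(1,1)] by (simp_all add: m(3) a.one b.one)
    show "rep_a m x = x \<Longrightarrow> rep_b m y = y \<Longrightarrow> x = 0 \<or> y = 0" for x y
      using free m unfolding free_on_spheres_def by blast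
  qed (use m(1) in \<open>simp_all add: a.rho_linear b.rho_linear rep_triality
         orthogonal_transformation_norm[OF a.orth] orthogonal_transformation_norm[OF b.orth]\<close>)
  then show ?thesis by (auto simp: rep_c_def oct_mult.minus_left oct_mult.minus_right)
qed

lemma fixed_partner:
  assumes q: "norm q = 1" and x: "x \<noteq> 0" and y: "y \<noteq> 0"
  shows "rep_a q x = x \<Longrightarrow> rep_c q (oct_mult x y) = oct_mult x y \<Longrightarrow> rep_b q y = y"
    and "rep_b q y = y \<Longrightarrow> rep_c q (oct_mult x y) = oct_mult x y \<Longrightarrow> rep_a q x = x"
  using rep_triality[OF q, of x y] x y
  by (simp_all add: oct_mult_left_cancel_iff oct_mult_right_cancel_iff)

text \<open>  One of the three representations is trivial at \<open>-1\<close> and therefore has a vector \<open>z\<close> fixed by the circle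
  \<open>e\<^sup>i\<^sup>t\<close>. If this is \<open>rep_c\<close>, write \<open>z = x y\<close>: by triality, an element of the circle fixes \<open>x\<close> in
  \<open>rep_a\<close> iff it fixes \<open>y\<close> in \<open>rep_b\<close>, so that freeness on the product forces freeness on each factor.
  If it is \<open>rep_b\<close>, then \<open>rep_a\<close> is free since \<open>(x, z)\<close> is never fixed, and the same comparison, now
  with \<open>x z\<close>, shows that \<open>rep_c\<close> is free. The case of \<open>rep_a\<close> is symmetric.\<close>

lemma free_hopf_model:
  assumes free: free_on_spheres
  obtains F where "diffeomorphism S7xS7 S7xS7 F"
    "\<And>q x y. norm q = 1 \<Longrightarrow> (x, y) \<in> S7xS7 \<Longrightarrow>
       F (rep_a q x, rep_b q y) = (hopf q (fst (F (x, y))), hopf q (snd (F (x, y))))"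
proof -
  have torus: "norm (quat_cis quat_i t) = 1" for t by (rule norm_quat_cis[OF a.imag_units_ijk(1)])
  have nz: "oct_mult x y \<noteq> 0" if "x \<noteq> 0" "y \<noteq> 0" for x y
    using that norm_oct_mult[of x y] by (metis mult_eq_0_iff norm_eq_zero)
  have cz: "oct_conj x \<noteq> 0" if "x \<noteq> 0" for x using that norm_oct_conj[of x] by (metis norm_eq_zero)
  consider (c) "\<forall>x. rep_c (- quat_one) x = x" | (b) "\<forall>x. rep_b (- quat_one) x = x" | (a) "\<forall>x. rep_a (- quat_one) x = x"
    using central_sign[OF free] by blast
  then show ?thesis
  proof cases
    case c
    then obtain z where z: "norm z = 1" "\<And>t. rep_c (quat_cis quat_i t) z = z"
      using c.even_rep_zero_weight by metis
    then have z0: "z \<noteq> 0" by auto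
    have scaled: "rep_c (quat_cis quat_i t) (r *\<^sub>R z) = r *\<^sub>R z" for t r
      by (simp add: linear_scale[OF c.rho_linear[OF torus]] z)
    have "acts_freely rep_a"
    proof (rule a.free_if_torus_free, rule ccontr)
      fix t x assume t: "quat_cis quat_i t \<noteq> quat_one" and x: "rep_a (quat_cis quat_i t) x = x" "x \<noteq> 0"
      have y: "oct_mult (oct_conj x) z \<noteq> 0" using nz cz x(2) z0 by blast
      have "rep_b (quat_cis quat_i t) (oct_mult (oct_conj x) z) = oct_mult (oct_conj x) z"
        using fixed_partner(1)[OF torus x(2) y x(1)] scaled by (simp add: oct_left_cancel')
      then show False using free torus t x y unfolding free_on_spheres_def by blast
    qed
    then obtain Q1 where Q1: "orthogonal_transformation Q1" "\<And>q x. norm q = 1 \<Longrightarrow> Q1 (rep_a q x) = hopf q (Q1 x)"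
      using free_rep_is_hopf[OF rep_a] by blast
    have "acts_freely rep_b"
    proof (rule b.free_if_torus_free, rule ccontr)
      fix t y assume t: "quat_cis quat_i t \<noteq> quat_one" and y: "rep_b (quat_cis quat_i t) y = y" "y \<noteq> 0"
      have x: "oct_mult z (oct_conj y) \<noteq> 0" using nz cz y(2) z0 by blast
      have "rep_a (quat_cis quat_i t) (oct_mult z (oct_conj y)) = oct_mult z (oct_conj y)"
        using fixed_partner(2)[OF torus x y(2) y(1)] scaled by (simp add: oct_right_cancel')
      then show False using free torus t x y unfolding free_on_spheres_def by blast
    qed
    then obtain Q2 where Q2: "orthogonal_transformation Q2" "\<And>q x. norm q = 1 \<Longrightarrow> Q2 (rep_b q x) = hopf q (Q2 x)"
      using free_rep_is_hopf[OF rep_b] by blast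
    show ?thesis
      by (rule that[OF diffeo_orthogonal_pair[OF Q1(1) Q2(1)]]) (simp add: Q1 Q2)
  next
    case b
    then obtain z where z: "norm z = 1" "\<And>t. rep_b (quat_cis quat_i t) z = z"
      using b.even_rep_zero_weight by metis
    then have z0: "z \<noteq> 0" by auto
    have "rep_a (quat_cis quat_i t) x = x \<Longrightarrow> x = 0" if "quat_cis quat_i t \<noteq> quat_one" for t x
      using free torus that z z0 unfolding free_on_spheres_def by blast
    note a_free = this
    then have "acts_freely rep_a" by (rule a.free_if_torus_free)
    then obtain Q1 where Q1: "orthogonal_transformation Q1" "\<And>q x. norm q = 1 \<Longrightarrow> Q1 (rep_a q x) = hopf q (Q1 x)"
      using free_rep_is_hopf[OF rep_a] by blast
    have "acts_freely rep_c"
    proof (rule c.free_if_torus_free, rule ccontr)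
      fix t w assume t: "quat_cis quat_i t \<noteq> quat_one" and w: "rep_c (quat_cis quat_i t) w = w" "w \<noteq> 0"
      have x: "oct_mult w (oct_conj z) \<noteq> 0" using nz cz w(2) z0 by blast
      have "rep_a (quat_cis quat_i t) (oct_mult w (oct_conj z)) = oct_mult w (oct_conj z)"
        using fixed_partner(2)[OF torus x z0 z(2)] w z(1) by (simp add: oct_right_cancel')
      then show False using a_free[OF t] x by blast
    qed
    then obtain Q2 where Q2: "orthogonal_transformation Q2" "\<And>q x. norm q = 1 \<Longrightarrow> Q2 (rep_c q x) = hopf q (Q2 x)"
      using free_rep_is_hopf[OF rep_c] by blast
    show ?thesis
      by (rule that[OF diffeomorphism_compose[OF diffeo_mult_right diffeo_orthogonal_pair[OF Q1(1) Q2(1)]]])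
         (simp add: Q1 Q2 rep_triality)
  next
    case a
    then obtain z where z: "norm z = 1" "\<And>t. rep_a (quat_cis quat_i t) z = z"
      using a.even_rep_zero_weight by metis
    then have z0: "z \<noteq> 0" by auto
    have "rep_b (quat_cis quat_i t) x = x \<Longrightarrow> x = 0" if "quat_cis quat_i t \<noteq> quat_one" for t x
      using free torus that z z0 unfolding free_on_spheres_def by blast
    note b_free = this
    then have "acts_freely rep_b" by (rule b.free_if_torus_free)
    then obtain Q2 where Q2: "orthogonal_transformation Q2" "\<And>q x. norm q = 1 \<Longrightarrow> Q2 (rep_b q x) = hopf q (Q2 x)"
      using free_rep_is_hopf[OF rep_b] by blast
    have "acts_freely rep_c"
    proof (rule c.free_if_torus_free, rule ccontr)
      fix t w assume t: "quat_cis quat_i t \<noteq> quat_one" and w: "rep_c (quat_cis quat_i t) w = w" "w \<noteq> 0"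
      have y: "oct_mult (oct_conj z) w \<noteq> 0" using nz cz w(2) z0 by blast
      have "rep_b (quat_cis quat_i t) (oct_mult (oct_conj z) w) = oct_mult (oct_conj z) w"
        using fixed_partner(1)[OF torus z0 y z(2)] w z(1) by (simp add: oct_left_cancel')
      then show False using b_free[OF t] y by blast
    qed
    then obtain Q1 where Q1: "orthogonal_transformation Q1" "\<And>q x. norm q = 1 \<Longrightarrow> Q1 (rep_c q x) = hopf q (Q1 x)"
      using free_rep_is_hopf[OF rep_c] by blast
    show ?thesis
      by (rule that[OF diffeomorphism_compose[OF diffeo_mult_left diffeo_orthogonal_pair[OF Q1(1) Q2(1)]]])
         (simp add: Q1 Q2 rep_triality)
  qed
qed

end

section \<open>Subgroups isomorphic to SU(2)\<close>

lemma smooth_map_differentiable: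
  assumes "smooth_map M N f" "x \<in> M"
  obtains U g g' where "open U" "x \<in> U" "(g has_derivative g') (at x)" "\<And>y. y \<in> M \<inter> U \<Longrightarrow> g y = f y"
proof -
  obtain U g where U: "open U" "x \<in> U" "smooth_on U g" "\<forall>y\<in>M \<inter> U. g y = f y"
    using assms unfolding smooth_map_def by blast
  have "higher_differentiable_on (Suc 0) U g" using U(3) unfolding smooth_on_def by blast
  then have "g differentiable (at x)" using U(2) unfolding higher_differentiable_on.simps(2) by blast
  then obtain g' where "(g has_derivative g') (at x)" unfolding differentiable_def by blast
  then show ?thesis using that U by blast
qed

text \<open>  The inverse of the isomorphism \<open>\<phi>\<close> extends smoothly to a neighbourhood of the identity matrix in the
  ambient space; the differential of such an extension provides the linear map \<open>d\<close>.\<close>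

lemma spin8_hom_of_subgroup:
  assumes L: "subgroup L Spin8" and \<phi>: "lie_group_iso (as_group Spin8 L) SU2 \<phi>"
  obtains \<sigma> d where "spin8_hom \<sigma> d" "\<And>q. norm q = 1 \<Longrightarrow> \<sigma> q \<in> L" "\<And>g. g \<in> L \<Longrightarrow> \<sigma> (su2_quat (\<phi> g)) = g"
    "\<And>q. norm q = 1 \<Longrightarrow> \<phi> (\<sigma> q) = quat_su2 q"
proof -
  have hom: "\<phi> \<in> hom (as_group Spin8 L) SU2" and diff: "diffeomorphism L (carrier SU2) \<phi>"
    using \<phi> by (auto simp: lie_group_iso_def iso_def)
  define \<sigma> where "\<sigma> q = inv_into L \<phi> (quat_su2 q)" for q
  have in_L: "\<sigma> q \<in> L" if "norm q = 1" for q
    unfolding \<sigma>_def by (rule diffeomorphismD(5)[OF diff quat_su2_carrier[OF that]])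
  have phi_sigma: "\<phi> (\<sigma> q) = quat_su2 q" if "norm q = 1" for q
    unfolding \<sigma>_def by (rule diffeomorphismD(6)[OF diff quat_su2_carrier[OF that]])
  have sigma_phi: "\<sigma> (su2_quat (\<phi> g)) = g" if "g \<in> L" for g
    unfolding \<sigma>_def using SU2_form(1) diffeomorphismD(3,4)[OF diff that] by simp
  have mult: "\<sigma> (quat_mult p q) = \<sigma> p \<otimes>\<^bsub>Spin8\<^esub> \<sigma> q" if "norm p = 1" "norm q = 1" for p q
  proof -
    have "\<sigma> p \<otimes>\<^bsub>Spin8\<^esub> \<sigma> q \<in> L" using subgroup.m_closed[OF L] in_L that by blast
    moreover have "\<phi> (\<sigma> p \<otimes>\<^bsub>Spin8\<^esub> \<sigma> q) = \<phi> (\<sigma> p) \<otimes>\<^bsub>SU2\<^esub> \<phi> (\<sigma> q)"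
      using hom in_L[OF that(1)] in_L[OF that(2)] unfolding hom_def by simp
    ultimately show ?thesis
      using sigma_phi[of "\<sigma> p \<otimes>\<^bsub>Spin8\<^esub> \<sigma> q"] that by (simp add: phi_sigma quat_su2_mult[symmetric])
  qed
  have one: "\<sigma> quat_one = (mat 1, mat 1)"
  proof -
    have "\<sigma> quat_one = \<sigma> quat_one \<otimes>\<^bsub>Spin8\<^esub> \<sigma> quat_one" using mult[of quat_one quat_one] by simp
    then have "\<sigma> quat_one = \<one>\<^bsub>Spin8\<^esub>"
      using group.l_cancel_one'[OF group_Spin8, of "\<sigma> quat_one" "\<sigma> quat_one"] in_L[of quat_one] subgroup.mem_carrier[OF L]
      by simp
    then show ?thesis by simp
  qed
  obtain U g g' where U: "open U" "mat 1 \<in> U" "(g has_derivative g') (at (mat 1))"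
    and g: "\<And>y. y \<in> carrier SU2 \<inter> U \<Longrightarrow> g y = inv_into L \<phi> y"
    using smooth_map_differentiable[OF diffeomorphismD(2)[OF diff], of "mat 1"] quat_su2_carrier[of quat_one]
    by (auto simp: quat_su2_one)
  have lin: "linear (\<lambda>v. g' (quat_su2 v))"
    using linear_compose[OF linear_quat_su2 has_derivative_linear[OF U(3)]] by (simp add: o_def)
  have deriv: "((\<lambda>t. \<sigma> (quat_cis v t)) has_vector_derivative g' (quat_su2 v)) (at 0)" if v: "v \<in> imag_units" for v
  proof -
    let ?c = "\<lambda>t. quat_su2 (quat_cis v t)"
    have qd: "((\<lambda>t. quat_cis v t) has_vector_derivative v) (at 0)"
      unfolding quat_cis_def by (auto intro!: derivative_eq_intros simp: has_real_derivative_iff_has_vector_derivative[symmetric])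
    have bl: "bounded_linear quat_su2" using linear_quat_su2 by (simp add: linear_conv_bounded_linear)
    have c: "(?c has_vector_derivative quat_su2 v) (at 0)"
      by (rule bounded_linear.has_vector_derivative[OF bl qd])
    have c0: "?c 0 = mat 1" by (simp add: quat_su2_one)
    have gc: "((\<lambda>t. g (?c t)) has_vector_derivative g' (quat_su2 v)) (at 0)"
      using vector_derivative_diff_chain_within[of ?c "quat_su2 v" 0 UNIV g g'] c U(3)
      by (simp add: quat_su2_one o_def has_derivative_at_withinI)
    have "isCont ?c 0" using c by (rule has_vector_derivative_continuous)
    then have "(?c \<longlongrightarrow> mat 1) (at 0)" unfolding isCont_def c0 .
    then have "\<forall>\<^sub>F t in at 0. ?c t \<in> U" using U(1,2) by (rule topological_tendstoD)
    then have "\<forall>\<^sub>F t in nhds 0. ?c t \<in> U"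
      unfolding eventually_nhds_conv_at c0 using U(2) by blast
    then have ev: "\<forall>\<^sub>F t in nhds 0. t \<in> UNIV \<longrightarrow> g (?c t) = \<sigma> (quat_cis v t)"
      by eventually_elim (simp add: g \<sigma>_def quat_su2_carrier norm_quat_cis v)
    then have "g (?c 0) = \<sigma> (quat_cis v 0)" by (auto dest: eventually_nhds_x_imp_x)
    from has_vector_derivative_cong_ev[OF ev this] show ?thesis using gc by blast
  qed
  have "spin8_hom \<sigma> (\<lambda>v. g' (quat_su2 v))"
    by (rule spin8_hom.intro) (use in_L subgroup.mem_carrier[OF L] mult one lin deriv in auto)
  then show ?thesis using that in_L sigma_phi phi_sigma by blast
qed

lemma hopf_act_eq: "hopf_act U x = hopf (su2_quat U) x"
  by (simp add: hopf_act_def hopf_def)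

theorem free_SU2_subgroup_equivalent_to_hopf:
  assumes "L \<in> free_subgroups Spin8 SU2 S7xS7 spin_act"
  shows "equivalent_actions (as_group Spin8 L) S7xS7 spin_act SU2 S7xS7 act_a"
proof -
  obtain \<phi> where L: "subgroup L Spin8" and \<phi>: "lie_group_iso (as_group Spin8 L) SU2 \<phi>"
    and free: "free_action (as_group Spin8 L) S7xS7 spin_act"
    using assms by (auto simp: free_subgroups_def)
  obtain \<sigma> d where h: "spin8_hom \<sigma> d" and in_L: "\<And>q. norm q = 1 \<Longrightarrow> \<sigma> q \<in> L"
    and sigma_phi: "\<And>g. g \<in> L \<Longrightarrow> \<sigma> (su2_quat (\<phi> g)) = g" and phi_sigma: "\<And>q. norm q = 1 \<Longrightarrow> \<phi> (\<sigma> q) = quat_su2 q"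
    using spin8_hom_of_subgroup[OF L \<phi>] by blast
  interpret spin8_hom \<sigma> d by (rule h)
  have act: "spin_act (\<sigma> q) (x, y) = (rep_a q x, rep_b q y)" for q x y
    by (simp add: spin_act_def rep_a_def rep_b_def case_prod_beta)
  have "free_on_spheres"
    unfolding free_on_spheres_def
  proof (intro allI impI, rule ccontr)
    fix q x y assume q: "norm q = 1" "q \<noteq> quat_one" and f: "rep_a q x = x" "rep_b q y = y" and "\<not> (x = 0 \<or> y = 0)"
    then have xy: "(x /\<^sub>R norm x, y /\<^sub>R norm y) \<in> S7xS7" by (simp add: S7xS7_def)
    have "spin_act (\<sigma> q) (x /\<^sub>R norm x, y /\<^sub>R norm y) = (x /\<^sub>R norm x, y /\<^sub>R norm y)"
      by (simp add: act linear_scale[OF a.rho_linear[OF q(1)]] linear_scale[OF b.rho_linear[OF q(1)]] f)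
    moreover have "\<forall>g\<in>L. \<forall>m\<in>S7xS7. spin_act g m = m \<longrightarrow> g = (mat 1, mat 1)"
      using free by (simp add: free_action_def)
    ultimately have "\<sigma> q = \<sigma> quat_one"
      using in_L[OF q(1)] xy unfolding hom_one by blast
    then have "quat_su2 q = quat_su2 quat_one" using phi_sigma q(1) by (metis norm_quat_one)
    then show False using q(2) su2_quat_su2 by metis
  qed
  then obtain F where F: "diffeomorphism S7xS7 S7xS7 F"
    "\<And>q x y. norm q = 1 \<Longrightarrow> (x, y) \<in> S7xS7 \<Longrightarrow>
       F (rep_a q x, rep_b q y) = (hopf q (fst (F (x, y))), hopf q (snd (F (x, y))))"
    using free_hopf_model by blast
  have "F (spin_act g m) = act_a (\<phi> g) (F m)" if g: "g \<in> L" and m: "m \<in> S7xS7" for g m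
  proof -
    have U: "\<phi> g \<in> carrier SU2" using \<phi> g diffeomorphismD(3) unfolding lie_group_iso_def by fastforce
    have "F (spin_act (\<sigma> (su2_quat (\<phi> g))) m) = act_a (\<phi> g) (F m)"
      using F(2)[OF SU2_form(2)[OF U]] m by (cases m) (simp add: act act_a_def case_prod_beta hopf_act_eq)
    then show ?thesis by (simp add: sigma_phi[OF g])
  qed
  with \<phi> F(1) show ?thesis
    unfolding equivalent_actions_def by (intro exI[of _ \<phi>] exI[of _ F] conjI ballI) simp_all
qed

lemma real_matrix_works: "linear f \<Longrightarrow> matrix f *v x = f (x :: real^'n)" for f :: "real^'n \<Rightarrow> real^'m"
  using matrix_vector_mul(2)[of f] by metis

section \<open>A standard free subgroup\<close>

text \<open>  In terms of pairs of quaternions, \<open>std_A q\<close> maps \<open>(x\<^sub>1, x\<^sub>2)\<close> to \<open>(q x\<^sub>1 q\<^sup>*, x\<^sub>2)\<close> and \<open>std_B q\<close> maps \<open>(y\<^sub>1, y\<^sub>2)\<close>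
  to \<open>(q y\<^sub>1, y\<^sub>2 q\<^sup>*)\<close>, where \<open>q\<^sup>*\<close> is the conjugate. Up to a permutation of the coordinates the former is
  the rotation block of action (b), and up to conjugation of \<open>y\<^sub>2\<close> the latter is the Hopf action.\<close>

definition std_A :: "quat \<Rightarrow> real^8^8" where
  "std_A q = matrix (\<lambda>x. oct_pair (quat_mult (quat_mult q (oct_fst x)) (quat_conj q)) (oct_snd x))"

definition std_B :: "quat \<Rightarrow> real^8^8" where
  "std_B q = matrix (\<lambda>y. oct_pair (quat_mult q (oct_fst y)) (quat_mult (oct_snd y) (quat_conj q)))"

definition std :: "quat \<Rightarrow> (real^8^8) \<times> (real^8^8)" where
  "std q = (std_A q, std_B q)"

lemma std_A_apply: "std_A q *v x = oct_pair (quat_mult (quat_mult q (oct_fst x)) (quat_conj q)) (oct_snd x)"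
  unfolding std_A_def
  by (subst real_matrix_works) (auto simp: linear_iff linear_add[OF linear_oct_fst] linear_scale[OF linear_oct_fst]
      linear_add[OF linear_oct_snd] linear_scale[OF linear_oct_snd] quat_mult.add_left quat_mult.add_right
      quat_mult.scaleR_left quat_mult.scaleR_right oct_pair_add oct_pair_scale)

lemma std_B_apply: "std_B q *v x = oct_pair (quat_mult q (oct_fst x)) (quat_mult (oct_snd x) (quat_conj q))"
  unfolding std_B_def
  by (subst real_matrix_works) (auto simp: linear_iff linear_add[OF linear_oct_fst] linear_scale[OF linear_oct_fst]
      linear_add[OF linear_oct_snd] linear_scale[OF linear_oct_snd] quat_mult.add_left quat_mult.add_right
      quat_mult.scaleR_left quat_mult.scaleR_right oct_pair_add oct_pair_scale)

lemma std_mult: "std (quat_mult p q) = (std_A p ** std_A q, std_B p ** std_B q)"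
  by (simp add: std_def matrix_eq matrix_vector_mul_assoc[symmetric] std_A_apply std_B_apply quat_mult_assoc)

lemma oct_pair_fst_snd [simp]: "oct_pair (oct_fst x) (oct_snd x) = x"
  by (simp add: oct_eq_iff)

lemma quat_conj_one [simp]: "quat_conj quat_one = quat_one"
  by (simp add: quat_eq_iff quat_one_def)

lemma std_one: "std quat_one = (mat 1, mat 1)"
  by (simp add: std_def matrix_eq std_A_apply std_B_apply)

lemma unit_quat_sqrt: assumes "norm q = 1" obtains p where "norm p = 1" "q = quat_mult p p"
proof -
  obtain v t where v: "v \<in> imag_units" "q = quat_cis v t" using unit_quat_is_cis[OF assms] .
  then have "q = quat_mult (quat_cis v (t/2)) (quat_cis v (t/2))"
    by (simp add: quat_cis_add[symmetric])
  then show ?thesis using that norm_quat_cis[OF v(1)] by blast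
qed

lemma orthogonal_matrixI:
  assumes "\<And>x. norm (A *v x) = norm (x :: real^'n)" shows "orthogonal_matrix A"
proof -
  have "orthogonal_transformation ((*v) A)"
    using assms by (simp add: orthogonal_transformation)
  then show ?thesis by (simp add: orthogonal_transformation_matrix)
qed

text \<open>The matrices below that come from multiplication by unit quaternions or imaginary unit octonions are
  squares of matrices of the same kind, so this determines the sign of their determinants.\<close>

lemma rotation_matrix_square: "orthogonal_matrix A \<Longrightarrow> rotation_matrix (A ** A)" for A :: "real^'n^'n"
  using det_orthogonal_matrix[of A] by (auto simp: rotation_matrix_def det_mul intro: orthogonal_matrix_mul)

lemma std_rotation: assumes "norm q = 1" shows "rotation_matrix (std_A q)" "rotation_matrix (std_B q)"
proof -
  obtain p where p: "norm p = 1" "q = quat_mult p p" using unit_quat_sqrt[OF assms] .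
  have "(norm (std_A p *v x))\<^sup>2 = (norm x)\<^sup>2" "(norm (std_B p *v x))\<^sup>2 = (norm x)\<^sup>2" for x
    using p(1) by (simp_all add: norm_oct std_A_apply std_B_apply norm_quat_mult)
  then have "norm (std_A p *v x) = norm x" "norm (std_B p *v x) = norm x" for x
    by (simp_all add: power2_eq_iff_nonneg)
  then have "orthogonal_matrix (std_A p)" "orthogonal_matrix (std_B p)" by (auto intro: orthogonal_matrixI)
  then show "rotation_matrix (std_A q)" "rotation_matrix (std_B q)"
    using rotation_matrix_square std_mult[of p p] by (auto simp: std_def p(2))
qed

lemma unit_quat_cancel: assumes "norm q = 1"
  shows "quat_mult (quat_conj q) (quat_mult q r) = r" "quat_mult q (quat_mult (quat_conj q) r) = r"
  using assms by (simp_all add: quat_mult_assoc[symmetric] quat_mult_conj)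

lemma std_Spin7: assumes "norm q = 1" shows "std q \<in> carrier Spin7"
proof -
  have "triality (std_A q) (std_B q) (std_B q)"
    unfolding triality_def
    by (simp add: oct_mult_def std_A_apply std_B_apply quat_mult_assoc unit_quat_cancel[OF assms]
        quat_mult.diff_left quat_mult.diff_right quat_mult.add_left quat_mult.add_right)
  then show ?thesis using std_rotation[OF assms] by (simp add: std_def carrier_Spin7)
qed

definition std_group :: "((real^8^8) \<times> (real^8^8)) set" where
  "std_group = std ` sphere 0 1"

lemma std_subgroup: "subgroup std_group Spin7"
proof (rule group.subgroupI[OF group_Spin7])
  show "std_group \<subseteq> carrier Spin7" by (auto simp: std_group_def std_Spin7)
  show "std_group \<noteq> {}" using norm_quat_one by (force simp: std_group_def)
  show "inv\<^bsub>Spin7\<^esub> g \<in> std_group" if g: "g \<in> std_group" for g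
  proof -
    obtain q where q: "norm q = 1" "g = std q" using g by (auto simp: std_group_def)
    have "std (quat_mult (quat_conj q) q) = (mat 1, mat 1)"
      using q(1) by (simp add: quat_mult_conj std_one)
    then have "std (quat_conj q) \<otimes>\<^bsub>Spin7\<^esub> std q = \<one>\<^bsub>Spin7\<^esub>"
      unfolding std_mult by (simp add: std_def)
    then have "inv\<^bsub>Spin7\<^esub> g = std (quat_conj q)"
      using q by (intro group.inv_equality[OF group_Spin7]) (auto simp: std_Spin7)
    then show ?thesis using q by (auto simp: std_group_def)
  qed
  show "g \<otimes>\<^bsub>Spin7\<^esub> h \<in> std_group" if gh: "g \<in> std_group" "h \<in> std_group" for g h
  proof -
    obtain p q where pq: "norm p = 1" "g = std p" "norm q = 1" "h = std q"
      using gh by (auto simp: std_group_def)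
    have "g \<otimes>\<^bsub>Spin7\<^esub> h = std (quat_mult p q)" by (simp add: pq std_mult) (simp add: std_def)
    then show ?thesis using pq by (auto simp: std_group_def norm_quat_mult)
  qed
qed

lemma matrix_fun_add: "matrix (\<lambda>x. f x + g x) = matrix f + matrix (g :: real^'n \<Rightarrow> real^'m)"
  and matrix_fun_scale: "matrix (\<lambda>x. r *\<^sub>R f x) = r *\<^sub>R matrix (f :: real^'n \<Rightarrow> real^'m)"
  by (simp_all add: matrix_def vec_eq_iff)

lemma smooth_std: "smooth_on UNIV std"
proof -
  let ?h = "\<lambda>p q. (matrix (\<lambda>x. oct_pair (quat_mult (quat_mult p (oct_fst x)) (quat_conj q)) 0), 0 :: real^8^8)"
  let ?l = "\<lambda>q. (0 :: real^8^8, std_B q)"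
  let ?c = "(matrix (\<lambda>x. oct_pair 0 (oct_snd x)), 0 :: real^8^8)"
  have o: "oct_pair (a + b) 0 = oct_pair a 0 + oct_pair b 0" "oct_pair (r *\<^sub>R a) 0 = r *\<^sub>R oct_pair a 0" for a b r
    using oct_pair_add[of a b 0 0] oct_pair_scale[of r a 0] by simp_all
  have "bilinear ?h"
    by (simp add: bilinear_def linear_iff quat_mult.add_left quat_mult.add_right quat_mult.scaleR_left quat_mult.scaleR_right
        linear_add[OF linear_quat_conj] linear_scale[OF linear_quat_conj] o matrix_fun_add matrix_fun_scale)
  moreover have "linear ?l"
    by (simp add: linear_iff std_B_def quat_mult.add_left quat_mult.add_right quat_mult.scaleR_left quat_mult.scaleR_right
        linear_add[OF linear_quat_conj] linear_scale[OF linear_quat_conj] oct_pair_add oct_pair_scale matrix_fun_add matrix_fun_scale)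
  ultimately have "smooth_on UNIV (\<lambda>q. ?h q q + ?l q + ?c)" by (rule smooth_on_quadratic)
  moreover have "(\<lambda>q. ?h q q + ?l q + ?c) = std"
    by (rule ext) (simp add: std_def std_A_def matrix_fun_add[symmetric] oct_pair_add[symmetric])
  ultimately show ?thesis by simp
qed

definition std_param :: "(real^8^8) \<times> (real^8^8) \<Rightarrow> complex^2^2" where
  "std_param g = quat_su2 (oct_fst (snd g *v oct_one))"

lemma std_param_std [simp]: "std_param (std q) = quat_su2 q"
  by (simp add: std_param_def std_def std_B_apply oct_one_def)

lemma linear_std_param: "linear std_param"
  unfolding std_param_def
  by (simp add: linear_iff matrix_vector_mult_add_rdistrib scaleR_matrix_vector_assoc[symmetric]
      linear_add[OF linear_oct_fst] linear_scale[OF linear_oct_fst] linear_add[OF linear_quat_su2] linear_scale[OF linear_quat_su2])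

text \<open>  Since \<open>std_B q\<close> maps \<open>1\<close> to \<open>(q, 0)\<close>, the parameter \<open>q\<close> is a linear function of the matrices, while
  conversely \<open>std q\<close> is quadratic in \<open>q\<close>.\<close>

lemma std_lie_group_iso: "lie_group_iso (as_group Spin8 std_group) SU2 std_param"
proof -
  have p: "std_param \<in> std_group \<rightarrow> carrier SU2" by (auto simp: std_group_def quat_su2_carrier)
  have s: "(\<lambda>U. std (su2_quat U)) \<in> carrier SU2 \<rightarrow> std_group" by (auto simp: std_group_def SU2_form)
  have "smooth_map std_group (carrier SU2) std_param"
    using linear_std_param p by (intro smooth_mapI smooth_on_linear)
  moreover have "smooth_map (carrier SU2) UNIV su2_quat"
    by (intro smooth_mapI smooth_on_linear linear_su2_quat) auto
  then have "smooth_map (carrier SU2) UNIV (\<lambda>U. std (su2_quat U))"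
    using smooth_mapI[OF smooth_std] by (rule smooth_map_compose) auto
  then have "smooth_map (carrier SU2) std_group (\<lambda>U. std (su2_quat U))"
    using s by (simp add: smooth_map_def)
  ultimately have d: "diffeomorphism std_group (carrier SU2) std_param"
    by (rule diffeomorphismI) (auto simp: std_group_def SU2_form)
  have "std_param (g \<otimes>\<^bsub>Spin8\<^esub> h) = std_param g ** std_param h" if gh: "g \<in> std_group" "h \<in> std_group" for g h
  proof -
    obtain p q where pq: "g = std p" "h = std q" using gh unfolding std_group_def by blast
    have "g \<otimes>\<^bsub>Spin8\<^esub> h = std (quat_mult p q)" by (simp add: pq std_mult) (simp add: std_def)
    then show ?thesis by (simp only: std_param_std pq quat_su2_mult)
  qed
  then have "std_param \<in> hom (as_group Spin8 std_group) SU2"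
    using p by (auto simp: hom_def)
  then show ?thesis using d unfolding lie_group_iso_def iso_def by (auto simp: diffeomorphism_def)
qed

lemma std_free:
  assumes q: "norm q = 1" and y: "y \<noteq> 0" and f: "std_B q *v y = y"
  shows "q = quat_one"
proof -
  have 1: "quat_mult (q - quat_one) (oct_fst y) = 0"
    using arg_cong[OF f, of oct_fst] by (simp add: std_B_apply quat_mult.diff_left)
  have "quat_mult (oct_snd y) (quat_conj q) = oct_snd y"
    using arg_cong[OF f, of oct_snd] by (simp add: std_B_apply)
  then have "quat_mult (oct_snd y) (quat_mult (quat_conj q) q) = quat_mult (oct_snd y) q"
    by (simp add: quat_mult_assoc[symmetric])
  then have 2: "quat_mult (oct_snd y) (q - quat_one) = 0"
    using q by (simp add: quat_mult_conj quat_mult.diff_right)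
  have "oct_fst y \<noteq> 0 \<or> oct_snd y \<noteq> 0" using y by (auto simp: oct_eq_iff quat_eq_iff)
  then have "q - quat_one = 0"
    using norm_quat_mult[of "q - quat_one" "oct_fst y"] norm_quat_mult[of "oct_snd y" "q - quat_one"] 1 2 by auto
  then show ?thesis by simp
qed

lemma std_free_action:
  assumes "\<And>x y. (x, y) \<in> M \<Longrightarrow> y \<noteq> 0"
  shows "free_action (as_group Spin8 std_group) M spin_act"
  unfolding free_action_def
proof (intro ballI impI)
  fix g m assume g: "g \<in> carrier (as_group Spin8 std_group)" and m: "m \<in> M" "spin_act g m = m"
  obtain q where q: "norm q = 1" "g = std q" using g by (auto simp: std_group_def)
  obtain x y where "m = (x, y)" by (cases m)
  then have "q = quat_one" using std_free[OF q(1), of y] m assms by (auto simp: q spin_act_def std_def)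
  then show "g = \<one>\<^bsub>as_group Spin8 std_group\<^esub>" by (simp add: q std_one)
qed

lemma std_group_free_Spin8: "std_group \<in> free_subgroups Spin8 SU2 S7xS7 spin_act"
proof -
  have "free_action (as_group Spin8 std_group) S7xS7 spin_act"
    by (rule std_free_action) (auto simp: S7xS7_def)
  then show ?thesis
    unfolding free_subgroups_def using std_lie_group_iso subgroup_Spin7_Spin8[OF std_subgroup] by blast
qed

lemma std_group_free_Spin7: "std_group \<in> free_subgroups Spin7 SU2 S6xS7 spin_act"
proof -
  have "free_action (as_group Spin8 std_group) S6xS7 spin_act"
    by (rule std_free_action) (auto simp: S7xS7_def S6xS7_def)
  then show ?thesis
    unfolding free_subgroups_def as_group_Spin7 using std_lie_group_iso std_subgroup by blast
qed

text \<open>Moves the coordinates 2, 3, 4, which \<open>std_A\<close> rotates, to the positions 6, 7, 8 of \<open>so3_block\<close>.\<close>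

definition oct_shift :: "oct \<Rightarrow> oct" where
  "oct_shift x = vector [x$1, x$5, x$6, x$7, x$8, x$2, x$3, x$4]"

definition oct_unshift :: "oct \<Rightarrow> oct" where
  "oct_unshift x = vector [x$1, x$6, x$7, x$8, x$2, x$3, x$4, x$5]"

definition conj_snd :: "oct \<Rightarrow> oct" where
  "conj_snd y = oct_pair (oct_fst y) (quat_conj (oct_snd y))"

lemma so3_block_apply:
  "so3_block A *v z = (let w = A *v vector [z$6, z$7, z$8] in vector [z$1, z$2, z$3, z$4, z$5, w$1, w$2, w$3])"
  by (simp add: so3_block_def vec_eq_iff forall_8 matrix_vector_mult_def sum_8 sum_3)

lemma su2_cover_apply:
  "su2_cover U *v w = quat_im (quat_mult (quat_mult (su2_quat U) (im_quat w)) (quat_conj (su2_quat U)))"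
  unfolding su2_cover_def
  by (subst real_matrix_works)
     (auto simp: linear_iff quat_im_def im_quat_def vec_eq_iff forall_3 quat_mult_nth algebra_simps)

lemma so3_block_shift:
  assumes q: "norm (su2_quat U) = 1"
  shows "so3_block (su2_cover U) *v oct_shift x = oct_shift (std_A (su2_quat U) *v x)"
proof -
  let ?q = "su2_quat U"
  let ?w = "vector [x$2, x$3, x$4] :: real^3"
  let ?r = "quat_mult (quat_mult ?q (im_quat ?w)) (quat_conj ?q)"
  have "oct_fst x = (x $ 1) *\<^sub>R quat_one + im_quat ?w"
    by (simp add: quat_eq_iff quat_one_def im_quat_def)
  then have "quat_mult (quat_mult ?q (oct_fst x)) (quat_conj ?q) = (x $ 1) *\<^sub>R quat_one + ?r"
    using q by (simp add: quat_mult.add_left quat_mult.add_right quat_mult.scaleR_left quat_mult.scaleR_right quat_mult_conj)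
  moreover have "?r $ 1 = 0"
    by (simp add: quat_mult_nth im_quat_def algebra_simps)
  ultimately show ?thesis
    by (simp add: so3_block_apply su2_cover_apply Let_def std_A_apply oct_shift_def quat_im_def vec_eq_iff forall_8 quat_one_def del: su2_quat_nth)
qed

lemma conj_snd_std_B: "conj_snd (std_B q *v y) = hopf q (conj_snd y)"
  by (simp add: conj_snd_def std_B_apply hopf_def)

lemma spin_act_std: "spin_act (std q) (x, y) = (std_A q *v x, std_B q *v y)"
  by (simp add: spin_act_def std_def)

lemma std_equivalent_act_b:
  assumes M: "M = S7xS7 \<or> M = S6xS7"
  shows "equivalent_actions (as_group Spin8 std_group) M spin_act SU2 M act_b"
proof -
  let ?F = "\<lambda>(x, y). (oct_shift x, conj_snd y)" and ?G = "\<lambda>(x, y). (oct_unshift x, conj_snd y)"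
  have n: "norm (oct_shift x) = norm x" "norm (oct_unshift x) = norm x" "norm (conj_snd x) = norm x" for x
    by (simp_all add: norm_eq_sqrt_inner inner_vec_def sum_8 oct_shift_def oct_unshift_def conj_snd_def)
  have n1: "oct_shift x $ 1 = x $ 1" "oct_unshift x $ 1 = x $ 1" for x
    by (simp_all add: oct_shift_def oct_unshift_def)
  have lF: "linear ?F" and lG: "linear ?G"
    by (auto intro!: linearI simp: oct_shift_def oct_unshift_def conj_snd_def vec_eq_iff forall_8)
  have "diffeomorphism M M ?F"
  proof (rule diffeomorphismI)
    show "smooth_map M M ?F" using M
      by (intro smooth_mapI smooth_on_linear[OF lF]) (auto simp: S6xS7_def S7xS7_def n n1)
    show "smooth_map M M ?G" using M
      by (intro smooth_mapI smooth_on_linear[OF lG]) (auto simp: S6xS7_def S7xS7_def n n1)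
  qed (auto simp: oct_shift_def oct_unshift_def conj_snd_def vec_eq_iff forall_8)
  moreover have "?F (spin_act g m) = act_b (std_param g) (?F m)" if g: "g \<in> std_group" for g m
  proof -
    obtain q where q: "norm q = 1" "g = std q" using g by (auto simp: std_group_def)
    then show ?thesis
      using so3_block_shift[of "quat_su2 q"]
      by (cases m) (simp add: spin_act_std act_b_def conj_snd_std_B hopf_act_eq)
  qed
  ultimately show ?thesis
    using std_lie_group_iso unfolding equivalent_actions_def
    by (intro exI[of _ std_param] exI[of _ ?F] conjI ballI) simp_all
qed

text \<open>  All free subgroups are equivalent to the Hopf action on both factors, and one of them, \<open>std_group\<close>, is
  equivalent to action (b).\<close>

theorem free_SU2_subgroup_equivalent_to_act_b:
  assumes L: "L \<in> free_subgroups Spin8 SU2 S7xS7 spin_act"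
  shows "equivalent_actions (as_group Spin8 L) S7xS7 spin_act SU2 S7xS7 act_b"
    and "L' \<in> free_subgroups Spin8 SU2 S7xS7 spin_act \<Longrightarrow>
      equivalent_actions (as_group Spin8 L) S7xS7 spin_act (as_group Spin8 L') S7xS7 spin_act"
proof -
  have two: "equivalent_actions (as_group Spin8 L) S7xS7 spin_act (as_group Spin8 L') S7xS7 spin_act"
    if L': "L' \<in> free_subgroups Spin8 SU2 S7xS7 spin_act" for L'
  proof (rule equivalent_actions_trans[OF free_SU2_subgroup_equivalent_to_hopf[OF L]])
    have s: "subgroup L' Spin8" using L' by (auto simp: free_subgroups_def)
    show "equivalent_actions SU2 S7xS7 act_a (as_group Spin8 L') S7xS7 spin_act"
    proof (rule equivalent_actions_sym[OF _ _ free_SU2_subgroup_equivalent_to_hopf[OF L']])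
      show "group (as_group Spin8 L')" using subgroup.subgroup_is_group[OF s group_Spin8] .
    qed (use subgroup.mem_carrier[OF s] spin_act_S7xS7 in auto)
  qed
  show "L' \<in> free_subgroups Spin8 SU2 S7xS7 spin_act \<Longrightarrow>
      equivalent_actions (as_group Spin8 L) S7xS7 spin_act (as_group Spin8 L') S7xS7 spin_act" by (rule two)
  show "equivalent_actions (as_group Spin8 L) S7xS7 spin_act SU2 S7xS7 act_b"
    using equivalent_actions_trans[OF two[OF std_group_free_Spin8] std_equivalent_act_b] by blast
qed

section \<open>Every element of Spin(7) fixes a point of the equator\<close>

lemma singular_matrix_kernel:
  fixes A :: "real^'n^'n"
  assumes "det A = 0" obtains x where "x \<noteq> 0" "A *v x = 0"
proof -
  have "\<not> inj ((*v) A)" using det_nz_iff_inj[of "(*v) A"] assms by (simp add: matrix_of_matrix_vector_mul)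
  then show ?thesis using that by (auto simp: linear_injective_0[OF matrix_vector_mul_linear])
qed

text \<open>  \<open>M - 1 = M (1 - M)\<^sup>T\<close> implies \<open>det (M - 1) = - det (1 - M)\<close>, and in even dimension \<open>det (1 - M) = det (M - 1)\<close>.\<close>

lemma improper_fixed_vector:
  fixes M :: "real^8^8"
  assumes M: "orthogonal_matrix M" "det M = - 1"
  obtains x where "x \<noteq> 0" "M *v x = x"
proof -
  have s: "matrix ((*\<^sub>R) (- 1)) ** (M - mat 1) = mat 1 - M"
    by (simp add: matrix_eq matrix_vector_mul_assoc[symmetric] real_matrix_works linear_iff matrix_vector_mult_diff_rdistrib)
  have "det (mat 1 - M) = det (M - mat 1)"
    using arg_cong[OF s, of det] by (simp add: det_mul)
  moreover have "transpose (mat 1 - M) = mat 1 - transpose M"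
    by (simp add: transpose_def vec_eq_iff mat_def)
  then have "M - mat 1 = M ** transpose (mat 1 - M)"
    using M(1) by (simp add: orthogonal_matrix_def matrix_eq matrix_vector_mul_assoc[symmetric]
        matrix_vector_mult_diff_rdistrib matrix_vector_mult_diff_distrib)
  then have "det (M - mat 1) = - det (mat 1 - M)"
    using M(2) by (metis det_mul det_transpose mult_minus1)
  ultimately have "det (M - mat 1) = 0" by simp
  then obtain x where "x \<noteq> 0" "(M - mat 1) *v x = 0" by (rule singular_matrix_kernel)
  then show ?thesis using that by (simp add: matrix_vector_mult_diff_rdistrib)
qed

text \<open>  A rotation of an odd-dimensional space, here the imaginary octonions, has a fixed vector. Composing
  \<open>A\<close> with the reflection \<open>R\<close> that negates \<open>1\<close> makes it improper, and since \<open>A R\<close> negates \<open>1\<close>, its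
  fixed vectors are imaginary.\<close>

lemma rotation_fixing_one_fixes_equator_point:
  assumes A: "rotation_matrix A" and A1: "A *v oct_one = oct_one"
  obtains x where "norm x = 1" "x $ 1 = 0" "A *v x = x"
proof -
  \<comment> \<open>The reflection \<open>x \<mapsto> x - 2 (Re x) 1\<close>.\<close>
  define R :: "real^8^8" where "R = (\<chi> i j. if i = j then (if i = 1 then - 1 else 1) else 0)"
  have R: "R *v x = x - (2 * x $ 1) *\<^sub>R oct_one" for x
    by (simp add: R_def vec_eq_iff matrix_vector_mult_def forall_8 sum_8 oct_one_nth)
  have "det R = (\<Prod>i\<in>UNIV. R $ i $ i)" by (rule det_diagonal) (simp add: R_def)
  also have "\<dots> = - 1" by (simp add: R_def)
  finally have "det R = - 1" .
  moreover have "orthogonal_matrix R"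
  proof (rule orthogonal_matrixI)
    fix x show "norm (R *v x) = norm x"
      by (simp add: R norm_eq_sqrt_inner inner_vec_def sum_8 oct_one_nth)
  qed
  ultimately have "orthogonal_matrix (A ** R)" "det (A ** R) = - 1"
    using A by (auto simp: rotation_matrix_def det_mul intro: orthogonal_matrix_mul)
  then obtain x where x: "x \<noteq> 0" "A *v (R *v x) = x"
    using improper_fixed_vector by (metis matrix_vector_mul_assoc)
  have "R *v oct_one = - oct_one" by (simp add: R vec_eq_iff forall_8 oct_one_nth)
  then have "(A *v (R *v x)) \<bullet> (A *v (R *v oct_one)) = - (x \<bullet> oct_one)"
    using x A1 by (simp add: linear_neg)
  moreover have "(A *v (R *v x)) \<bullet> (A *v (R *v oct_one)) = (R *v x) \<bullet> (R *v oct_one)"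
    by (rule rotation_matrix_inner[OF A])
  moreover have "(R *v x) \<bullet> (R *v oct_one) = x $ 1"
    by (simp add: R inner_vec_def sum_8 oct_one_nth)
  ultimately have x1: "x $ 1 = 0" by (simp add: inner_oct_one)
  then have "A *v x = x" using x R by simp
  then show ?thesis using that[of "x /\<^sub>R norm x"] x(1) x1
    by (simp add: linear_scale[OF matrix_vector_mul_linear])
qed

section \<open>Free subgroups of Spin(7) and orthonormal frames\<close>

definition imag_oct :: "oct set" where "imag_oct = {x. norm x = 1 \<and> x $ 1 = 0}"

definition oct_frame :: "oct \<Rightarrow> oct \<Rightarrow> oct \<Rightarrow> bool" where
  "oct_frame e1 e2 e3 \<longleftrightarrow> {e1, e2, e3} \<subseteq> imag_oct \<and> e1 \<bullet> e2 = 0 \<and> e2 \<bullet> e3 = 0 \<and> e3 \<bullet> e1 = 0"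

text \<open>  For an orthonormal frame of imaginary octonions, the even Clifford algebra on \<open>e1\<close>, \<open>e2\<close>, \<open>e3\<close> is a quaternion algebra acting on the octonions; its
  imaginary units are the products of left multiplications by two frame vectors.\<close>

definition frame_map :: "oct \<Rightarrow> oct \<Rightarrow> oct \<Rightarrow> quat \<Rightarrow> oct \<Rightarrow> oct" where
  "frame_map e1 e2 e3 q y = (q $ 1) *\<^sub>R y + (q $ 2) *\<^sub>R oct_mult e2 (oct_mult e3 y)
     + (q $ 3) *\<^sub>R oct_mult e3 (oct_mult e1 y) + (q $ 4) *\<^sub>R oct_mult e1 (oct_mult e2 y)"

definition frame_group :: "oct \<Rightarrow> oct \<Rightarrow> oct \<Rightarrow> ((real^8^8) \<times> (real^8^8)) set" where
  "frame_group e1 e2 e3 = {(A, B) \<in> carrier Spin7. \<exists>q. norm q = 1 \<and> (\<forall>y. B *v y = frame_map e1 e2 e3 q y)}"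

lemma imag_oct_clifford:
  assumes "u \<in> imag_oct"
  shows "oct_mult u (oct_mult u y) = - y"
  using assms oct_imaginary_square[of u y] by (simp add: imag_oct_def)

lemma imag_oct_anticommute:
  assumes "u $ 1 = 0" "v $ 1 = 0" "u \<bullet> v = 0"
  shows "oct_mult u (oct_mult v y) = - oct_mult v (oct_mult u y)"
  using oct_imaginary_clifford[OF assms(1,2), of y] assms(3) by (simp add: eq_neg_iff_add_eq_0)

text \<open>  Let \<open>U\<close>, \<open>V\<close> be the left multiplications by \<open>u\<close>, \<open>v\<close>. The Clifford relation
  \<open>V U = - U V - 2 (u \<bullet> v)\<close> gives \<open>(U V)\<^sup>2 = - 1 - 2 (u \<bullet> v) U V\<close>.\<close>

lemma imag_oct_orthogonal:
  assumes u: "u \<in> imag_oct" and v: "v \<in> imag_oct"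
    and sq: "\<And>y. oct_mult u (oct_mult v (oct_mult u (oct_mult v y))) = - y"
  shows "u \<bullet> v = 0"
proof -
  have "oct_mult u (oct_mult v oct_one) + oct_mult v (oct_mult u oct_one) = - ((2 * (u \<bullet> v)) *\<^sub>R oct_one)"
    using u v by (intro oct_imaginary_clifford) (auto simp: imag_oct_def)
  then have swap: "oct_mult v (oct_mult u y) = - ((2 * (u \<bullet> v)) *\<^sub>R y) - oct_mult u (oct_mult v y)" for y
    using u v oct_imaginary_clifford[of u v y] by (simp add: imag_oct_def eq_diff_eq add.commute)
  have "oct_mult v (oct_mult u v) = - ((2 * (u \<bullet> v)) *\<^sub>R v) + u"
    using swap[of v] imag_oct_clifford[OF v, of oct_one] by (simp add: oct_mult.minus_right)
  then have "oct_mult u (oct_mult v (oct_mult u v)) = - ((2 * (u \<bullet> v)) *\<^sub>R oct_mult u v) + oct_mult u u"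
    by (simp add: oct_mult.add_right oct_mult.minus_right oct_mult.scaleR_right oct_mult.diff_right)
  moreover have "oct_mult u (oct_mult v (oct_mult u v)) = - oct_one" using sq[of oct_one] by simp
  moreover have "oct_mult u u = - oct_one" using imag_oct_clifford[OF u, of oct_one] by simp
  ultimately have "(2 * (u \<bullet> v)) *\<^sub>R oct_mult u v = 0" by simp
  moreover have "oct_mult u v \<noteq> 0" using norm_oct_mult[of u v] u v by (auto simp: imag_oct_def)
  ultimately show ?thesis by simp
qed

lemma Spin7_triality:
  "(A, B) \<in> carrier Spin7 \<Longrightarrow> B *v oct_mult x y = oct_mult (A *v x) (B *v y)"
  by (simp add: carrier_Spin7 triality_def)

lemma Spin7_determined:
  assumes "(A, B) \<in> carrier Spin7" "(A', B) \<in> carrier Spin7" shows "A = A'"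
proof -
  have r: "rotation_matrix B" using assms by (simp add: carrier_Spin7)
  have "A *v x = A' *v x" for x
  proof -
    have "oct_mult (A *v x) (B *v y) = oct_mult (A' *v x) (B *v y)" for y
      using Spin7_triality[OF assms(1)] Spin7_triality[OF assms(2)] by metis
    from this[of "transpose B *v oct_one"] show ?thesis by (simp add: rotation_matrix_cancel[OF r])
  qed
  then show ?thesis by (simp add: matrix_eq)
qed

lemma hopf_quat_expansion:
  "hopf q x = (q $ 1) *\<^sub>R x + (q $ 2) *\<^sub>R hopf quat_i x + (q $ 3) *\<^sub>R hopf quat_j x + (q $ 4) *\<^sub>R hopf quat_k x"
  by (simp add: hopf_def oct_eq_iff quat_eq_iff quat_mult_nth)

context spin8_hom
begin

text \<open>  Let \<open>I\<close>, \<open>J\<close>, \<open>K\<close> be the images of \<open>i\<close>, \<open>j\<close>, \<open>k\<close> under \<open>rep_b\<close>, let \<open>A\<^sub>i\<close>, \<open>A\<^sub>j\<close> be those of \<open>i\<close>, \<open>j\<close> under \<open>rep_a\<close>,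
  and write \<open>L\<^sub>x\<close> for left multiplication. Triality reads \<open>I L\<^sub>x = L\<^sub>y I\<close> with \<open>y = A\<^sub>i x\<close>. As \<open>rep_b\<close> is linear
  in the quaternion, \<open>rep_b (-1) = -1\<close>, so \<open>rep_a (-1) = 1\<close> and \<open>A\<^sub>i\<close>, \<open>A\<^sub>j\<close> are commuting involutions.
  Whenever \<open>A\<^sub>i x = - x\<close>, the triality equation at the square root of \<open>i\<close> factorizes \<open>I\<close> as \<open>L\<^sub>x L\<^sub>f\<close>.
  A common eigenvector \<open>e3\<close> of \<open>A\<^sub>i\<close> and \<open>A\<^sub>j\<close> for the eigenvalue \<open>-1\<close> is thus a common factor: \<open>I\<close> is the
  product of left multiplications by \<open>e2\<close> and \<open>e3\<close>, and \<open>J\<close> by \<open>e3\<close> and \<open>e1\<close>. Then \<open>K = I J\<close> has the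
  right form too, and the frame is orthogonal because \<open>I\<^sup>2 = J\<^sup>2 = K\<^sup>2 = -1\<close>.\<close>

lemma free_Spin7_frame:
  assumes spin7: "\<And>q. norm q = 1 \<Longrightarrow> \<sigma> q \<in> carrier Spin7" and free: "acts_freely rep_b"
  obtains e1 e2 e3 where "oct_frame e1 e2 e3" "\<And>q y. norm q = 1 \<Longrightarrow> rep_b q y = frame_map e1 e2 e3 q y"
proof -
  obtain Q where Q: "orthogonal_transformation Q" "\<And>q x. norm q = 1 \<Longrightarrow> Q (rep_b q x) = hopf q (Q x)"
    using free_rep_is_hopf[OF rep_b free] by blast
  note linQ = orthogonal_transformation_linear[OF Q(1)]
  have unit: "norm quat_i = 1" "norm quat_j = 1" "norm quat_k = 1"
    using a.imag_units_ijk by (simp_all add: imag_units_def)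
  have expand: "rep_b q y = (q $ 1) *\<^sub>R y + (q $ 2) *\<^sub>R rep_b quat_i y + (q $ 3) *\<^sub>R rep_b quat_j y + (q $ 4) *\<^sub>R rep_b quat_k y"
    if q: "norm q = 1" for q y
  proof -
    have "Q (rep_b q y) = Q ((q $ 1) *\<^sub>R y + (q $ 2) *\<^sub>R rep_b quat_i y + (q $ 3) *\<^sub>R rep_b quat_j y + (q $ 4) *\<^sub>R rep_b quat_k y)"
      unfolding linear_add[OF linQ] linear_scale[OF linQ] Q(2)[OF q] Q(2)[OF unit(1)] Q(2)[OF unit(2)] Q(2)[OF unit(3)]
      by (rule hopf_quat_expansion)
    then show ?thesis using orthogonal_transformation_inv_cancel(1)[OF Q(1)] by metis
  qed
  have tri: "rep_b q (oct_mult x y) = oct_mult (rep_a q x) (rep_b q y)" if "norm q = 1" for q x y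
    using Spin7_triality[of "fst (\<sigma> q)" "snd (\<sigma> q)"] spin7[OF that] by (simp add: rep_a_def rep_b_def)
  have real: "rep_a q x $ 1 = x $ 1" if "norm q = 1" for q x
    using Spin7_real_part[of "fst (\<sigma> q)" "snd (\<sigma> q)"] spin7[OF that] by (simp add: rep_a_def)
  have imag: "rep_a q x \<in> imag_oct" if "norm q = 1" "x \<in> imag_oct" for q x
    using real[OF that(1)] that(2) orthogonal_transformation_norm[OF a.orth[OF that(1)]] by (simp add: imag_oct_def)
  have m1: "norm (- quat_one) = 1" by simp
  have b_m: "rep_b (- quat_one) y = - y" for y
    using expand[OF m1, of y] by (simp add: quat_one_def)
  have a_m: "rep_a (- quat_one) x = x" for x
    using tri[OF m1, of x oct_one] by (simp add: b_m oct_mult.minus_right)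
  have qm: "quat_mult quat_i quat_i = - quat_one" "quat_mult quat_j quat_j = - quat_one" "quat_mult quat_k quat_k = - quat_one"
    "quat_mult quat_i quat_j = quat_k" "quat_mult quat_j quat_i = quat_mult (- quat_one) quat_k"
    by (simp_all add: quat_eq_iff quat_mult_nth quat_one_def)
  have sq_a: "rep_a q (rep_a q x) = x" and sq_b: "rep_b q (rep_b q y) = - y"
    if "q = quat_i \<or> q = quat_j \<or> q = quat_k" for q x y
    using that unit by (auto simp: a.mult[symmetric] b.mult[symmetric] qm a_m b_m)
  have ij_b: "rep_b quat_i (rep_b quat_j y) = rep_b quat_k y" "rep_b quat_j (rep_b quat_i y) = - rep_b quat_k y" for y
    using b.mult[OF unit(1,2), of y] b.mult[OF unit(2,1), of y] b.mult[OF m1 unit(3), of y] by (simp_all add: qm b_m)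
  have ij_a: "rep_a quat_j (rep_a quat_i x) = rep_a quat_i (rep_a quat_j x)" for x
    using a.mult[OF unit(1,2), of x] a.mult[OF unit(2,1), of x] a.mult[OF m1 unit(3), of x] by (simp add: qm a_m)
  have half: "\<exists>f\<in>imag_oct. rep_a v f = - f \<and> (\<forall>y. rep_b v y = oct_mult x (oct_mult f y))"
    if v: "v = quat_i \<or> v = quat_j" and x: "x \<in> imag_oct" "rep_a v x = - x" for v x
  proof -
    have vi: "v \<in> imag_units" using v a.imag_units_ijk by auto
    \<comment> \<open>The square root \<open>(1 + v) / sqrt 2\<close> of \<open>v\<close>.\<close>
    let ?z = "quat_cis v (pi / 4)"
    define s :: real where "s = sqrt 2 / 2"
    have s: "s \<noteq> 0" "s * s = 1 / 2" by (simp_all add: s_def)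
    have nz: "norm ?z = 1" "norm v = 1" using norm_quat_cis[OF vi] vi by (auto simp: imag_units_def)
    have bz: "rep_b ?z y = s *\<^sub>R (y + rep_b v y)" for y
    proof -
      have "rep_b ?z y = cos (pi/4) *\<^sub>R y + sin (pi/4) *\<^sub>R rep_b v y"
        using expand[OF nz(1), of y] expand[OF nz(2), of y] vi
        by (simp add: quat_cis_def quat_one_def imag_units_def scaleR_add_right)
      then show ?thesis by (simp add: cos_45 sin_45 s_def scaleR_add_right)
    qed
    define f where "f = rep_a ?z x"
    have f: "f \<in> imag_oct" unfolding f_def by (rule imag[OF nz(1) x(1)])
    note bl = linear_add[OF b.rho_linear[OF nz(2)]]
    have "rep_b v y = oct_mult x (oct_mult f y)" for y
    proof -
      have sqv: "rep_b v (rep_b v w) = - w" for w using sq_b v by blast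
      have anti: "rep_b v (oct_mult x w) = - oct_mult x (rep_b v w)" for w
        using tri[OF nz(2), of x w] x(2) by (simp add: oct_mult.minus_left)
      have "s *\<^sub>R (oct_mult x y - oct_mult x (rep_b v y)) = s *\<^sub>R (oct_mult f y + oct_mult f (rep_b v y))" for y
        using tri[OF nz(1), of x y] unfolding bz f_def[symmetric] by (simp add: anti oct_mult.scaleR_right oct_mult.add_right)
      then have e: "oct_mult x y - oct_mult x (rep_b v y) = oct_mult f y + oct_mult f (rep_b v y)" for y
        using s(1) by simp
      have "oct_mult x (rep_b v y) + oct_mult x y = oct_mult f (rep_b v y) - oct_mult f y"
        using e[of "rep_b v y"] by (simp add: sqv oct_mult.minus_right)
      with e[of y] have "(oct_mult x (rep_b v y) + oct_mult x (rep_b v y)) $ l = (- (oct_mult f y + oct_mult f y)) $ l" for l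
        unfolding vec_eq_iff by (simp only: vector_add_component vector_minus_component vector_uminus_component) smt
      then have "oct_mult x (rep_b v y) + oct_mult x (rep_b v y) = - (oct_mult f y + oct_mult f y)"
        unfolding vec_eq_iff by blast
      then have "2 *\<^sub>R oct_mult x (rep_b v y) = 2 *\<^sub>R (- oct_mult f y)"
        by (simp only: scaleR_2 minus_add_distrib)
      then have "oct_mult x (rep_b v y) = - oct_mult f y" unfolding scaleR_cancel_left by simp
      then have "oct_mult x (oct_mult x (rep_b v y)) = - oct_mult x (oct_mult f y)" by (simp add: oct_mult.minus_right)
      then show ?thesis by (simp add: imag_oct_clifford[OF x(1)])
    qed
    moreover have "rep_a v f = - f"
    proof -
      have "quat_mult v ?z = quat_mult ?z v"
        by (simp add: quat_cis_def quat_mult.add_left quat_mult.add_right quat_mult.scaleR_left quat_mult.scaleR_right)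
      then have "rep_a v f = rep_a ?z (rep_a v x)"
        using a.mult[OF nz(1,2), of x] a.mult[OF nz(2,1), of x] by (simp add: f_def)
      then show ?thesis by (simp add: x(2) f_def linear_neg[OF a.rho_linear[OF nz(1)]])
    qed
    ultimately show ?thesis using f by blast
  qed
  have normalize: "\<exists>x\<in>imag_oct. P x"
    if "z \<noteq> 0" "z $ 1 = 0" "\<And>r. P (r *\<^sub>R z)" for z :: oct and P
    using that(3)[of "1 / norm z"] that(1,2) by (intro bexI[of _ "(1 / norm z) *\<^sub>R z"]) (auto simp: imag_oct_def)
  note lin_a = linear_diff[OF a.rho_linear] linear_scale[OF a.rho_linear]
  \<comment> \<open>Otherwise \<open>rep_b i\<close> would be a sign, but its square is \<open>-1\<close>.\<close>
  have "\<exists>x0. rep_a quat_i x0 \<noteq> x0"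
  proof (rule ccontr)
    assume "\<not> ?thesis"
    then have "oct_mult x (rep_b quat_i y) = rep_b quat_i (oct_mult x y)" for x y
      using tri[OF unit(1), of x y] by simp
    then have "(\<forall>y. rep_b quat_i y = y) \<or> (\<forall>y. rep_b quat_i y = - y)"
      by (rule triality_trivial_left) (simp add: orthogonal_transformation_norm[OF b.orth[OF unit(1)]])
    then have "rep_b quat_i (rep_b quat_i oct_one) = oct_one" by auto
    then have "oct_one = - oct_one" using sq_b[of quat_i oct_one] by simp
    then show False by (simp add: oct_eq_iff quat_eq_iff oct_one_nth)
  qed
  then obtain x0 where x0: "rep_a quat_i x0 \<noteq> x0" by blast
  obtain x where x: "x \<in> imag_oct" "rep_a quat_i x = - x"
    using normalize[of "x0 - rep_a quat_i x0" "\<lambda>x. rep_a quat_i x = - x"] x0 real[OF unit(1)] sq_a[of quat_i]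
    by (auto simp: lin_a unit scaleR_diff_right)
  obtain f where f: "f \<in> imag_oct" "rep_a quat_i f = - f" "\<And>y. rep_b quat_i y = oct_mult x (oct_mult f y)"
    using half[of quat_i x] x by blast
  \<comment> \<open>Otherwise \<open>J\<close> would commute with \<open>I = L\<^sub>x L\<^sub>f\<close>, but the two anticommute.\<close>
  have "\<exists>w. rep_a quat_i w = - w \<and> w \<in> imag_oct \<and> rep_a quat_j w \<noteq> w"
  proof (rule ccontr)
    assume "\<not> ?thesis"
    then have "rep_a quat_j x = x" "rep_a quat_j f = f" using x f by auto
    then have "rep_b quat_j (rep_b quat_i y) = rep_b quat_i (rep_b quat_j y)" for y
      unfolding f(3) by (simp add: tri[OF unit(2)])
    then have "rep_b quat_k oct_one = - rep_b quat_k oct_one" unfolding ij_b by simp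
    then have "rep_b quat_k oct_one = 0" by (simp add: vec_eq_iff)
    then show False using orthogonal_transformation_norm[OF b.orth[OF unit(3)], of oct_one] by simp
  qed
  then obtain w where w: "rep_a quat_i w = - w" "w \<in> imag_oct" "rep_a quat_j w \<noteq> w" by blast
  obtain e3 where e3: "e3 \<in> imag_oct" "rep_a quat_i e3 = - e3" "rep_a quat_j e3 = - e3"
    using normalize[of "w - rep_a quat_j w" "\<lambda>x. rep_a quat_i x = - x \<and> rep_a quat_j x = - x"] w real[OF unit(2)] sq_a[of quat_j]
    by (auto simp: lin_a unit scaleR_diff_right ij_a[symmetric] linear_neg[OF a.rho_linear] imag_oct_def)
  obtain g where g: "g \<in> imag_oct" "\<And>y. rep_b quat_i y = oct_mult e3 (oct_mult g y)"
    using half[of quat_i e3] e3 by blast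
  obtain e1 where e1: "e1 \<in> imag_oct" "\<And>y. rep_b quat_j y = oct_mult e3 (oct_mult e1 y)"
    using half[of quat_j e3] e3 by blast
  \<comment> \<open>The sign accounts for the order of the factors in \<open>I\<close>.\<close>
  define e2 where "e2 = - g"
  have e2: "e2 \<in> imag_oct" using g(1) by (simp add: e2_def imag_oct_def)
  have g3: "e3 \<bullet> g = 0" using sq_b[of quat_i] by (intro imag_oct_orthogonal[OF e3(1) g(1)]) (simp add: g(2))
  have e31: "e3 \<bullet> e1 = 0" using sq_b[of quat_j] by (intro imag_oct_orthogonal[OF e3(1) e1(1)]) (simp add: e1(2))
  have bi: "rep_b quat_i y = oct_mult e2 (oct_mult e3 y)" for y
    using imag_oct_anticommute[of e3 g y] g3 e3(1) g(1) by (simp add: g(2) e2_def imag_oct_def oct_mult.minus_left)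
  have k: "rep_b quat_k y = - oct_mult e2 (oct_mult e1 y)" for y
    using ij_b(1)[of y] by (simp add: bi e1(2) imag_oct_clifford[OF e3(1)] oct_mult.minus_right)
  have "oct_mult e2 (oct_mult e1 (oct_mult e2 (oct_mult e1 y))) = - y" for y
    using sq_b[of quat_k y] by (simp add: k oct_mult.minus_right)
  then have e21: "e2 \<bullet> e1 = 0" by (rule imag_oct_orthogonal[OF e2 e1(1)])
  have bk: "rep_b quat_k y = oct_mult e1 (oct_mult e2 y)" for y
    using imag_oct_anticommute[of e2 e1 y] e21 e2 e1(1) by (simp add: k imag_oct_def)
  have "oct_frame e1 e2 e3"
    using e1 e2 e3 e21 e31 g3 by (simp add: oct_frame_def e2_def inner_commute)
  moreover have "rep_b q y = frame_map e1 e2 e3 q y" if "norm q = 1" for q y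
    using expand[OF that, of y] by (simp add: frame_map_def bi bk e1(2))
  ultimately show ?thesis using that by blast
qed

end

text \<open>  Every element of Spin(7) fixes a point of the equator, so freeness means that the second components
  act freely on the other sphere. Conversely, an element of the frame group has the same second component as
  some element of \<open>K\<close>, and in Spin(7) the second component determines the first.\<close>

lemma free_Spin7_subgroup_is_frame_group:
  assumes "K \<in> free_subgroups Spin7 SU2 S6xS7 spin_act"
  obtains e1 e2 e3 where "oct_frame e1 e2 e3" "K = frame_group e1 e2 e3"
proof -
  obtain \<phi> where K7: "subgroup K Spin7" and \<phi>: "lie_group_iso (as_group Spin8 K) SU2 \<phi>"
    and free: "free_action (as_group Spin8 K) S6xS7 spin_act"
    using assms unfolding free_subgroups_def as_group_Spin7 by blast
  obtain \<sigma> d where h: "spin8_hom \<sigma> d" and in_K: "\<And>q. norm q = 1 \<Longrightarrow> \<sigma> q \<in> K"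
    and sigma_phi: "\<And>g. g \<in> K \<Longrightarrow> \<sigma> (su2_quat (\<phi> g)) = g" and phi_sigma: "\<And>q. norm q = 1 \<Longrightarrow> \<phi> (\<sigma> q) = quat_su2 q"
    using spin8_hom_of_subgroup[OF subgroup_Spin7_Spin8[OF K7] \<phi>] by blast
  interpret spin8_hom \<sigma> d by (rule h)
  have in7: "\<sigma> q \<in> carrier Spin7" if "norm q = 1" for q
    using in_K[OF that] subgroup.mem_carrier[OF K7] by blast
  have free': "\<forall>g\<in>K. \<forall>m\<in>S6xS7. spin_act g m = m \<longrightarrow> g = (mat 1, mat 1)"
    using free by (simp add: free_action_def)
  have "acts_freely rep_b"
    unfolding acts_freely_def
  proof (intro allI impI, rule ccontr)
    fix q y assume q: "norm q = 1" "q \<noteq> quat_one" and y: "rep_b q y = y" "y \<noteq> 0"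
    have AB: "(fst (\<sigma> q), snd (\<sigma> q)) \<in> carrier Spin7" using in7[OF q(1)] by simp
    then have "rotation_matrix (fst (\<sigma> q))" unfolding carrier_Spin7 by blast
    then obtain x where x: "norm x = 1" "x $ 1 = 0" "fst (\<sigma> q) *v x = x"
      using rotation_fixing_one_fixes_equator_point Spin7_fixes_one[OF AB] by blast
    have "spin_act (\<sigma> q) (x, y /\<^sub>R norm y) = (x, y /\<^sub>R norm y)"
      using y x by (simp add: spin_act_def case_prod_beta rep_b_def linear_scale[OF matrix_vector_mul_linear])
    moreover have "(x, y /\<^sub>R norm y) \<in> S6xS7" using x y by (simp add: S6xS7_def S7xS7_def)
    ultimately have "\<sigma> q = \<sigma> quat_one"
      using free' in_K[OF q(1)] unfolding hom_one by blast
    then have "quat_su2 q = quat_su2 quat_one" using phi_sigma q(1) by (metis norm_quat_one)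
    then show False using q(2) su2_quat_su2 by metis
  qed
  then obtain e1 e2 e3 where e: "oct_frame e1 e2 e3"
    and b: "\<And>q y. norm q = 1 \<Longrightarrow> rep_b q y = frame_map e1 e2 e3 q y"
    using free_Spin7_frame[OF in7] by blast
  have "K = frame_group e1 e2 e3"
  proof (rule Set.set_eqI)
    fix g :: "(real^8^8) \<times> (real^8^8)"
    obtain A B where AB: "g = (A, B)" by (cases g)
    show "g \<in> K \<longleftrightarrow> g \<in> frame_group e1 e2 e3"
    proof
      assume g: "g \<in> K"
      have "\<phi> g \<in> carrier SU2" using \<phi> g diffeomorphismD(3) unfolding lie_group_iso_def by fastforce
      then have q: "norm (su2_quat (\<phi> g)) = 1" by (rule SU2_form)
      have "B *v y = frame_map e1 e2 e3 (su2_quat (\<phi> g)) y" for y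
        using b[OF q, of y] unfolding rep_b_def sigma_phi[OF g] by (simp add: AB)
      then show "g \<in> frame_group e1 e2 e3"
        using q subgroup.mem_carrier[OF K7 g] by (auto simp: frame_group_def AB)
    next
      assume "g \<in> frame_group e1 e2 e3"
      then obtain q where q: "norm q = 1" "\<And>y. B *v y = frame_map e1 e2 e3 q y" and c: "(A, B) \<in> carrier Spin7"
        by (auto simp: frame_group_def AB)
      have "snd (\<sigma> q) *v y = B *v y" for y using b[OF q(1), of y] q(2)[of y] by (simp add: rep_b_def)
      then have s: "snd (\<sigma> q) = B" by (simp add: matrix_eq)
      have "fst (\<sigma> q) = A"
        using in7[OF q(1)] c by (intro Spin7_determined[of _ B]) (auto simp flip: s)
      then have "g = \<sigma> q" using s by (simp add: AB prod_eq_iff)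
      then show "g \<in> K" using in_K[OF q(1)] by simp
    qed
  qed
  then show ?thesis using that e by blast
qed

section \<open>Conjugacy in Spin(7)\<close>

lemma Spin7_frame_map:
  assumes g: "(G, H) \<in> carrier Spin7"
  shows "H *v frame_map e1 e2 e3 q y = frame_map (G *v e1) (G *v e2) (G *v e3) q (H *v y)"
  by (simp add: frame_map_def Spin7_triality[OF g] matrix_vector_right_distrib linear_scale[OF matrix_vector_mul_linear])

lemma frame_group_conj_subset:
  assumes g: "(G, H) \<in> carrier Spin7" and h: "h \<in> frame_group e1 e2 e3"
  shows "(G, H) \<otimes>\<^bsub>Spin7\<^esub> h \<otimes>\<^bsub>Spin7\<^esub> inv\<^bsub>Spin7\<^esub> (G, H) \<in> frame_group (G *v e1) (G *v e2) (G *v e3)"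
proof -
  obtain A B where AB: "h = (A, B)" by (cases h)
  obtain q where c: "(A, B) \<in> carrier Spin7" and q: "norm q = 1" "\<And>y. B *v y = frame_map e1 e2 e3 q y"
    using h by (auto simp: frame_group_def AB)
  have H: "rotation_matrix H" using g by (simp add: carrier_Spin7)
  have "(G, H) \<otimes>\<^bsub>Spin7\<^esub> h \<otimes>\<^bsub>Spin7\<^esub> inv\<^bsub>Spin7\<^esub> (G, H) \<in> carrier Spin7"
    using g c unfolding AB
    by (intro monoid.m_closed[OF group.is_monoid[OF group_Spin7]] group.inv_closed[OF group_Spin7])
  moreover have "(H ** B ** transpose H) *v y = frame_map (G *v e1) (G *v e2) (G *v e3) q y" for y
    by (simp add: matrix_vector_mul_assoc[symmetric] q(2) Spin7_frame_map[OF g] rotation_matrix_cancel[OF H])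
  ultimately show ?thesis using q(1) by (auto simp: frame_group_def AB inv_Spin7[OF g])
qed

lemma (in group) conj_inverse_conj:
  assumes "g \<in> carrier G" "k \<in> carrier G"
  shows "g \<otimes> (inv g \<otimes> k \<otimes> g) \<otimes> inv g = k"
  using assms by (metis inv_closed l_one m_assoc m_closed r_inv r_one)

lemma frame_group_conj:
  assumes g: "(G, H) \<in> carrier Spin7"
  shows "conjugate_in Spin7 (frame_group e1 e2 e3) (frame_group (G *v e1) (G *v e2) (G *v e3))"
  unfolding conjugate_in_def
proof (intro bexI[OF _ g] equalityI subsetI)
  interpret group Spin7 by (rule group_Spin7)
  let ?g = "(G, H)"
  fix k assume k: "k \<in> frame_group (G *v e1) (G *v e2) (G *v e3)"
  have kc: "k \<in> carrier Spin7" using k by (auto simp: frame_group_def)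
  have i: "(transpose G, transpose H) \<in> carrier Spin7" using inv_closed[OF g] by (simp only: inv_Spin7[OF g])
  have G: "rotation_matrix G" using g by (simp add: carrier_Spin7)
  have "inv\<^bsub>Spin7\<^esub> ?g \<otimes>\<^bsub>Spin7\<^esub> k \<otimes>\<^bsub>Spin7\<^esub> inv\<^bsub>Spin7\<^esub> (inv\<^bsub>Spin7\<^esub> ?g) \<in> frame_group e1 e2 e3"
    using frame_group_conj_subset[OF i k] by (simp only: inv_Spin7[OF g] rotation_matrix_cancel[OF G])
  then have h: "inv\<^bsub>Spin7\<^esub> ?g \<otimes>\<^bsub>Spin7\<^esub> k \<otimes>\<^bsub>Spin7\<^esub> ?g \<in> frame_group e1 e2 e3"
    by (simp only: inv_inv[OF g])
  have "k = ?g \<otimes>\<^bsub>Spin7\<^esub> (inv\<^bsub>Spin7\<^esub> ?g \<otimes>\<^bsub>Spin7\<^esub> k \<otimes>\<^bsub>Spin7\<^esub> ?g) \<otimes>\<^bsub>Spin7\<^esub> inv\<^bsub>Spin7\<^esub> ?g"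
    by (rule conj_inverse_conj[OF g kc, symmetric])
  then show "k \<in> (\<lambda>h. ?g \<otimes>\<^bsub>Spin7\<^esub> h \<otimes>\<^bsub>Spin7\<^esub> inv\<^bsub>Spin7\<^esub> ?g) ` frame_group e1 e2 e3"
    using h by (rule image_eqI)
next
  fix k assume "k \<in> (\<lambda>h. (G, H) \<otimes>\<^bsub>Spin7\<^esub> h \<otimes>\<^bsub>Spin7\<^esub> inv\<^bsub>Spin7\<^esub> (G, H)) ` frame_group e1 e2 e3"
  then show "k \<in> frame_group (G *v e1) (G *v e2) (G *v e3)"
    using frame_group_conj_subset[OF g] by blast
qed

lemma conjugate_in_trans:
  assumes G: "group G" and L: "L \<subseteq> carrier G" and 1: "conjugate_in G L L'" and 2: "conjugate_in G L' L''"
  shows "conjugate_in G L L''"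
proof -
  interpret group G by (rule G)
  obtain g where g: "g \<in> carrier G" "L' = (\<lambda>h. g \<otimes>\<^bsub>G\<^esub> h \<otimes>\<^bsub>G\<^esub> inv\<^bsub>G\<^esub> g) ` L" using 1 by (auto simp: conjugate_in_def)
  obtain k where k: "k \<in> carrier G" "L'' = (\<lambda>h. k \<otimes>\<^bsub>G\<^esub> h \<otimes>\<^bsub>G\<^esub> inv\<^bsub>G\<^esub> k) ` L'" using 2 by (auto simp: conjugate_in_def)
  have "k \<otimes>\<^bsub>G\<^esub> (g \<otimes>\<^bsub>G\<^esub> h \<otimes>\<^bsub>G\<^esub> inv\<^bsub>G\<^esub> g) \<otimes>\<^bsub>G\<^esub> inv\<^bsub>G\<^esub> k = (k \<otimes>\<^bsub>G\<^esub> g) \<otimes>\<^bsub>G\<^esub> h \<otimes>\<^bsub>G\<^esub> inv\<^bsub>G\<^esub> (k \<otimes>\<^bsub>G\<^esub> g)" if "h \<in> L" for h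
    using that g k L by (simp add: m_assoc inv_mult_group subset_iff)
  then have "L'' = (\<lambda>h. (k \<otimes>\<^bsub>G\<^esub> g) \<otimes>\<^bsub>G\<^esub> h \<otimes>\<^bsub>G\<^esub> inv\<^bsub>G\<^esub> (k \<otimes>\<^bsub>G\<^esub> g)) ` L"
    unfolding k(2) g(2) image_image by (rule image_cong[OF refl])
  then show ?thesis using g k unfolding conjugate_in_def by blast
qed

definition left_matrix :: "oct \<Rightarrow> real^8^8" where "left_matrix p = matrix (oct_mult p)"
definition right_matrix :: "oct \<Rightarrow> real^8^8" where "right_matrix p = matrix (\<lambda>x. oct_mult x p)"

lemma left_matrix_apply [simp]: "left_matrix p *v x = oct_mult p x"
  unfolding left_matrix_def by (rule real_matrix_works) (simp add: linear_iff oct_mult.add_right oct_mult.scaleR_right)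

lemma right_matrix_apply [simp]: "right_matrix p *v x = oct_mult x p"
  unfolding right_matrix_def by (rule real_matrix_works) (simp add: linear_iff oct_mult.add_left oct_mult.scaleR_left)

lemma imag_oct_clifford_right:
  assumes "v \<in> imag_oct" shows "oct_mult (oct_mult y v) v = - y"
  using oct_right_cancel[of y v] assms oct_conj_imaginary[of v] by (simp add: imag_oct_def oct_mult.minus_right minus_equation_iff[of _ y])

lemma half_angle_norm:
  assumes v: "v \<in> imag_oct" shows "norm ((sqrt 2 / 2) *\<^sub>R (oct_one + v)) = 1"
proof -
  have "(norm (oct_one + v))\<^sup>2 = 2"
    using v by (simp add: power2_norm_eq_inner inner_add_left inner_add_right inner_oct_one
        inner_commute[of oct_one] oct_one_nth imag_oct_def norm_eq_1)
  then have "norm (oct_one + v) = sqrt 2" by (metis norm_ge_zero real_sqrt_unique)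
  then show ?thesis by simp
qed

lemma half_angle_square: "(sqrt 2 / 2) *\<^sub>R ((sqrt 2 / 2) *\<^sub>R (x + y) + (sqrt 2 / 2) *\<^sub>R (y - x)) = y"
  for x y :: "'a::real_vector"
proof -
  have "(sqrt 2 / 2) *\<^sub>R ((sqrt 2 / 2) *\<^sub>R (x + y) + (sqrt 2 / 2) *\<^sub>R (y - x)) = (1 / 2) *\<^sub>R ((x + y) + (y - x))"
    by (simp flip: scaleR_add_right)
  also have "(x + y) + (y - x) = 2 *\<^sub>R y" by (simp add: scaleR_2)
  finally show ?thesis by simp
qed

text \<open>  For an imaginary unit \<open>v\<close>, the unit octonion \<open>(1 + v) / sqrt 2\<close> is a square root of \<open>v\<close>, also with respect to
  left and right multiplications.\<close>

lemma left_matrix_rotation: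
  assumes v: "v \<in> imag_oct" shows "rotation_matrix (left_matrix v)"
proof -
  let ?p = "(sqrt 2 / 2) *\<^sub>R (oct_one + v)"
  have "orthogonal_matrix (left_matrix ?p)"
    by (rule orthogonal_matrixI) (simp only: left_matrix_apply norm_oct_mult half_angle_norm[OF v] mult_1)
  moreover have "left_matrix v = left_matrix ?p ** left_matrix ?p"
    by (simp add: matrix_eq matrix_vector_mul_assoc[symmetric] oct_mult.scaleR_left oct_mult.scaleR_right
        oct_mult.add_left oct_mult.add_right imag_oct_clifford[OF v] half_angle_square)
  ultimately show ?thesis using rotation_matrix_square by metis
qed

lemma right_matrix_rotation:
  assumes v: "v \<in> imag_oct" shows "rotation_matrix (right_matrix v)"
proof -
  let ?p = "(sqrt 2 / 2) *\<^sub>R (oct_one + v)"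
  have "orthogonal_matrix (right_matrix ?p)"
    by (rule orthogonal_matrixI) (simp only: right_matrix_apply norm_oct_mult half_angle_norm[OF v] mult_1_right)
  moreover have "right_matrix v = right_matrix ?p ** right_matrix ?p"
    by (simp add: matrix_eq matrix_vector_mul_assoc[symmetric] oct_mult.scaleR_left oct_mult.scaleR_right
        oct_mult.add_left oct_mult.add_right imag_oct_clifford_right[OF v] half_angle_square)
  ultimately show ?thesis using rotation_matrix_square by metis
qed

text \<open>For an imaginary unit \<open>v\<close>, this is conjugation by \<open>v\<close>: it fixes \<open>1\<close> and \<open>v\<close> and is \<open>-1\<close> on their
  orthogonal complement.\<close>

definition half_turn :: "oct \<Rightarrow> real^8^8" where
  "half_turn v = left_matrix v ** right_matrix (- v)"

lemma half_turn_one: "v \<in> imag_oct \<Longrightarrow> half_turn v *v oct_one = oct_one"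
  using imag_oct_clifford[of v oct_one] by (simp add: half_turn_def matrix_vector_mul_assoc[symmetric] oct_mult.minus_right)

lemma half_turn_imaginary:
  assumes v: "v \<in> imag_oct" and x: "x $ 1 = 0"
  shows "half_turn v *v x = (2 * (x \<bullet> v)) *\<^sub>R v - x"
proof -
  have "oct_mult v (oct_mult x v) + oct_mult x (oct_mult v v) = - ((2 * (v \<bullet> x)) *\<^sub>R v)"
    using v x by (intro oct_imaginary_clifford) (auto simp: imag_oct_def)
  moreover have "oct_mult v v = - oct_one" using imag_oct_clifford[OF v, of oct_one] by simp
  ultimately have "oct_mult v (oct_mult x v) = x - (2 * (v \<bullet> x)) *\<^sub>R v"
    by (simp add: oct_mult.minus_right algebra_simps)
  then show ?thesis by (simp add: half_turn_def matrix_vector_mul_assoc[symmetric] oct_mult.minus_right inner_commute)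
qed

text \<open>The triality equation for the pair is the Clifford relation between \<open>v\<close> and the imaginary part of \<open>x\<close>.\<close>

lemma half_turn_Spin7:
  assumes v: "v \<in> imag_oct" shows "(half_turn v, left_matrix v) \<in> carrier Spin7"
proof -
  have v': "- v \<in> imag_oct" using v by (simp add: imag_oct_def)
  have "oct_mult (half_turn v *v x) (oct_mult v y) = oct_mult v (oct_mult x y)" for x y
  proof -
    \<comment> \<open>Imaginary part of \<open>x\<close>.\<close>
    define z where "z = x - (x $ 1) *\<^sub>R oct_one"
    have z: "z $ 1 = 0" and x: "x = (x $ 1) *\<^sub>R oct_one + z" by (simp_all add: z_def oct_one_nth)
    have "oct_mult v (oct_mult z y) + oct_mult z (oct_mult v y) = - ((2 * (v \<bullet> z)) *\<^sub>R y)"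
      using v z by (intro oct_imaginary_clifford) (auto simp: imag_oct_def)
    then have "oct_mult v (oct_mult z y) = - ((2 * (v \<bullet> z)) *\<^sub>R y) - oct_mult z (oct_mult v y)"
      by (simp add: eq_diff_eq)
    then have "oct_mult (half_turn v *v z) (oct_mult v y) = oct_mult v (oct_mult z y)"
      by (simp add: half_turn_imaginary[OF v z] oct_mult.diff_left oct_mult.scaleR_left imag_oct_clifford[OF v] inner_commute)
    moreover have "half_turn v *v x = (x $ 1) *\<^sub>R oct_one + half_turn v *v z"
      by (subst x) (simp add: matrix_vector_right_distrib linear_scale[OF matrix_vector_mul_linear] half_turn_one[OF v])
    ultimately show ?thesis
      by (subst (2) x) (simp add: oct_mult.add_left oct_mult.add_right oct_mult.scaleR_left oct_mult.scaleR_right)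
  qed
  then show ?thesis
    using left_matrix_rotation[OF v] right_matrix_rotation[OF v'] rotation_matrix_mult
    by (simp add: carrier_Spin7 triality_def half_turn_def)
qed

lemma frame_map_uminus: "frame_map (- e1) (- e2) (- e3) = frame_map e1 e2 e3"
  by (intro ext) (simp add: frame_map_def oct_mult.minus_left oct_mult.minus_right)

lemma frame_group_uminus: "frame_group (- e1) (- e2) (- e3) = frame_group e1 e2 e3"
  by (simp add: frame_group_def frame_map_uminus)

text \<open>  A frame group does not change when its frame is negated. So up to this sign the half-turn about
  \<open>v = (f - f') / |f - f'|\<close> acts on frames as the reflection \<open>T\<close> that maps \<open>f\<close> to \<open>f'\<close>.\<close>

lemma frame_reflection:
  assumes f: "f \<in> imag_oct" and f': "f' \<in> imag_oct"
  obtains T where "\<And>e1 e2 e3. conjugate_in Spin7 (frame_group e1 e2 e3) (frame_group (T e1) (T e2) (T e3))"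
    "\<And>x y. T x \<bullet> T y = x \<bullet> y" "\<And>x. x $ 1 = 0 \<Longrightarrow> T x $ 1 = 0" "T f = f'"
    "\<And>x. x $ 1 = 0 \<Longrightarrow> x \<bullet> f = 0 \<Longrightarrow> x \<bullet> f' = 0 \<Longrightarrow> T x = x"
proof (cases "f = f'")
  case True
  have one: "(mat 1, mat 1) \<in> carrier Spin7" by (simp add: carrier_Spin7 rotation_matrix_one triality_one)
  show ?thesis by (rule that[of "\<lambda>x. x"]) (use frame_group_conj[OF one] True in auto)
next
  case False
  define v where "v = (f - f') /\<^sub>R norm (f - f')"
  have v: "v \<in> imag_oct" using False f f' by (simp add: v_def imag_oct_def)
  note g = half_turn_Spin7[OF v]
  let ?T = "\<lambda>x. - (half_turn v *v x)"
  have f1: "f $ 1 = 0" "f' $ 1 = 0" "f \<bullet> f = 1" "f' \<bullet> f' = 1"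
    using f f' by (simp_all add: imag_oct_def norm_eq_1)
  have "(norm (f - f'))\<^sup>2 = 2 * (f \<bullet> (f - f'))"
    using f1 by (simp add: power2_norm_eq_inner inner_diff_left inner_diff_right inner_commute)
  moreover have "(2 * (f \<bullet> v)) *\<^sub>R v = (2 * (f \<bullet> (f - f')) / (norm (f - f'))\<^sup>2) *\<^sub>R (f - f')"
    by (simp add: v_def power2_eq_square divide_inverse)
  moreover have "(norm (f - f'))\<^sup>2 \<noteq> 0" using False by simp
  ultimately have "(2 * (f \<bullet> v)) *\<^sub>R v = f - f'"
    by (metis divide_self scaleR_one)
  then have Tf: "?T f = f'" by (simp add: half_turn_imaginary[OF v f1(1)])
  have Tx: "?T x = x" if "x $ 1 = 0" "x \<bullet> f = 0" "x \<bullet> f' = 0" for x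
  proof -
    have "x \<bullet> v = 0" using that by (simp add: v_def inner_diff_right)
    then show ?thesis by (simp add: half_turn_imaginary[OF v that(1)])
  qed
  have r: "rotation_matrix (half_turn v)" using g by (simp add: carrier_Spin7)
  show ?thesis
  proof (rule that[of ?T])
    show "conjugate_in Spin7 (frame_group e1 e2 e3) (frame_group (?T e1) (?T e2) (?T e3))" for e1 e2 e3
      unfolding frame_group_uminus by (rule frame_group_conj[OF g])
  qed (use Tf Tx rotation_matrix_inner[OF r] Spin7_real_part[OF g] in auto)
qed

text \<open>  Three reflections carry one frame to the other, moving one vector at a time: the next
  reflection fixes the vectors already in place, being orthogonal to both vectors that define it.\<close>

lemma frame_groups_conjugate:
  assumes e: "oct_frame e1 e2 e3" and f: "oct_frame f1 f2 f3"
  shows "conjugate_in Spin7 (frame_group e1 e2 e3) (frame_group f1 f2 f3)"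
proof -
  have fi: "f1 \<in> imag_oct" "f2 \<in> imag_oct" "f3 \<in> imag_oct" and fo: "f1 \<bullet> f2 = 0" "f2 \<bullet> f3 = 0" "f1 \<bullet> f3 = 0"
    using f by (auto simp: oct_frame_def inner_commute)
  have ei: "e1 \<in> imag_oct" "e2 \<in> imag_oct" "e3 \<in> imag_oct" and eo: "e1 \<bullet> e2 = 0" "e2 \<bullet> e3 = 0" "e1 \<bullet> e3 = 0"
    using e by (auto simp: oct_frame_def inner_commute)
  have imag: "T x \<in> imag_oct" if "\<And>x y. T x \<bullet> T y = x \<bullet> y" "\<And>x. x $ 1 = 0 \<Longrightarrow> T x $ 1 = 0" "x \<in> imag_oct"
    for T :: "oct \<Rightarrow> oct" and x
    using that by (simp add: imag_oct_def norm_eq_1)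
  obtain T1 where T1: "\<And>e1 e2 e3. conjugate_in Spin7 (frame_group e1 e2 e3) (frame_group (T1 e1) (T1 e2) (T1 e3))"
    "\<And>x y. T1 x \<bullet> T1 y = x \<bullet> y" "\<And>x. x $ 1 = 0 \<Longrightarrow> T1 x $ 1 = 0" "T1 e1 = f1"
    using frame_reflection[OF ei(1) fi(1)] by metis
  have T1i: "T1 x \<in> imag_oct" if "x \<in> imag_oct" for x by (rule imag[OF T1(2) _ that]) (rule T1(3))
  obtain T2 where T2: "\<And>e1 e2 e3. conjugate_in Spin7 (frame_group e1 e2 e3) (frame_group (T2 e1) (T2 e2) (T2 e3))"
    "\<And>x y. T2 x \<bullet> T2 y = x \<bullet> y" "\<And>x. x $ 1 = 0 \<Longrightarrow> T2 x $ 1 = 0" "T2 (T1 e2) = f2"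
    "\<And>x. x $ 1 = 0 \<Longrightarrow> x \<bullet> T1 e2 = 0 \<Longrightarrow> x \<bullet> f2 = 0 \<Longrightarrow> T2 x = x"
    using frame_reflection[OF T1i[OF ei(2)] fi(2)] by metis
  have T2i: "T2 x \<in> imag_oct" if "x \<in> imag_oct" for x by (rule imag[OF T2(2) _ that]) (rule T2(3))
  have "f1 \<bullet> T1 e2 = 0" using T1(2)[of e1 e2] T1(4) eo(1) by simp
  then have T2f: "T2 f1 = f1" using fi(1) fo(1) by (intro T2(5)) (auto simp: imag_oct_def)
  obtain T3 where T3: "\<And>e1 e2 e3. conjugate_in Spin7 (frame_group e1 e2 e3) (frame_group (T3 e1) (T3 e2) (T3 e3))"
    "T3 (T2 (T1 e3)) = f3"
    "\<And>x. x $ 1 = 0 \<Longrightarrow> x \<bullet> T2 (T1 e3) = 0 \<Longrightarrow> x \<bullet> f3 = 0 \<Longrightarrow> T3 x = x"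
    using frame_reflection[OF T2i[OF T1i[OF ei(3)]] fi(3)] by metis
  have "f1 \<bullet> T2 (T1 e3) = 0" using T2(2)[of f1 "T1 e3"] T1(2)[of e1 e3] T1(4) T2f eo(3) by simp
  then have T3f1: "T3 f1 = f1" using fi(1) fo(3) by (intro T3(3)) (auto simp: imag_oct_def)
  have "f2 \<bullet> T2 (T1 e3) = 0" using T2(2)[of "T1 e2" "T1 e3"] T1(2)[of e2 e3] T2(4) eo(2) by simp
  then have T3f2: "T3 f2 = f2" using fi(2) fo(2) by (intro T3(3)) (auto simp: imag_oct_def)
  have sub: "frame_group a b c \<subseteq> carrier Spin7" for a b c by (auto simp: frame_group_def)
  have "conjugate_in Spin7 (frame_group e1 e2 e3) (frame_group f1 (T1 e2) (T1 e3))" using T1(1)[of e1 e2 e3] T1(4) by simp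
  moreover have "conjugate_in Spin7 (frame_group f1 (T1 e2) (T1 e3)) (frame_group f1 f2 (T2 (T1 e3)))"
    using T2(1)[of f1 "T1 e2" "T1 e3"] T2f T2(4) by simp
  moreover have "conjugate_in Spin7 (frame_group f1 f2 (T2 (T1 e3))) (frame_group f1 f2 f3)"
    using T3(1)[of f1 f2 "T2 (T1 e3)"] T3f1 T3f2 T3(2) by simp
  ultimately show ?thesis using conjugate_in_trans[OF group_Spin7 sub] by blast
qed

theorem free_Spin7_subgroups_conjugate:
  assumes "K \<in> free_subgroups Spin7 SU2 S6xS7 spin_act" "K' \<in> free_subgroups Spin7 SU2 S6xS7 spin_act"
  shows "conjugate_in Spin7 K K'"
  using free_Spin7_subgroup_is_frame_group[OF assms(1)] free_Spin7_subgroup_is_frame_group[OF assms(2)]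
    frame_groups_conjugate by metis

lemma conjugate_subgroups_equivalent:
  assumes K: "subgroup K Spin7" and conj: "conjugate_in Spin7 K K'"
  shows "equivalent_actions (as_group Spin7 K) S6xS7 spin_act (as_group Spin7 K') S6xS7 spin_act"
proof -
  interpret group Spin7 by (rule group_Spin7)
  obtain G H where g: "(G, H) \<in> carrier Spin7" and K': "K' = (\<lambda>h. (G, H) \<otimes>\<^bsub>Spin7\<^esub> h \<otimes>\<^bsub>Spin7\<^esub> inv\<^bsub>Spin7\<^esub> (G, H)) ` K"
    using conj unfolding conjugate_in_def by (metis surj_pair)
  have r: "rotation_matrix G" "rotation_matrix H" using g by (auto simp: carrier_Spin7)
  let ?c = "\<lambda>h. (G ** fst h ** transpose G, H ** snd h ** transpose H)"
  let ?c' = "\<lambda>h. (transpose G ** fst h ** G, transpose H ** snd h ** H)"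
  have c: "K' = ?c ` K" using K' by (simp add: inv_Spin7[OF g])
  have cc: "transpose R ** (R ** X ** transpose R) ** R = X" "R ** (transpose R ** X ** R) ** transpose R = X"
    if R: "rotation_matrix R" for R X :: "real^8^8"
    by (simp_all add: matrix_eq matrix_vector_mul_assoc[symmetric] rotation_matrix_cancel[OF R])
  have lin: "linear (\<lambda>h. (P ** fst h ** P', Q ** snd h ** Q'))" for P P' Q Q' :: "real^8^8"
    by (auto intro!: linearI simp: matrix_eq matrix_vector_mul_assoc[symmetric] matrix_vector_mult_add_rdistrib matrix_vector_right_distrib
        scaleR_matrix_vector_assoc[symmetric] linear_scale[OF matrix_vector_mul_linear])
  have d: "diffeomorphism K K' ?c"
    by (rule diffeomorphismI[of _ _ _ ?c'])
       (auto intro!: smooth_mapI smooth_on_linear lin simp: c cc r)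
  have "?c \<in> hom (as_group Spin7 K) (as_group Spin7 K')"
    by (auto simp: hom_def c matrix_eq matrix_vector_mul_assoc[symmetric] rotation_matrix_cancel r)
  then have iso: "lie_group_iso (as_group Spin7 K) (as_group Spin7 K') ?c"
    using d by (auto simp: lie_group_iso_def iso_def diffeomorphism_def)
  let ?F = "\<lambda>m. (G *v fst m, H *v snd m)" and ?F' = "\<lambda>m. (transpose G *v fst m, transpose H *v snd m)"
  have F: "?F = spin_act (G, H)" "?F' = spin_act (transpose G, transpose H)" by (auto simp: spin_act_def)
  have i: "(transpose G, transpose H) \<in> carrier Spin7" using inv_closed[OF g] by (simp only: inv_Spin7[OF g])
  have linF: "linear (\<lambda>m. (P *v fst m, Q *v snd m))" for P Q :: "real^8^8"
    by (auto intro!: linearI simp: matrix_vector_right_distrib linear_scale[OF matrix_vector_mul_linear])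
  have "diffeomorphism S6xS7 S6xS7 ?F"
  proof (rule diffeomorphismI[of _ _ _ ?F'])
    show "smooth_map S6xS7 S6xS7 ?F"
      by (intro smooth_mapI smooth_on_linear linF) (simp add: F spin_act_S6xS7[OF g])
    show "smooth_map S6xS7 S6xS7 ?F'"
      by (intro smooth_mapI smooth_on_linear linF) (simp add: F spin_act_S6xS7[OF i])
  qed (simp_all add: rotation_matrix_cancel r)
  moreover have "?F (spin_act h m) = spin_act (?c h) (?F m)" for h m
    by (cases h; cases m) (simp add: spin_act_def matrix_vector_mul_assoc[symmetric] rotation_matrix_cancel r)
  ultimately show ?thesis
    unfolding equivalent_actions_def using iso by (intro exI[of _ ?c] exI[of _ ?F] conjI ballI)
qed

text \<open>  A conjugating element of Spin(7) is itself an equivariant linear diffeomorphism, so it suffices to know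
  the action of \<open>std_group\<close>.\<close>

theorem free_Spin7_subgroup_equivalent_to_act_b:
  assumes K: "K \<in> free_subgroups Spin7 SU2 S6xS7 spin_act"
  shows "equivalent_actions (as_group Spin7 K) S6xS7 spin_act SU2 S6xS7 act_b"
proof -
  have "equivalent_actions (as_group Spin7 K) S6xS7 spin_act (as_group Spin7 std_group) S6xS7 spin_act"
    using K free_Spin7_subgroups_conjugate[OF K std_group_free_Spin7]
    by (intro conjugate_subgroups_equivalent) (auto simp: free_subgroups_def)
  then show ?thesis
    by (rule equivalent_actions_trans) (simp add: as_group_Spin7 std_equivalent_act_b)
qed

section \<open>Subgroups isomorphic to SO(3)\<close>

text \<open>A half-turn about an axis does not commute with the cyclic permutation of the three axes.\<close>

lemma SO3_noncentral_involution:
  obtains D P :: "real^3^3" where "D \<in> carrier SO" "P \<in> carrier SO" "D ** D = mat 1" "D \<noteq> mat 1" "D ** P \<noteq> P ** D"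
proof -
  let ?D = "vector [vector [1, 0, 0], vector [0, - 1, 0], vector [0, 0, - 1]] :: real^3^3"
  let ?P = "vector [vector [0, 1, 0], vector [0, 0, 1], vector [1, 0, 0]] :: real^3^3"
  note defs = orthogonal_matrix vec_eq_iff forall_3 matrix_matrix_mult_def sum_3 transpose_def mat_def
  have "orthogonal_matrix ?D" by (simp add: defs)
  moreover have "orthogonal_matrix ?P" by (simp add: defs)
  moreover have "det ?D = 1" "det ?P = 1" by (simp_all add: det_3)
  moreover have "?D ** ?D = mat 1" by (simp add: defs)
  moreover have "(?D ** ?P) $ 1 $ 2 \<noteq> (?P ** ?D) $ 1 $ 2" by (simp add: matrix_matrix_mult_def sum_3)
  then have "?D ** ?P \<noteq> ?P ** ?D" by metis
  moreover have "?D $ 2 $ 2 \<noteq> (mat 1 :: real^3^3) $ 2 $ 2" by (simp add: mat_def)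
  then have "?D \<noteq> mat 1" by metis
  ultimately show ?thesis using that[of ?D ?P] by (simp add: rotation_matrix_def)
qed

lemma iso_SO3_noncentral_involution:
  assumes L: "subgroup L Spin8" and \<phi>: "\<phi> \<in> iso (as_group Spin8 L) (SO :: (real^3^3) monoid)"
  obtains a h where "a \<in> L" "h \<in> L" "a \<otimes>\<^bsub>Spin8\<^esub> a = \<one>\<^bsub>Spin8\<^esub>" "a \<noteq> \<one>\<^bsub>Spin8\<^esub>" "a \<otimes>\<^bsub>Spin8\<^esub> h \<noteq> h \<otimes>\<^bsub>Spin8\<^esub> a"
proof -
  obtain D P :: "real^3^3" where DP: "D \<in> carrier SO" "P \<in> carrier SO" "D ** D = mat 1" "D \<noteq> mat 1" "D ** P \<noteq> P ** D"
    by (rule SO3_noncentral_involution)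
  have hom: "\<And>x y. x \<in> L \<Longrightarrow> y \<in> L \<Longrightarrow> \<phi> (x \<otimes>\<^bsub>Spin8\<^esub> y) = \<phi> x ** \<phi> y"
    and bij: "bij_betw \<phi> L (carrier SO)"
    using \<phi> by (auto simp: iso_def hom_def simp del: mult_Spin8)
  obtain a h where ah: "a \<in> L" "h \<in> L" "\<phi> a = D" "\<phi> h = P"
    using DP(1,2) unfolding bij_betw_imp_surj_on[OF bij, symmetric] by blast
  have one: "\<phi> \<one>\<^bsub>Spin8\<^esub> = mat 1"
  proof -
    have "\<one>\<^bsub>Spin8\<^esub> \<in> L" by (rule subgroup.one_closed[OF L])
    then have e: "\<phi> \<one>\<^bsub>Spin8\<^esub> ** \<phi> \<one>\<^bsub>Spin8\<^esub> = \<phi> \<one>\<^bsub>Spin8\<^esub>" and "\<phi> \<one>\<^bsub>Spin8\<^esub> \<in> carrier SO"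
      using hom[of "\<one>\<^bsub>Spin8\<^esub>" "\<one>\<^bsub>Spin8\<^esub>"] bij_betwE[OF bij] by auto
    then have r: "rotation_matrix (\<phi> \<one>\<^bsub>Spin8\<^esub>)" by simp
    then show ?thesis
      using arg_cong[OF e, of "\<lambda>X. transpose (\<phi> \<one>\<^bsub>Spin8\<^esub>) ** X"]
      by (simp only: matrix_mul_assoc rotation_matrix_cancel[OF r] matrix_mul_lid)
  qed
  have "\<phi> (a \<otimes>\<^bsub>Spin8\<^esub> a) = \<phi> \<one>\<^bsub>Spin8\<^esub>" unfolding hom[OF ah(1,1)] one ah(3) by (rule DP(3))
  moreover have "a \<otimes>\<^bsub>Spin8\<^esub> a \<in> L" "\<one>\<^bsub>Spin8\<^esub> \<in> L" using subgroup.m_closed[OF L ah(1,1)] subgroup.one_closed[OF L] by auto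
  ultimately have "a \<otimes>\<^bsub>Spin8\<^esub> a = \<one>\<^bsub>Spin8\<^esub>" using bij unfolding bij_betw_def inj_on_def by blast
  moreover have "a \<noteq> \<one>\<^bsub>Spin8\<^esub>" using DP(4) ah(3) one by auto
  moreover have "a \<otimes>\<^bsub>Spin8\<^esub> h \<noteq> h \<otimes>\<^bsub>Spin8\<^esub> a" using hom[OF ah(1,2)] hom[OF ah(2,1)] ah DP(5) by metis
  ultimately show ?thesis using that ah by blast
qed

lemma scalar_sign_commute:
  fixes A M :: "real^'n^'n"
  assumes "(\<forall>x. A *v x = x) \<or> (\<forall>x. A *v x = - x)"
  shows "A ** M = M ** A"
  using assms by (auto simp: matrix_eq matrix_vector_mul_assoc[symmetric] linear_neg[OF matrix_vector_mul_linear])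

text \<open>  By \<open>triality_involution_signs\<close>, freeness makes every involution of the group central, contrary to the
  structure of SO(3).\<close>

lemma no_free_SO3:
  assumes L: "subgroup L Spin8" and \<phi>: "\<phi> \<in> iso (as_group Spin8 L) (SO :: (real^3^3) monoid)"
    and nofix: "\<And>A B x y. (A, B) \<in> L \<Longrightarrow> (A, B) \<noteq> \<one>\<^bsub>Spin8\<^esub> \<Longrightarrow> A *v x = x \<Longrightarrow> B *v y = y \<Longrightarrow> x = 0 \<or> y = 0"
  shows False
proof -
  obtain a h where a: "a \<in> L" "a \<otimes>\<^bsub>Spin8\<^esub> a = \<one>\<^bsub>Spin8\<^esub>" "a \<noteq> \<one>\<^bsub>Spin8\<^esub>" "a \<otimes>\<^bsub>Spin8\<^esub> h \<noteq> h \<otimes>\<^bsub>Spin8\<^esub> a"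
    using iso_SO3_noncentral_involution[OF L \<phi>] by metis
  obtain A B where AB: "a = (A, B)" by (cases a)
  have "(A, B) \<in> carrier Spin8" using a(1) subgroup.mem_carrier[OF L] by (simp add: AB)
  then obtain C where rot: "rotation_matrix A" "rotation_matrix B" and t: "triality A B C" by (auto simp: carrier_Spin8)
  have sq: "A ** A = mat 1" "B ** B = mat 1" using a(2) by (auto simp: AB)
  have "(\<forall>x. A *v x = - x) \<and> ((\<forall>y. B *v y = y) \<or> (\<forall>y. B *v y = - y)) \<or>
    (\<forall>y. B *v y = - y) \<and> ((\<forall>x. A *v x = x) \<or> (\<forall>x. A *v x = - x))"
  proof (rule triality_involution_signs)
    show "oct_mult (A *v x) (B *v y) = C *v oct_mult x y" for x y using t by (simp add: triality_def)
    show "A *v x = x \<Longrightarrow> B *v y = y \<Longrightarrow> x = 0 \<or> y = 0" for x y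
      using nofix a by (simp only: AB)
  qed (simp_all add: matrix_vector_mul_assoc sq rotation_matrix_norm rot)
  then have "A ** fst h = fst h ** A" "B ** snd h = snd h ** B" by (auto intro!: scalar_sign_commute)
  then show False using a(4) by (simp add: AB)
qed

lemma no_free_SO3_Spin8: "free_subgroups Spin8 (SO :: (real^3^3) monoid) S7xS7 spin_act = {}"
proof (rule equals0I)
  fix L assume "L \<in> free_subgroups Spin8 (SO :: (real^3^3) monoid) S7xS7 spin_act"
  then obtain \<phi> where L: "subgroup L Spin8" and \<phi>: "\<phi> \<in> iso (as_group Spin8 L) (SO :: (real^3^3) monoid)"
    and free: "\<And>g m. g \<in> L \<Longrightarrow> m \<in> S7xS7 \<Longrightarrow> spin_act g m = m \<Longrightarrow> g = \<one>\<^bsub>Spin8\<^esub>"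
    by (auto simp: free_subgroups_def free_action_def lie_group_iso_def)
  show False
  proof (rule no_free_SO3[OF L \<phi>], rule ccontr)
    fix A B and x y :: oct
    assume g: "(A, B) \<in> L" "(A, B) \<noteq> \<one>\<^bsub>Spin8\<^esub>" and fixed: "A *v x = x" "B *v y = y" and "\<not> (x = 0 \<or> y = 0)"
    then have "(x /\<^sub>R norm x, y /\<^sub>R norm y) \<in> S7xS7" by (simp add: S7xS7_def)
    moreover have "spin_act (A, B) (x /\<^sub>R norm x, y /\<^sub>R norm y) = (x /\<^sub>R norm x, y /\<^sub>R norm y)"
      by (simp add: spin_act_def linear_scale[OF matrix_vector_mul_linear] fixed)
    ultimately show False using free g by blast
  qed
qed

lemma no_free_SO3_Spin7: "free_subgroups Spin7 (SO :: (real^3^3) monoid) S6xS7 spin_act = {}"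
proof (rule equals0I)
  fix L assume "L \<in> free_subgroups Spin7 (SO :: (real^3^3) monoid) S6xS7 spin_act"
  then obtain \<phi> where L: "subgroup L Spin7" and \<phi>: "\<phi> \<in> iso (as_group Spin8 L) (SO :: (real^3^3) monoid)"
    and fa: "free_action (as_group Spin8 L) S6xS7 spin_act"
    unfolding free_subgroups_def as_group_Spin7 lie_group_iso_def by blast
  have free: "\<forall>g\<in>L. \<forall>m\<in>S6xS7. spin_act g m = m \<longrightarrow> g = \<one>\<^bsub>Spin8\<^esub>"
    using fa by (simp add: free_action_def)
  show False
  proof (rule no_free_SO3[OF subgroup_Spin7_Spin8[OF L] \<phi>], rule disjI2, rule ccontr)
    fix A B and x y :: oct
    assume g: "(A, B) \<in> L" "(A, B) \<noteq> \<one>\<^bsub>Spin8\<^esub>" and fixed: "B *v y = y" "y \<noteq> 0"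
    have AB: "(A, B) \<in> carrier Spin7" using subgroup.mem_carrier[OF L g(1)] .
    then have "rotation_matrix A" by (simp add: carrier_Spin7)
    then obtain e where e: "norm e = 1" "e $ 1 = 0" "A *v e = e"
      using rotation_fixing_one_fixes_equator_point Spin7_fixes_one[OF AB] by blast
    then have "(e, y /\<^sub>R norm y) \<in> S6xS7" using fixed(2) by (simp add: S6xS7_def S7xS7_def)
    moreover have "spin_act (A, B) (e, y /\<^sub>R norm y) = (e, y /\<^sub>R norm y)"
      by (simp add: spin_act_def linear_scale[OF matrix_vector_mul_linear] fixed e)
    ultimately show False using free g by blast
  qed
qed

theorem theorem7p11:
  shows
    "(free_subgroups Spin8 SU2 S7xS7 spin_act \<noteq> {} \<and>
      (\<forall>L \<in> free_subgroups Spin8 SU2 S7xS7 spin_act.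
       \<forall>L' \<in> free_subgroups Spin8 SU2 S7xS7 spin_act.
         equivalent_actions (as_group Spin8 L) S7xS7 spin_act (as_group Spin8 L') S7xS7 spin_act)) \<and>
     (\<forall>L \<in> free_subgroups Spin8 SU2 S7xS7 spin_act.
        equivalent_actions (as_group Spin8 L) S7xS7 spin_act SU2 S7xS7 act_a \<and>
        equivalent_actions (as_group Spin8 L) S7xS7 spin_act SU2 S7xS7 act_b) \<and>
     (free_subgroups Spin7 SU2 S6xS7 spin_act \<noteq> {} \<and>
      (\<forall>K \<in> free_subgroups Spin7 SU2 S6xS7 spin_act.
       \<forall>K' \<in> free_subgroups Spin7 SU2 S6xS7 spin_act. conjugate_in Spin7 K K')) \<and>
     (\<forall>K \<in> free_subgroups Spin7 SU2 S6xS7 spin_act.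
        equivalent_actions (as_group Spin7 K) S6xS7 spin_act SU2 S6xS7 act_b) \<and>
     free_subgroups Spin8 (SO :: (real^3^3) monoid) S7xS7 spin_act = {} \<and>
     free_subgroups Spin7 (SO :: (real^3^3) monoid) S6xS7 spin_act = {}"
proof (intro conjI ballI)
  show "free_subgroups Spin8 SU2 S7xS7 spin_act \<noteq> {}" using std_group_free_Spin8 by blast
  show "free_subgroups Spin7 SU2 S6xS7 spin_act \<noteq> {}" using std_group_free_Spin7 by blast
qed (simp_all add: free_SU2_subgroup_equivalent_to_hopf free_SU2_subgroup_equivalent_to_act_b
      free_Spin7_subgroups_conjugate free_Spin7_subgroup_equivalent_to_act_b no_free_SO3_Spin8 no_free_SO3_Spin7)

end
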